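(* Let $p\ge1$ and let $D$ be a doubly-infinite $p$-banded matrix with $D\in\mathcal{P}_p(\beta)$, where $0<\beta<\frac12$. Then $E_D$ is a closed set of Lebesgue measure zero, and its convergence exponent satisfies $$\dim E_D\le\tau(E_D)\le\frac{1-2\beta}{1-\beta},$$ where $\dim E_D$ is the Hausdorff dimension of $E_D$. Moreover, if $D\in\mathcal{P}_p(\frac12)$, then $E_D=\emptyset$, i.e., the discrete spectrum is finite.
   Context: A doubly-infinite complex matrix $D=\|d_{ij}\|_{i,j=-\infty}^\infty$ is called banded of order $p$ if $d_{ij}=0$ for $|i-j|>p$ and $d_{ij}\ne0$ for $|i-j|=p$. For $0<\beta<1$ it belongs to the class $\mathcal{P}_p(\beta)$ if there are constants $C_1,C_2>0$ such that for all $n\in\mathbb{Z}$ $$q_n:=|d_{n,n-p}-1|+\sum_{j=-p+1}^{p-1}|d_{n,n+j}|+|d_{n,n+p}-1|\le C_1\exp(-C_2|n|^\beta).$$ Such a $D$ defines a bounded operator on $\ell^2(\mathbb{Z})$ which is a compact perturbation of the operator with entries $1$ for $|i-j|=p$ and $0$ otherwise, whose spectrum is $[-2,2]$. Hence $\sigma(D)=[-2,2]\cup\sigma_{\rm d}(D)$, where the discrete spectrum $\sigma_{\rm d}(D)$ is the at most countable set of eigenvalues (of finite algebraic multiplicity) of $D$ in $\mathbb{C}\setminus[-2,2]$, whose accumulation points all lie in $[-2,2]$. $E_D\subset[-2,2]$ denotes the set of all accumulation points of $\sigma_{\rm d}(D)$. The convergence exponent (Taylor–Besicovitch index) of a closed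 set $F\subset[-2,2]$ is $\tau(F):=\inf\{\varepsilon>0:\ \sum_j|l_j|^\varepsilon<\infty\}$, where $\{l_j\}$ are the adjacent intervals of $F$ (the connected components of $[-2,2]\setminus F$) and $|l_j|$ is the length of $l_j$. *)

theory Defs
  imports "HOL-Analysis.Analysis" "HOL-Library.Function_Algebras"
begin

definition banded :: "nat \<Rightarrow> (int \<Rightarrow> int \<Rightarrow> complex) \<Rightarrow> bool" where
  "banded p D \<longleftrightarrow>
     (\<forall>i j. \<bar>i - j\<bar> > int p \<longrightarrow> D i j = 0) \<and>
     (\<forall>i j. \<bar>i - j\<bar> = int p \<longrightarrow> D i j \<noteq> 0)"

definition q_dev :: "nat \<Rightarrow> (int \<Rightarrow> int \<Rightarrow> complex) \<Rightarrow> int \<Rightarrow> real" where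
  "q_dev p D n =
     cmod (D n (n - int p) - 1)
     + (\<Sum>j = - int p + 1..int p - 1. cmod (D n (n + j)))
     + cmod (D n (n + int p) - 1)"

definition P_class :: "nat \<Rightarrow> real \<Rightarrow> (int \<Rightarrow> int \<Rightarrow> complex) set" where
  "P_class p \<beta> = {D. banded p D \<and>
     (\<exists>C1>0. \<exists>C2>0. \<forall>n. q_dev p D n \<le> C1 * exp (- C2 * \<bar>real_of_int n\<bar> powr \<beta>))}"

definition ell2 :: "(int \<Rightarrow> complex) set" where
  "ell2 = {u. (\<lambda>n. (cmod (u n))\<^sup>2) summable_on UNIV}"

text \<open>For a banded matrix the sum is finite, so this is defined on every sequence.\<close>

definition mat_op :: "(int \<Rightarrow> int \<Rightarrow> complex) \<Rightarrow> (int \<Rightarrow> complex) \<Rightarrow> int \<Rightarrow> complex" where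
  "mat_op D u = (\<lambda>i. \<Sum>\<^sub>\<infinity>j. D i j * u j)"

definition eigenvalue :: "(int \<Rightarrow> int \<Rightarrow> complex) \<Rightarrow> complex \<Rightarrow> bool" where
  "eigenvalue D z \<longleftrightarrow>
     (\<exists>u\<in>ell2. u \<noteq> (\<lambda>_. 0) \<and> mat_op D u = (\<lambda>n. z * u n))"

definition root_space :: "(int \<Rightarrow> int \<Rightarrow> complex) \<Rightarrow> complex \<Rightarrow> (int \<Rightarrow> complex) set" where
  "root_space D z =
     {u\<in>ell2. \<exists>k. ((\<lambda>v n. mat_op D v n - z * v n) ^^ k) u = (\<lambda>_. 0)}"

interpretation cseq: vector_space "\<lambda>c (u :: int \<Rightarrow> complex) n. c * u n"
  by unfold_locales (auto simp: fun_eq_iff algebra_simps)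

text \<open>The algebraic multiplicity is the complex dimension of the root space. Its finiteness is
  expressed through a finite spanning set, because \<open>cseq.dim\<close> has a junk value on
  infinite-dimensional spaces.\<close>

definition finite_alg_mult :: "(int \<Rightarrow> int \<Rightarrow> complex) \<Rightarrow> complex \<Rightarrow> bool" where
  "finite_alg_mult D z \<longleftrightarrow> (\<exists>B. finite B \<and> root_space D z \<subseteq> cseq.span B)"

definition discrete_spectrum :: "(int \<Rightarrow> int \<Rightarrow> complex) \<Rightarrow> complex set" where
  "discrete_spectrum D =
     {z. z \<notin> complex_of_real ` {-2..2} \<and> eigenvalue D z \<and> finite_alg_mult D z}"

text \<open>Limit points are taken in \<open>\<complex>\<close>; that they all lie in the segment \<open>[-2,2]\<close> is not built in.\<close>

definition E_set :: "(int \<Rightarrow> int \<Rightarrow> complex) \<Rightarrow> complex set" where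
  "E_set D = {z. z islimpt discrete_spectrum D}"

definition adjacent_intervals :: "real set \<Rightarrow> real set set" where
  "adjacent_intervals F = components ({-2..2} - F)"

definition conv_exponent :: "real set \<Rightarrow> real" where
  "conv_exponent F =
     Inf {\<epsilon>. \<epsilon> > 0 \<and> (\<lambda>l. measure lborel l powr \<epsilon>) summable_on adjacent_intervals F}"

text \<open>Only exponents \<open>s > 0\<close> are used: since \<open>0 powr 0 = 0\<close>, the formula for \<open>s = 0\<close> would
  not give the counting measure. The infimum defining the dimension does not depend on \<open>s = 0\<close>,
  and with this convention the empty set has dimension \<open>0\<close>.\<close>

definition hausdorff_content :: "real \<Rightarrow> real \<Rightarrow> 'a::metric_space set \<Rightarrow> ennreal" where
  "hausdorff_content s \<delta> A =
     (INF U\<in>{U :: nat \<Rightarrow> 'a set. A \<subseteq> (\<Union>i. U i) \<and> (\<forall>i. bounded (U i) \<and> diameter (U i) \<le> \<delta>)}.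
        \<Sum>i. ennreal (diameter (U i) powr s))"

definition hausdorff_measure :: "real \<Rightarrow> 'a::metric_space set \<Rightarrow> ennreal" where
  "hausdorff_measure s A = (SUP \<delta>\<in>{0<..}. hausdorff_content s \<delta> A)"

definition hausdorff_dim :: "'a::metric_space set \<Rightarrow> ereal" where
  "hausdorff_dim A = (INF s\<in>{s::real. s > 0 \<and> hausdorff_measure s A = 0}. ereal s)"

end

theory Submission
  imports Defs "HOL-Complex_Analysis.Complex_Analysis" "HOL-Real_Asymp.Real_Asymp"
begin

text \<open>
  Write \<open>z = \<zeta> + 1/\<zeta>\<close> with \<open>\<bar>\<zeta>\<bar> < 1\<close>. Cutting the free operator into half-line Laplacians makes its resolvent
  kernel a polynomial in \<open>\<zeta>\<close>, and an eigenvector \<open>u\<close> of \<open>D\<close> yields a null vector of \<open>I + V R(\<zeta>)\<close>, where \<open>V\<close>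
  is the (decaying) perturbation. Eliminating all but finitely many coordinates by a Neumann series, and these by
  fraction-free Gauss elimination, gives a power series \<open>F = \<Sum> a\<^sub>n \<zeta>\<^sup>n\<close> with
  \<open>\<Sum> \<bar>a\<^sub>n\<bar> exp (c n\<^sup>\<beta>) < \<infinity>\<close> and \<open>F 0 = 1\<close>, which vanishes at every \<open>\<zeta>\<close> belonging to an eigenvalue.
  At a point \<open>e\<close> of the unit circle that is a limit of zeros, \<open>F\<close> vanishes to infinite order, and Taylor's
  formula gives \<open>\<bar>F \<zeta>\<bar> \<le> B exp (- (L \<bar>\<zeta> - e\<bar>)\<^sup>-\<^sup>\<gamma>)\<close> with \<open>\<gamma> = \<beta> / (1 - \<beta>)\<close>. Jensen's inequality then bounds the integral
  of the function \<open>dist (\<sqdot>, E)\<^sup>-\<^sup>\<gamma>\<close> over the circle. Hence \<open>E\<close> is a null set, the gaps satisfy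
  \<open>\<Sum> \<bar>l\<bar>\<^sup>1\<^sup>-\<^sup>\<gamma> < \<infinity>\<close>, and for \<open>\<gamma> = 1\<close> the integral diverges unless \<open>E\<close> is empty.
\<close>

section \<open>Power series with weighted summable coefficients\<close>

text \<open>Only the implication from eigenvalue to zero is used. This leaves freedom in building F:
  the elimination may multiply it by pivots, which can add zeros. The equation is posed for v = V u
  because v inherits the decay of V, and the kernel of V R(\<zeta>) is then dominated by a row
  factor times a column factor whose diagonal is summable. Zeros may accumulate at \<zeta> = 1 and
  \<zeta> = -1, where the whole-line resolvent has a pole; the cut trades this pole for linear
  growth of the kernel, which the decay of V absorbs. The exponent \<gamma> comes from a balance:
  the weight exp (c n^\<beta>) bounds the K-th derivative on the closed disc by about (const
  K)^(K/\<beta>), so the Taylor remainder at distance d is about (const K^(1/\<beta> - 1) d)^K, and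
  the best order is K ~ d^(-\<beta>/(1-\<beta>)). At \<beta> = 1/2 this gives \<gamma> = 1, the
  exponent at which dist^(-\<gamma>) stops being integrable near even a single point. The singular
  integral itself is never formed: finite step functions below its integrand carry all the
  information.\<close>

definition wnorm_le :: "(nat \<Rightarrow> real) \<Rightarrow> (complex \<Rightarrow> complex) \<Rightarrow> real \<Rightarrow> bool" where
  "wnorm_le w f K \<longleftrightarrow> (\<exists>a. (\<forall>F. finite F \<longrightarrow> (\<Sum>n\<in>F. cmod (a n) * w n) \<le> K) \<and>
     (\<forall>z. cmod z \<le> 1 \<longrightarrow> ((\<lambda>n. a n * z ^ n) has_sum f z) UNIV))"

lemma norm_summable_onI:
  fixes f :: "'a \<Rightarrow> 'b::real_normed_vector"
  assumes "\<And>F. finite F \<Longrightarrow> F \<subseteq> I \<Longrightarrow> (\<Sum>t\<in>F. norm (f t)) \<le> K"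
  shows "(\<lambda>t. norm (f t)) summable_on I"
  using assms by (intro nonneg_bdd_above_summable_on bdd_aboveI2[where M = K]) auto

text \<open>Submultiplicativity turns the power series of finite weighted norm into an algebra (a
  Beurling algebra), and \<open>1 \<le> w n\<close> makes the norm dominate the supremum on the
  closed disc. Since \<open>wnorm_le\<close> only bounds the norm, coefficients stay hidden and no
  norm has to be computed.\<close>

locale weight =
  fixes w :: "nat \<Rightarrow> real"
  assumes w_ge1: "1 \<le> w n" and w_submult: "w (m + n) \<le> w m * w n"
begin

lemma w_pos: "0 < w n" using w_ge1[of n] by linarith

lemma power_le_w: "cmod z \<le> 1 \<Longrightarrow> cmod z ^ n \<le> w n"
  using power_le_one[of "cmod z" n] w_ge1[of n] by simp

lemma power_family_abs_summable:
  fixes a :: "'t \<Rightarrow> complex"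
  assumes "\<And>F. finite F \<Longrightarrow> F \<subseteq> I \<Longrightarrow> (\<Sum>t\<in>F. cmod (a t) * w (N t)) \<le> K"
    and z: "cmod z \<le> 1"
  shows "(\<lambda>t. cmod (a t * z ^ N t)) summable_on I"
proof (rule norm_summable_onI[where K = K])
  fix F assume F: "finite F" "F \<subseteq> I"
  have "(\<Sum>t\<in>F. norm (a t * z ^ N t)) \<le> (\<Sum>t\<in>F. cmod (a t) * w (N t))"
    unfolding norm_mult norm_power
    by (intro sum_mono mult_left_mono power_le_w z norm_ge_zero)
  then show "(\<Sum>t\<in>F. norm (a t * z ^ N t)) \<le> K" using assms(1)[OF F] by linarith
qed

text \<open>Monomials of equal exponent are collected: \<open>B n\<close> is the fibre of exponent n
  and \<open>b n\<close> its total coefficient. Infinite sums and products of series are instances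
  with pairs as indices.\<close>

lemma wnorm_le_family:
  fixes a :: "'t \<Rightarrow> complex"
  assumes bd: "\<And>F. finite F \<Longrightarrow> F \<subseteq> I \<Longrightarrow> (\<Sum>t\<in>F. cmod (a t) * w (N t)) \<le> K"
  shows "wnorm_le w (\<lambda>z. \<Sum>\<^sub>\<infinity>t\<in>I. a t * z ^ N t) K"
proof -
  define B where "B n = {t\<in>I. N t = n}" for n
  define b where "b n = (\<Sum>\<^sub>\<infinity>t\<in>B n. a t)" for n
  have sw: "(\<lambda>t. cmod (a t) * w (N t)) summable_on I"
    using norm_summable_onI[of I "\<lambda>t. cmod (a t) * w (N t)" K] bd w_pos by (simp add: abs_mult less_imp_le)
  have sa: "(\<lambda>t. cmod (a t)) summable_on I"
  proof -
    have "(\<lambda>t. cmod (a t * 1 ^ N t)) summable_on I"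
      by (rule power_family_abs_summable[where K = K]) (rule bd, auto)
    then show ?thesis by simp
  qed
  have BI: "B n \<subseteq> I" for n by (auto simp: B_def)
  have saB: "(\<lambda>t. cmod (a t)) summable_on B n" for n
    using sa BI by (rule summable_on_subset_banach)
  have swB: "(\<lambda>t. cmod (a t) * w (N t)) summable_on B n" for n
    using sw BI by (rule summable_on_subset_banach)
  have "(\<Sum>n\<in>F. cmod (b n) * w n) \<le> K" if "finite F" for F
  proof -
    have "cmod (b n) * w n \<le> (\<Sum>\<^sub>\<infinity>t\<in>B n. cmod (a t) * w (N t))" for n
    proof -
      have "cmod (b n) * w n \<le> (\<Sum>\<^sub>\<infinity>t\<in>B n. cmod (a t)) * w n"
        unfolding b_def using norm_infsum_bound[OF saB] w_pos by (intro mult_right_mono) (auto simp: less_imp_le)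
      also have "\<dots> = (\<Sum>\<^sub>\<infinity>t\<in>B n. cmod (a t) * w n)"
        using saB by (intro infsum_cmult_left[symmetric])
      also have "\<dots> = (\<Sum>\<^sub>\<infinity>t\<in>B n. cmod (a t) * w (N t))"
        by (intro infsum_cong) (auto simp: B_def)
      finally show ?thesis .
    qed
    then have "(\<Sum>n\<in>F. cmod (b n) * w n) \<le> (\<Sum>n\<in>F. \<Sum>\<^sub>\<infinity>t\<in>B n. cmod (a t) * w (N t))"
      by (rule sum_mono)
    also have "\<dots> = (\<Sum>\<^sub>\<infinity>t\<in>(\<Union>n\<in>F. B n). cmod (a t) * w (N t))"
      using that swB by (intro sum_infsum) (auto simp: B_def)
    also have "\<dots> \<le> K"
    proof (rule infsum_le_finite_sums)
      show "(\<lambda>t. cmod (a t) * w (N t)) summable_on (\<Union>n\<in>F. B n)"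
        using sw by (rule summable_on_subset_banach) (use BI in auto)
      show "(\<Sum>t\<in>G. cmod (a t) * w (N t)) \<le> K" if "finite G" "G \<subseteq> (\<Union>n\<in>F. B n)" for G
        using that BI by (intro bd) auto
    qed
    finally show ?thesis .
  qed
  moreover have "((\<lambda>n. b n * z ^ n) has_sum (\<Sum>\<^sub>\<infinity>t\<in>I. a t * z ^ N t)) UNIV" if z: "cmod z \<le> 1" for z
  proof (rule has_sum_Sigma')
    have "((\<lambda>t. a t * z ^ N t) has_sum (\<Sum>\<^sub>\<infinity>t\<in>I. a t * z ^ N t)) I"
      by (rule has_sum_infsum, rule abs_summable_summable, rule power_family_abs_summable[OF _ z]) (rule bd)
    moreover have "bij_betw snd (Sigma UNIV B) I"
      by (rule bij_betw_byWitness[where f' = "\<lambda>t. (N t, t)"]) (auto simp: B_def)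
    ultimately have "((\<lambda>x. a (snd x) * z ^ N (snd x)) has_sum (\<Sum>\<^sub>\<infinity>t\<in>I. a t * z ^ N t)) (Sigma UNIV B)"
      by (subst has_sum_reindex_bij_betw)
    then show "((\<lambda>(n,t). a t * z ^ n) has_sum (\<Sum>\<^sub>\<infinity>t\<in>I. a t * z ^ N t)) (Sigma UNIV B)"
      by (rule has_sum_cong[THEN iffD1, rotated]) (auto simp: B_def)
    show "((\<lambda>t. case (n, t) of (n, t) \<Rightarrow> a t * z ^ n) has_sum b n * z ^ n) (B n)" for n
      unfolding b_def prod.case by (rule has_sum_cmult_left, rule has_sum_infsum, rule abs_summable_summable, rule saB)
  qed
  ultimately show ?thesis unfolding wnorm_le_def by blast
qed

section \<open>Closure properties of the weighted algebra\<close>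

lemma wnorm_le_cong:
  assumes "wnorm_le w f K" "\<And>z. cmod z \<le> 1 \<Longrightarrow> f z = g z"
  shows "wnorm_le w g K"
  using assms unfolding wnorm_le_def by auto

lemma wnorm_le_mono: "wnorm_le w f K \<Longrightarrow> K \<le> K' \<Longrightarrow> wnorm_le w f K'"
  unfolding wnorm_le_def by (meson order_trans)

lemma wnorm_le_nonneg: "wnorm_le w f K \<Longrightarrow> 0 \<le> K"
  unfolding wnorm_le_def by (metis finite.emptyI sum.empty)

lemma wnorm_le_norm:
  assumes "wnorm_le w f K" "cmod z \<le> 1"
  shows "cmod (f z) \<le> K"
proof -
  obtain a where a: "\<And>F. finite F \<Longrightarrow> (\<Sum>n\<in>F. cmod (a n) * w n) \<le> K"
    "((\<lambda>n. a n * z ^ n) has_sum f z) UNIV"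
    using assms unfolding wnorm_le_def by blast
  have "cmod (a n * z ^ n) \<le> cmod (a n) * w n" for n
    unfolding norm_mult norm_power
    by (intro mult_left_mono power_le_w assms(2) norm_ge_zero)
  then have "norm (sum (\<lambda>n. a n * z ^ n) F) \<le> K" if "finite F" for F
    using sum_norm_le[of F "\<lambda>n. a n * z ^ n" "\<lambda>n. cmod (a n) * w n"] a(1)[OF that] by fastforce
  moreover have "((\<lambda>F. norm (sum (\<lambda>n. a n * z ^ n) F)) \<longlongrightarrow> cmod (f z)) (finite_subsets_at_top UNIV)"
    using a(2) unfolding has_sum_def by (rule tendsto_norm)
  ultimately show ?thesis
    by (intro tendsto_upperbound[of _ _ "finite_subsets_at_top UNIV"])
      (auto intro: eventually_finite_subsets_at_top_weakI)
qed

lemma wnorm_le_infsum: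
  assumes f: "\<And>t. t \<in> I \<Longrightarrow> wnorm_le w (f t) (K t)" and K: "K summable_on I"
  shows "wnorm_le w (\<lambda>z. \<Sum>\<^sub>\<infinity>t\<in>I. f t z) (infsum K I)"
proof -
  have "\<forall>t\<in>I. \<exists>a. (\<forall>F. finite F \<longrightarrow> (\<Sum>n\<in>F. cmod (a n) * w n) \<le> K t) \<and>
     (\<forall>z. cmod z \<le> 1 \<longrightarrow> ((\<lambda>n. a n * z ^ n) has_sum f t z) UNIV)"
    using f unfolding wnorm_le_def by blast
  from bchoice[OF this] obtain a where a: "\<And>t F. t \<in> I \<Longrightarrow> finite F \<Longrightarrow> (\<Sum>n\<in>F. cmod (a t n) * w n) \<le> K t"
    "\<And>t z. t \<in> I \<Longrightarrow> cmod z \<le> 1 \<Longrightarrow> ((\<lambda>n. a t n * z ^ n) has_sum f t z) UNIV"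
    by blast
  define c where "c = (\<lambda>(t,n). a t n)"
  have bd: "(\<Sum>x\<in>F. cmod (c x) * w (snd x)) \<le> infsum K I" if F: "finite F" "F \<subseteq> I \<times> UNIV" for F
  proof -
    have FI: "fst ` F \<subseteq> I" using F(2) by auto
    have "(\<Sum>x\<in>F. cmod (c x) * w (snd x)) \<le> (\<Sum>x\<in>fst ` F \<times> snd ` F. cmod (c x) * w (snd x))"
      using F(1) by (intro sum_mono2 subset_fst_snd mult_nonneg_nonneg norm_ge_zero less_imp_le[OF w_pos]) auto
    also have "\<dots> = (\<Sum>t\<in>fst ` F. \<Sum>n\<in>snd ` F. cmod (a t n) * w n)"
      by (simp add: sum.cartesian_product c_def case_prod_unfold)
    also have "\<dots> \<le> sum K (fst ` F)"
      using FI F a(1) by (intro sum_mono) auto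
    also have "\<dots> \<le> infsum K I"
    proof (rule finite_sum_le_infsum[OF K _ FI])
      show "0 \<le> K t" if "t \<in> I - fst ` F" for t using f that wnorm_le_nonneg by blast
    qed (use F in auto)
    finally show ?thesis .
  qed
  have "wnorm_le w (\<lambda>z. \<Sum>\<^sub>\<infinity>x\<in>I \<times> UNIV. c x * z ^ snd x) (infsum K I)"
    by (rule wnorm_le_family) (rule bd)
  then show ?thesis
  proof (rule wnorm_le_cong)
    fix z :: complex assume z: "cmod z \<le> 1"
    have "(\<lambda>x. c x * z ^ snd x) summable_on I \<times> UNIV"
      by (rule abs_summable_summable, rule power_family_abs_summable[OF _ z]) (rule bd)
    from infsum_Sigma_banach[OF this]
    have "(\<Sum>\<^sub>\<infinity>x\<in>I \<times> UNIV. c x * z ^ snd x) = (\<Sum>\<^sub>\<infinity>t\<in>I. \<Sum>\<^sub>\<infinity>n. a t n * z ^ n)"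
      by (simp add: c_def)
    also have "\<dots> = (\<Sum>\<^sub>\<infinity>t\<in>I. f t z)"
      by (intro infsum_cong infsumI a(2) z)
    finally show "(\<Sum>\<^sub>\<infinity>x\<in>I \<times> UNIV. c x * z ^ snd x) = (\<Sum>\<^sub>\<infinity>t\<in>I. f t z)" .
  qed
qed

lemma wnorm_le_sum:
  assumes "finite I" "\<And>t. t \<in> I \<Longrightarrow> wnorm_le w (f t) (K t)"
  shows "wnorm_le w (\<lambda>z. \<Sum>t\<in>I. f t z) (sum K I)"
  using wnorm_le_infsum[of I f K] assms by simp

lemma wnorm_le_mult:
  assumes "wnorm_le w f K" "wnorm_le w g L"
  shows "wnorm_le w (\<lambda>z. f z * g z) (K * L)"
proof -
  obtain a where a: "\<And>F. finite F \<Longrightarrow> (\<Sum>n\<in>F. cmod (a n) * w n) \<le> K"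
    "\<And>z. cmod z \<le> 1 \<Longrightarrow> ((\<lambda>n. a n * z ^ n) has_sum f z) UNIV"
    using assms(1) unfolding wnorm_le_def by blast
  obtain b where b: "\<And>F. finite F \<Longrightarrow> (\<Sum>n\<in>F. cmod (b n) * w n) \<le> L"
    "\<And>z. cmod z \<le> 1 \<Longrightarrow> ((\<lambda>n. b n * z ^ n) has_sum g z) UNIV"
    using assms(2) unfolding wnorm_le_def by blast
  define c where "c = (\<lambda>(m,n). a m * b n)"
  define N where "N = (\<lambda>(m::nat,n::nat). m + n)"
  have bd: "(\<Sum>x\<in>F. cmod (c x) * w (N x)) \<le> K * L" if F: "finite F" "F \<subseteq> UNIV" for F
  proof -
    \<comment> \<open>A finite set of index pairs is enlarged to a rectangle, over which the sum
      factors.\<close>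
    have "(\<Sum>x\<in>F. cmod (c x) * w (N x)) \<le> (\<Sum>x\<in>fst ` F \<times> snd ` F. cmod (c x) * w (N x))"
      using F(1) by (intro sum_mono2 subset_fst_snd mult_nonneg_nonneg norm_ge_zero less_imp_le[OF w_pos]) auto
    also have "\<dots> \<le> (\<Sum>x\<in>fst ` F \<times> snd ` F. (cmod (a (fst x)) * w (fst x)) * (cmod (b (snd x)) * w (snd x)))"
    proof (rule sum_mono, clarify)
      fix m n
      have "cmod (a m * b n) * w (m + n) \<le> cmod (a m * b n) * (w m * w n)"
        by (intro mult_left_mono w_submult) auto
      then show "cmod (c (m,n)) * w (N (m,n)) \<le> cmod (a (fst (m, n))) * w (fst (m, n)) * (cmod (b (snd (m, n))) * w (snd (m, n)))"
        by (simp add: c_def N_def norm_mult mult_ac)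
    qed
    also have "\<dots> = (\<Sum>m\<in>fst ` F. cmod (a m) * w m) * (\<Sum>n\<in>snd ` F. cmod (b n) * w n)"
      by (simp add: sum_product sum.cartesian_product case_prod_unfold)
    also have "\<dots> \<le> K * L"
      using F by (intro mult_mono a b sum_nonneg mult_nonneg_nonneg norm_ge_zero less_imp_le[OF w_pos]
          wnorm_le_nonneg[OF assms(1)]) auto
    finally show ?thesis .
  qed
  have "wnorm_le w (\<lambda>z. \<Sum>\<^sub>\<infinity>x. c x * z ^ N x) (K * L)"
    by (rule wnorm_le_family) (rule bd)
  then show ?thesis
  proof (rule wnorm_le_cong)
    fix z :: complex assume z: "cmod z \<le> 1"
    have "(\<lambda>x. c x * z ^ N x) summable_on UNIV \<times> UNIV"
      unfolding UNIV_Times_UNIV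
      by (rule abs_summable_summable, rule power_family_abs_summable[OF _ z]) (rule bd)
    from infsum_Sigma_banach[OF this]
    have "(\<Sum>\<^sub>\<infinity>x. c x * z ^ N x) = (\<Sum>\<^sub>\<infinity>m. \<Sum>\<^sub>\<infinity>n. c (m, n) * z ^ N (m, n))"
      by simp
    also have "\<dots> = (\<Sum>\<^sub>\<infinity>m. \<Sum>\<^sub>\<infinity>n. (a m * z ^ m) * (b n * z ^ n))"
      by (simp add: c_def N_def power_add mult.assoc mult.left_commute)
    also have "\<dots> = (\<Sum>\<^sub>\<infinity>m. (a m * z ^ m) * g z)"
      by (simp only: infsum_cmult_right' infsumI[OF b(2)[OF z]])
    also have "\<dots> = f z * g z"
      by (simp only: infsum_cmult_left' infsumI[OF a(2)[OF z]])
    finally show "(\<Sum>\<^sub>\<infinity>x. c x * z ^ N x) = f z * g z" by simp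
  qed
qed

lemma wnorm_le_monom: "wnorm_le w (\<lambda>z. c * z ^ k) (cmod c * w k)"
proof -
  have "wnorm_le w (\<lambda>z. \<Sum>\<^sub>\<infinity>t\<in>{()}. c * z ^ k) (cmod c * w k)"
  proof (rule wnorm_le_family[where a = "\<lambda>_. c" and N = "\<lambda>_. k"])
    fix F :: "unit set" assume "finite F" "F \<subseteq> {()}"
    then have "F = {} \<or> F = {()}" by auto
    then show "(\<Sum>t\<in>F. cmod c * w k) \<le> cmod c * w k" using w_pos[of k] by auto
  qed
  then show ?thesis by simp
qed

lemma wnorm_le_const: "wnorm_le w (\<lambda>z. c) (cmod c * w 0)"
  using wnorm_le_monom[of c 0] by simp

lemma wnorm_le_cmult:
  assumes "wnorm_le w f K"
  shows "wnorm_le w (\<lambda>z. c * f z) (cmod c * K)"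
proof -
  obtain a where a: "\<And>F. finite F \<Longrightarrow> (\<Sum>n\<in>F. cmod (a n) * w n) \<le> K"
    "\<And>z. cmod z \<le> 1 \<Longrightarrow> ((\<lambda>n. a n * z ^ n) has_sum f z) UNIV"
    using assms(1) unfolding wnorm_le_def by blast
  have "(\<Sum>n\<in>F. cmod (c * a n) * w n) \<le> cmod c * K" if "finite F" for F
    using mult_left_mono[OF a(1)[OF that], of "cmod c"] by (simp add: norm_mult sum_distrib_left mult.assoc)
  moreover have "((\<lambda>n. c * a n * z ^ n) has_sum c * f z) UNIV" if "cmod z \<le> 1" for z
    using has_sum_cmult_right[OF a(2)[OF that], of c] by (simp add: mult.assoc)
  ultimately show ?thesis unfolding wnorm_le_def by (intro exI[of _ "\<lambda>n. c * a n"]) auto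
qed

lemma wnorm_le_uminus: "wnorm_le w f K \<Longrightarrow> wnorm_le w (\<lambda>z. - f z) K"
  using wnorm_le_cmult[of f K "-1"] by simp

lemma wnorm_le_add:
  assumes "wnorm_le w f K" "wnorm_le w g L"
  shows "wnorm_le w (\<lambda>z. f z + g z) (K + L)"
  using wnorm_le_sum[of "UNIV::bool set" "\<lambda>t. if t then f else g" "\<lambda>t. if t then K else L"] assms
  by (simp add: UNIV_bool add.commute)

lemma wnorm_le_diff:
  assumes "wnorm_le w f K" "wnorm_le w g L"
  shows "wnorm_le w (\<lambda>z. f z - g z) (K + L)"
  using wnorm_le_add[OF assms(1) wnorm_le_uminus[OF assms(2)]] by simp

text \<open>Gauss elimination with cross-multiplied rows instead of quotients: \<open>A'\<close>
  stays in the algebra and is again the identity at 0. Each pivot enters F as a factor, so F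
  vanishes at once where the pivot does; elsewhere v solves the reduced system and is still nonzero
  on the remaining indices.\<close>

lemma elimination:
  assumes "finite S"
    and "\<And>i j. i \<in> S \<Longrightarrow> j \<in> S \<Longrightarrow> \<exists>K. wnorm_le w (A i j) K"
    and "\<And>i j. i \<in> S \<Longrightarrow> j \<in> S \<Longrightarrow> A i j 0 = of_bool (i = j)"
  shows "\<exists>F K. wnorm_le w F K \<and> F 0 = 1 \<and>
    (\<forall>z v. cmod z \<le> 1 \<longrightarrow> (\<exists>i\<in>S. v i \<noteq> 0) \<longrightarrow> (\<forall>i\<in>S. (\<Sum>j\<in>S. A i j z * v j) = 0) \<longrightarrow> F z = 0)"
  using assms
proof (induction S arbitrary: A rule: finite_induct)
  case empty
  then show ?case using wnorm_le_const[of 1] by (intro exI[of _ "\<lambda>_. 1"]) auto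
next
  case (insert k S)
  define A' where "A' i j z = A k k z * A i j z - A i k z * A k j z" for i j z
  have W: "\<exists>K. wnorm_le w (A' i j) K" if "i \<in> S" "j \<in> S" for i j
  proof -
    have "i \<in> insert k S" "j \<in> insert k S" "k \<in> insert k S" using that by auto
    then obtain K1 K2 K3 K4 where "wnorm_le w (A k k) K1" "wnorm_le w (A i j) K2" "wnorm_le w (A i k) K3" "wnorm_le w (A k j) K4"
      using insert.prems(1)[of k k] insert.prems(1)[of i j] insert.prems(1)[of i k] insert.prems(1)[of k j] by blast
    then have "wnorm_le w (A' i j) (K1 * K2 + K3 * K4)"
      unfolding A'_def by (intro wnorm_le_diff wnorm_le_mult)
    then show ?thesis by blast
  qed
  have id: "A' i j 0 = of_bool (i = j)" if "i \<in> S" "j \<in> S" for i j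
    using insert.hyps insert.prems(2) that by (auto simp: A'_def)
  obtain F K where F: "wnorm_le w F K" "F 0 = 1"
    "\<And>z v. cmod z \<le> 1 \<Longrightarrow> (\<exists>i\<in>S. v i \<noteq> 0) \<Longrightarrow> (\<forall>i\<in>S. (\<Sum>j\<in>S. A' i j z * v j) = 0) \<Longrightarrow> F z = 0"
    using insert.IH[of A', OF W id] by blast
  obtain L where L: "wnorm_le w (A k k) L" using insert.prems(1) by blast
  show ?case
  proof (intro exI conjI allI impI)
    show "wnorm_le w (\<lambda>z. A k k z * F z) (L * K)" using L F(1) by (rule wnorm_le_mult)
    show "A k k 0 * F 0 = 1" using F(2) insert.prems(2)[of k k] by simp
    fix z v
    assume z: "cmod z \<le> 1" and v: "\<exists>i\<in>insert k S. v i \<noteq> 0"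
      and eq: "\<forall>i\<in>insert k S. (\<Sum>j\<in>insert k S. A i j z * v j) = 0"
    have eq': "A i k z * v k + (\<Sum>j\<in>S. A i j z * v j) = 0" if "i \<in> insert k S" for i
      using bspec[OF eq that] unfolding sum.insert[OF insert.hyps] .
    show "A k k z * F z = 0"
    proof (cases "A k k z = 0")
      case False
      have "(\<Sum>j\<in>S. A' i j z * v j) = 0" if "i \<in> S" for i
      proof -
        have "(\<Sum>j\<in>S. A' i j z * v j) = A k k z * (\<Sum>j\<in>S. A i j z * v j) - A i k z * (\<Sum>j\<in>S. A k j z * v j)"
          by (simp add: A'_def sum_distrib_left sum_subtractf algebra_simps)
        also have "(\<Sum>j\<in>S. A i j z * v j) = - A i k z * v k"
          using eq'[of i] that by (simp add: eq_neg_iff_add_eq_0 add.commute)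
        also have "(\<Sum>j\<in>S. A k j z * v j) = - A k k z * v k"
          using eq'[of k] by (simp add: eq_neg_iff_add_eq_0 add.commute)
        finally show ?thesis by simp
      qed
      moreover have "\<exists>i\<in>S. v i \<noteq> 0"
      proof (rule ccontr)
        assume *: "\<not> (\<exists>i\<in>S. v i \<noteq> 0)"
        then have "(\<Sum>j\<in>S. A k j z * v j) = 0" by (intro sum.neutral) auto
        then have "v k = 0" using eq'[of k] False by simp
        then show False using * v by auto
      qed
      ultimately show ?thesis using F(3)[OF z] by auto
    qed simp
  qed
qed

end

section \<open>Reduction of a trace-class perturbation to finite dimension\<close>

lemma has_sum_sum:
  fixes f :: "'a \<Rightarrow> 'b \<Rightarrow> 'c::topological_comm_monoid_add"
  assumes "\<And>j. j \<in> S \<Longrightarrow> (f j has_sum g j) A"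
  shows "((\<lambda>x. \<Sum>j\<in>S. f j x) has_sum (\<Sum>j\<in>S. g j)) A"
  using assms by (induction S rule: infinite_finite_induct) (auto intro: has_sum_add)

context weight
begin

text \<open>The finite set S leaves a tail with \<theta> \<le> 1/2, on which the domination of M by
  \<rho> times \<sigma> makes the Neumann series converge in the algebra. Solving for the
  coordinates outside S gives the Schur complement on S, to which the elimination applies. The
  assumption that v is bounded by a multiple of \<rho> gives convergence of the sums and uniqueness
  of the tail.\<close>

theorem fredholm_reduction:
  fixes M :: "'i \<Rightarrow> 'i \<Rightarrow> complex \<Rightarrow> complex"
  assumes M: "\<And>i j. wnorm_le w (M i j) (\<rho> i * \<sigma> j)"
    and \<rho>: "\<And>i. 0 \<le> \<rho> i" and \<sigma>: "\<And>i. 0 \<le> \<sigma> i"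
    and summ: "(\<lambda>i. \<rho> i * \<sigma> i) summable_on UNIV"
    and M0: "\<And>i j. M i j 0 = 0"
  shows "\<exists>F K. wnorm_le w F K \<and> F 0 = 1 \<and> (\<forall>z v C. cmod z \<le> 1 \<longrightarrow> v \<noteq> (\<lambda>_. 0) \<longrightarrow>
    (\<forall>i. cmod (v i) \<le> C * \<rho> i) \<longrightarrow> (\<forall>i. v i + (\<Sum>\<^sub>\<infinity>j. M i j z * v j) = 0) \<longrightarrow> F z = 0)"
proof -
  obtain S where S: "finite S" "(\<Sum>\<^sub>\<infinity>i\<in>-S. \<rho> i * \<sigma> i) \<le> 1/2"
  proof -
    obtain S where S: "finite S" "dist (sum (\<lambda>i. \<rho> i * \<sigma> i) S) (infsum (\<lambda>i. \<rho> i * \<sigma> i) UNIV) \<le> 1/2"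
      using infsum_finite_approximation[OF summ, of "1/2"] by auto
    have "infsum (\<lambda>i. \<rho> i * \<sigma> i) UNIV = sum (\<lambda>i. \<rho> i * \<sigma> i) S + (\<Sum>\<^sub>\<infinity>i\<in>-S. \<rho> i * \<sigma> i)"
      using infsum_Un_disjoint[of "\<lambda>i. \<rho> i * \<sigma> i" S "-S"] S(1) summable_on_subset_banach[OF summ] by simp
    then show ?thesis using S that unfolding dist_real_def by (smt (verit))
  qed
  define \<theta> where "\<theta> = (\<Sum>\<^sub>\<infinity>i\<in>-S. \<rho> i * \<sigma> i)"
  have \<theta>: "0 \<le> \<theta>" "\<theta> \<le> 1/2" using S(2) \<rho> \<sigma> unfolding \<theta>_def by (auto intro!: infsum_nonneg)
  define \<Theta> where "\<Theta> = (\<Sum>\<^sub>\<infinity>k. \<theta> ^ k)"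
  have \<Theta>s: "(\<lambda>k. \<theta> ^ k) summable_on UNIV"
    using \<theta> by (intro norm_summable_imp_summable_on) (auto simp: norm_power summable_geometric)
  have summT: "(\<lambda>i. \<rho> i * \<sigma> i) summable_on T" for T using summ by (rule summable_on_subset_banach) simp
  \<comment> \<open>\<open>Y k\<close> is the k-th Neumann term: k + 1 factors M with signs, the k
    inner indices running outside S. The row index is arbitrary, so S may be used as well.\<close>
  define Y where "Y = rec_nat (\<lambda>t j. M t j) (\<lambda>k y t j z. - (\<Sum>\<^sub>\<infinity>s\<in>-S. M t s z * y s j z))"
  have Y0: "Y 0 = M" by (simp add: Y_def)
  have YS: "Y (Suc k) t j z = - (\<Sum>\<^sub>\<infinity>s\<in>-S. M t s z * Y k s j z)" for k t j z by (simp add: Y_def)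
  have WY: "wnorm_le w (Y k t j) (\<rho> t * \<sigma> j * \<theta> ^ k)" for k t j
  proof (induction k arbitrary: t)
    case 0 then show ?case using M by (simp add: Y0)
  next
    case (Suc k)
    have "wnorm_le w (\<lambda>z. \<Sum>\<^sub>\<infinity>s\<in>-S. M t s z * Y k s j z) (\<Sum>\<^sub>\<infinity>s\<in>-S. (\<rho> t * \<sigma> j * \<theta> ^ k) * (\<rho> s * \<sigma> s))"
    proof (rule wnorm_le_infsum)
      show "wnorm_le w (\<lambda>z. M t s z * Y k s j z) (\<rho> t * \<sigma> j * \<theta> ^ k * (\<rho> s * \<sigma> s))" for s
        using wnorm_le_mult[OF M Suc, of t s s] by (simp add: mult_ac)
      show "(\<lambda>s. \<rho> t * \<sigma> j * \<theta> ^ k * (\<rho> s * \<sigma> s)) summable_on - S"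
        by (intro summable_on_cmult_right summT)
    qed
    also have "(\<Sum>\<^sub>\<infinity>s\<in>-S. (\<rho> t * \<sigma> j * \<theta> ^ k) * (\<rho> s * \<sigma> s)) = \<rho> t * \<sigma> j * \<theta> ^ Suc k"
      unfolding infsum_cmult_right' \<theta>_def[symmetric] by (simp add: mult_ac)
    finally show ?case using wnorm_le_uminus by (simp add: YS[abs_def])
  qed
  define X where "X t j z = (\<Sum>\<^sub>\<infinity>k. Y k t j z)" for t j z
  have WX: "wnorm_le w (X t j) (\<rho> t * \<sigma> j * \<Theta>)" for t j
  proof -
    have "wnorm_le w (\<lambda>z. \<Sum>\<^sub>\<infinity>k. Y k t j z) (\<Sum>\<^sub>\<infinity>k. \<rho> t * \<sigma> j * \<theta> ^ k)"
      by (rule wnorm_le_infsum[OF WY]) (intro summable_on_cmult_right \<Theta>s)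
    then show ?thesis by (simp add: X_def[abs_def] infsum_cmult_right' \<Theta>_def)
  qed
  \<comment> \<open>The Schur complement on S is the identity plus G.\<close>
  define G where "G i j z = M i j z - (\<Sum>\<^sub>\<infinity>t\<in>-S. M i t z * X t j z)" for i j z
  have WG: "\<exists>K. wnorm_le w (\<lambda>z. of_bool (i = j) + G i j z) K" for i j
  proof -
    have "wnorm_le w (\<lambda>z. \<Sum>\<^sub>\<infinity>t\<in>-S. M i t z * X t j z) (\<Sum>\<^sub>\<infinity>t\<in>-S. (\<rho> i * \<sigma> j * \<Theta>) * (\<rho> t * \<sigma> t))"
    proof (rule wnorm_le_infsum)
      show "wnorm_le w (\<lambda>z. M i t z * X t j z) (\<rho> i * \<sigma> j * \<Theta> * (\<rho> t * \<sigma> t))" for t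
        using wnorm_le_mult[OF M WX, of i t t j] by (simp add: mult_ac)
      show "(\<lambda>t. \<rho> i * \<sigma> j * \<Theta> * (\<rho> t * \<sigma> t)) summable_on - S"
        by (intro summable_on_cmult_right summT)
    qed
    then show ?thesis unfolding G_def using wnorm_le_add[OF wnorm_le_const wnorm_le_diff[OF M]] by blast
  qed
  have G0: "of_bool (i = j) + G i j 0 = of_bool (i = j)" for i j by (simp add: G_def M0)
  obtain F K where F: "wnorm_le w F K" "F 0 = 1"
    "\<And>z v. cmod z \<le> 1 \<Longrightarrow> (\<exists>i\<in>S. v i \<noteq> 0) \<Longrightarrow> (\<forall>i\<in>S. (\<Sum>j\<in>S. (of_bool (i = j) + G i j z) * v j) = 0) \<Longrightarrow> F z = 0"
    using elimination[OF S(1), of "\<lambda>i j z. of_bool (i = j) + G i j z", OF WG G0] by blast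
  have "F z = 0" if z: "cmod z \<le> 1" and v0: "v \<noteq> (\<lambda>_. 0)" and vC: "\<And>i. cmod (v i) \<le> C * \<rho> i"
    and eq: "\<And>i. v i + (\<Sum>\<^sub>\<infinity>j. M i j z * v j) = 0" for z v C
  proof -
    have m: "cmod (M i j z) \<le> \<rho> i * \<sigma> j" for i j using wnorm_le_norm[OF M z] .
    have x: "cmod (X i j z) \<le> \<rho> i * \<sigma> j * \<Theta>" for i j using wnorm_le_norm[OF WX z] .
    have my: "cmod (M i s z * y s) \<le> \<rho> i * C' * (\<rho> s * \<sigma> s)" if "\<And>s. cmod (y s) \<le> C' * \<rho> s" for y C' i s
    proof -
      have "cmod (M i s z) * cmod (y s) \<le> (\<rho> i * \<sigma> s) * (C' * \<rho> s)"
        by (intro mult_mono m that mult_nonneg_nonneg \<rho> \<sigma> norm_ge_zero)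
      then show ?thesis by (simp add: norm_mult mult_ac)
    qed
    have sm: "(\<lambda>s. M i s z * y s) summable_on T" if "\<And>s. cmod (y s) \<le> C' * \<rho> s" for y C' i T
      by (rule abs_summable_summable, rule Infinite_Sum.abs_summable_on_comparison_test'[where g = "\<lambda>s. \<rho> i * C' * (\<rho> s * \<sigma> s)"])
        (intro summable_on_cmult_right summT, rule my[OF that])
    have xb: "cmod (X s j z) \<le> (\<sigma> j * \<Theta>) * \<rho> s" for s j using x[of s j] by (simp add: mult_ac)
    \<comment> \<open>The Neumann series shifted by one term; the order of summation may be
      exchanged because the double family is dominated by \<rho> s * \<sigma> s *
      \<theta>^k.\<close>
    have Xeq: "X t j z + (\<Sum>\<^sub>\<infinity>s\<in>-S. M t s z * X s j z) = M t j z" for t j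
    proof -
      have yb: "cmod (Y k s j z) \<le> \<rho> s * \<sigma> j * \<theta> ^ k" for k s using wnorm_le_norm[OF WY z] .
      have Ys: "(\<lambda>k. Y k s j z) summable_on T" for s T
        by (rule abs_summable_summable, rule Infinite_Sum.abs_summable_on_comparison_test'[where g = "\<lambda>k. \<rho> s * \<sigma> j * \<theta> ^ k"])
          (intro summable_on_cmult_right summable_on_subset_banach[OF \<Theta>s] subset_UNIV, rule yb)
      have dbl: "(\<lambda>(s, k). M t s z * Y k s j z) summable_on (- S) \<times> UNIV"
      proof (rule abs_summable_summable, rule Infinite_Sum.abs_summable_on_comparison_test')
        have "(\<lambda>(s, k). (\<rho> s * \<sigma> s) * \<theta> ^ k) summable_on (- S) \<times> UNIV"
        proof (rule summable_on_SigmaI)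
          show "((\<lambda>k. case (s, k) of (s, k) \<Rightarrow> \<rho> s * \<sigma> s * \<theta> ^ k) has_sum \<rho> s * \<sigma> s * \<Theta>) UNIV" for s
            unfolding prod.case \<Theta>_def by (intro has_sum_cmult_right has_sum_infsum \<Theta>s)
        qed (use \<rho> \<sigma> \<theta> summT in \<open>auto intro!: summable_on_cmult_left mult_nonneg_nonneg\<close>)
        then show "(\<lambda>x. (\<rho> t * \<sigma> j) * (case x of (s, k) \<Rightarrow> (\<rho> s * \<sigma> s) * \<theta> ^ k)) summable_on (- S) \<times> UNIV"
          by (rule summable_on_cmult_right)
        show "norm (case x of (s, k) \<Rightarrow> M t s z * Y k s j z) \<le> (\<rho> t * \<sigma> j) * (case x of (s, k) \<Rightarrow> (\<rho> s * \<sigma> s) * \<theta> ^ k)" for x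
        proof (cases x)
          case (Pair s k)
          have "cmod (M t s z) * cmod (Y k s j z) \<le> (\<rho> t * \<sigma> s) * (\<rho> s * \<sigma> j * \<theta> ^ k)"
            by (intro mult_mono m yb mult_nonneg_nonneg \<rho> \<sigma> norm_ge_zero)
          then show ?thesis using Pair by (simp add: norm_mult mult_ac)
        qed
      qed
      have "(\<Sum>\<^sub>\<infinity>s\<in>-S. M t s z * X s j z) = (\<Sum>\<^sub>\<infinity>s\<in>-S. \<Sum>\<^sub>\<infinity>k. M t s z * Y k s j z)"
        by (simp add: X_def infsum_cmult_right')
      also have "\<dots> = (\<Sum>\<^sub>\<infinity>k. \<Sum>\<^sub>\<infinity>s\<in>-S. M t s z * Y k s j z)"
        by (rule infsum_swap_banach[OF dbl])
      also have "\<dots> = (\<Sum>\<^sub>\<infinity>k. - Y (Suc k) t j z)" by (simp add: YS)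
      also have "\<dots> = - (\<Sum>\<^sub>\<infinity>k. Y (Suc k) t j z)" by (rule infsum_uminus)
      finally have 1: "(\<Sum>\<^sub>\<infinity>s\<in>-S. M t s z * X s j z) = - (\<Sum>\<^sub>\<infinity>k. Y (Suc k) t j z)" .
      have "X t j z = (\<Sum>\<^sub>\<infinity>k\<in>insert 0 (range Suc). Y k t j z)"
        by (simp add: X_def UNIV_nat_eq[symmetric])
      also have "\<dots> = Y 0 t j z + (\<Sum>\<^sub>\<infinity>k\<in>range Suc. Y k t j z)"
        by (rule infsum_insert[OF Ys]) auto
      also have "(\<Sum>\<^sub>\<infinity>k\<in>range Suc. Y k t j z) = (\<Sum>\<^sub>\<infinity>k. Y (Suc k) t j z)"
        by (subst infsum_reindex) (auto simp: o_def)
      finally show ?thesis using 1 by (simp add: Y0)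
    qed
    have split: "(\<Sum>\<^sub>\<infinity>j. M i j z * v j) = (\<Sum>j\<in>S. M i j z * v j) + (\<Sum>\<^sub>\<infinity>j\<in>-S. M i j z * v j)" for i
      using infsum_Un_disjoint[of "\<lambda>j. M i j z * v j" S "-S"] sm[OF vC] S(1) by simp
    have MX: "(\<Sum>\<^sub>\<infinity>s\<in>-S. M i s z * (\<Sum>j\<in>S. X s j z * v j)) = (\<Sum>j\<in>S. (\<Sum>\<^sub>\<infinity>s\<in>-S. M i s z * X s j z) * v j)"
      and MXs: "(\<lambda>s. M i s z * (\<Sum>j\<in>S. X s j z * v j)) summable_on (-S)" for i
    proof -
      have h: "((\<lambda>s. \<Sum>j\<in>S. M i s z * X s j z * v j) has_sum (\<Sum>j\<in>S. (\<Sum>\<^sub>\<infinity>s\<in>-S. M i s z * X s j z) * v j)) (-S)"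
        by (rule has_sum_sum) (rule has_sum_cmult_left, rule has_sum_infsum, rule sm[OF xb])
      have e: "(\<lambda>s. M i s z * (\<Sum>j\<in>S. X s j z * v j)) = (\<lambda>s. \<Sum>j\<in>S. M i s z * X s j z * v j)"
        by (simp add: sum_distrib_left mult.assoc)
      show "(\<Sum>\<^sub>\<infinity>s\<in>-S. M i s z * (\<Sum>j\<in>S. X s j z * v j)) = (\<Sum>j\<in>S. (\<Sum>\<^sub>\<infinity>s\<in>-S. M i s z * X s j z) * v j)"
        unfolding e using h by (rule infsumI)
      show "(\<lambda>s. M i s z * (\<Sum>j\<in>S. X s j z * v j)) summable_on (-S)"
        unfolding e using h by (rule has_sum_imp_summable)
    qed
    \<comment> \<open>The defect between v and its expected expression by the coordinates in S. It
      solves a homogeneous equation over the complement of S.\<close>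
    define x where "x t = v t + (\<Sum>j\<in>S. X t j z * v j)" for t
    have xeq: "x t = - (\<Sum>\<^sub>\<infinity>s\<in>-S. M t s z * x s)" for t
    proof -
      have "(\<Sum>\<^sub>\<infinity>s\<in>-S. M t s z * x s) = (\<Sum>\<^sub>\<infinity>s\<in>-S. M t s z * v s + M t s z * (\<Sum>j\<in>S. X s j z * v j))"
        by (simp add: x_def distrib_left)
      also have "\<dots> = (\<Sum>\<^sub>\<infinity>s\<in>-S. M t s z * v s) + (\<Sum>j\<in>S. (\<Sum>\<^sub>\<infinity>s\<in>-S. M t s z * X s j z) * v j)"
        unfolding MX[symmetric] by (rule infsum_add[OF sm[OF vC] MXs])
      finally have "x t + (\<Sum>\<^sub>\<infinity>s\<in>-S. M t s z * x s) =
          v t + (\<Sum>\<^sub>\<infinity>s\<in>-S. M t s z * v s) + (\<Sum>j\<in>S. (X t j z + (\<Sum>\<^sub>\<infinity>s\<in>-S. M t s z * X s j z)) * v j)"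
        by (simp add: x_def distrib_right sum.distrib)
      also have "\<dots> = 0" unfolding Xeq using eq[of t] split[of t] by (simp add: add_ac)
      finally show ?thesis by (simp add: eq_neg_iff_add_eq_0)
    qed
    define C' where "C' = C + (\<Sum>j\<in>S. \<sigma> j * \<Theta> * cmod (v j))"
    have xC: "cmod (x t) \<le> C' * \<rho> t" for t
    proof -
      have "cmod (x t) \<le> cmod (v t) + (\<Sum>j\<in>S. cmod (X t j z * v j))"
        unfolding x_def by (intro order_trans[OF norm_triangle_ineq] add_left_mono sum_norm_le order_refl)
      also have "\<dots> \<le> C * \<rho> t + (\<Sum>j\<in>S. (\<sigma> j * \<Theta> * \<rho> t) * cmod (v j))"
        unfolding norm_mult by (intro add_mono vC sum_mono mult_right_mono xb norm_ge_zero)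
      also have "\<dots> = C' * \<rho> t" by (simp add: C'_def distrib_left distrib_right sum_distrib_left sum_distrib_right mult_ac)
      finally show ?thesis .
    qed
    \<comment> \<open>Each substitution into the homogeneous equation gains a factor \<theta>, so
      the defect is zero.\<close>
    have xk: "cmod (x t) \<le> (C' * \<theta> ^ k) * \<rho> t" for k t
    proof (induction k arbitrary: t)
      case 0 then show ?case using xC by simp
    next
      case (Suc k)
      have sn: "(\<lambda>s. \<rho> t * (C' * \<theta> ^ k) * (\<rho> s * \<sigma> s)) summable_on -S"
        by (intro summable_on_cmult_right summT)
      have "cmod (x t) \<le> (\<Sum>\<^sub>\<infinity>s\<in>-S. \<rho> t * (C' * \<theta> ^ k) * (\<rho> s * \<sigma> s))"
        unfolding xeq[of t] norm_minus_cancel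
        by (rule norm_infsum_le[OF has_sum_infsum[OF sm[OF Suc]] has_sum_infsum[OF sn]]) (rule my[OF Suc])
      also have "\<dots> = (C' * \<theta> ^ Suc k) * \<rho> t" unfolding infsum_cmult_right' \<theta>_def[symmetric] by (simp add: mult_ac)
      finally show ?case .
    qed
    have x0: "x t = 0" for t
    proof -
      have "(\<lambda>k. \<theta> ^ k) \<longlonglongrightarrow> 0" using \<theta> by (intro LIMSEQ_realpow_zero) auto
      then have "(\<lambda>k. (C' * \<theta> ^ k) * \<rho> t) \<longlonglongrightarrow> (C' * 0) * \<rho> t"
        by (intro tendsto_mult tendsto_const)
      then have "cmod (x t) \<le> (C' * 0) * \<rho> t" by (rule LIMSEQ_le_const) (use xk in blast)
      then show ?thesis by simp
    qed
    have vt: "v t = - (\<Sum>j\<in>S. X t j z * v j)" for t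
      using x0[of t] by (simp add: x_def eq_neg_iff_add_eq_0)
    show "F z = 0"
    proof (rule F(3)[OF z])
      show "\<exists>i\<in>S. v i \<noteq> 0"
      proof (rule ccontr)
        assume "\<not> (\<exists>i\<in>S. v i \<noteq> 0)"
        then have "(\<Sum>j\<in>S. X t j z * v j) = 0" for t by (intro sum.neutral) auto
        then have "v t = 0" for t using vt[of t] by simp
        then show False using v0 by auto
      qed
      show "\<forall>i\<in>S. (\<Sum>j\<in>S. (of_bool (i = j) + G i j z) * v j) = 0"
      proof
        fix i assume i: "i \<in> S"
        have "(\<Sum>\<^sub>\<infinity>s\<in>-S. M i s z * v s) = (\<Sum>\<^sub>\<infinity>s\<in>-S. - (M i s z * (\<Sum>j\<in>S. X s j z * v j)))"
        proof (rule infsum_cong)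
          fix s
          show "M i s z * v s = - (M i s z * (\<Sum>j\<in>S. X s j z * v j))"
            unfolding mult_minus_right[symmetric] vt[of s, symmetric] ..
        qed
        also have "\<dots> = - (\<Sum>j\<in>S. (\<Sum>\<^sub>\<infinity>s\<in>-S. M i s z * X s j z) * v j)"
          unfolding MX[symmetric] by (rule infsum_uminus)
        finally have 1: "(\<Sum>\<^sub>\<infinity>s\<in>-S. M i s z * v s) = - (\<Sum>j\<in>S. (\<Sum>\<^sub>\<infinity>s\<in>-S. M i s z * X s j z) * v j)" .
        have "(\<Sum>j\<in>S. of_bool (i = j) * v j) = (\<Sum>j\<in>S. if i = j then v j else 0)"
          by (intro sum.cong) auto
        also have "\<dots> = v i" using i S(1) by simp
        finally have "(\<Sum>j\<in>S. (of_bool (i = j) + G i j z) * v j) =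
            v i + (\<Sum>j\<in>S. M i j z * v j) - (\<Sum>j\<in>S. (\<Sum>\<^sub>\<infinity>s\<in>-S. M i s z * X s j z) * v j)"
          by (simp add: G_def distrib_right left_diff_distrib sum.distrib sum_subtractf)
        also have "\<dots> = 0" using eq[of i] unfolding split[of i] 1 by (simp add: algebra_simps)
        finally show "(\<Sum>j\<in>S. (of_bool (i = j) + G i j z) * v j) = 0" .
      qed
    qed
  qed
  then show ?thesis using F(1,2) by blast
qed

end

section \<open>The half-line Laplacian\<close>

lemma powr_subadditive:
  fixes x y \<beta> :: real
  assumes "0 \<le> x" "0 \<le> y" "0 < \<beta>" "\<beta> \<le> 1"
  shows "(x + y) powr \<beta> \<le> x powr \<beta> + y powr \<beta>"
proof (cases "x + y = 0")
  case False
  then have s: "0 < x + y" using assms by linarith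
  \<comment> \<open>After division by x + y this is t \<le> t^\<beta> on the unit interval.\<close>
  have *: "t / (x + y) \<le> t powr \<beta> / (x + y) powr \<beta>" if "0 \<le> t" "t \<le> x + y" for t
  proof -
    have "(t / (x + y)) powr 1 \<le> (t / (x + y)) powr \<beta>"
      using that s assms by (intro powr_mono') auto
    then show ?thesis using that s by (simp add: powr_divide)
  qed
  have "1 = x / (x + y) + y / (x + y)" using s by (simp add: add_divide_distrib[symmetric])
  also have "\<dots> \<le> x powr \<beta> / (x + y) powr \<beta> + y powr \<beta> / (x + y) powr \<beta>"
    using assms by (intro add_mono *) auto
  finally show ?thesis using s by (simp add: add_divide_distrib[symmetric] le_divide_eq)
qed (use assms in auto)

lemma weight_exp_powr:
  assumes "0 \<le> c" "0 < \<beta>" "\<beta> \<le> 1"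
  shows "weight (\<lambda>n. exp (c * real n powr \<beta>))"
proof
  fix m n
  show "1 \<le> exp (c * real n powr \<beta>)" using assms by simp
  have "c * real (m + n) powr \<beta> \<le> c * (real m powr \<beta> + real n powr \<beta>)"
    using powr_subadditive[of "real m" "real n" \<beta>] assms by (intro mult_left_mono) auto
  then show "exp (c * real (m + n) powr \<beta>) \<le> exp (c * real m powr \<beta>) * exp (c * real n powr \<beta>)"
    by (simp add: exp_add[symmetric] distrib_left)
qed

lemma summable_on_int_abs:
  fixes f :: "nat \<Rightarrow> real"
  assumes "summable f" "\<And>n. 0 \<le> f n"
  shows "(\<lambda>i::int. f (nat \<bar>i\<bar>)) summable_on UNIV"
proof -
  have f: "f summable_on A" for A
    by (rule summable_on_subset_banach[OF summable_nonneg_imp_summable_on]) (use assms in auto)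
  have "(\<lambda>i::int. f (nat \<bar>i\<bar>)) summable_on range int"
    by (subst summable_on_reindex) (auto simp: o_def f)
  moreover have "(\<lambda>i::int. f (nat \<bar>i\<bar>)) summable_on range (\<lambda>n. - int n)"
    by (subst summable_on_reindex) (auto simp: o_def f inj_on_def)
  ultimately have "(\<lambda>i::int. f (nat \<bar>i\<bar>)) summable_on (range int \<union> range (\<lambda>n. - int n))"
    by (rule summable_on_union)
  moreover have "range int \<union> range (\<lambda>n. - int n) = UNIV"
    by (auto intro: int_cases2)
  ultimately show ?thesis by simp
qed

lemma summable_linear_exp_powr:
  fixes a b \<beta> :: real
  assumes "0 < a" "0 < \<beta>"
  shows "summable (\<lambda>n. (real n + b) * exp (- a * real n powr \<beta>))"
proof (rule summable_comparison_test_bigo)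
  show "summable (\<lambda>n. norm (1 / real n ^ 2))"
    using inverse_power_summable[of 2, where 'a = real] by (simp add: inverse_eq_divide)
  show "(\<lambda>n. (real n + b) * exp (- a * real n powr \<beta>)) \<in> O(\<lambda>n. 1 / real n ^ 2)"
    using assms by real_asymp
qed

definition half_sum :: "complex \<Rightarrow> nat \<Rightarrow> complex" where
  "half_sum \<zeta> n = (\<Sum>l<n. \<zeta> ^ (2 * l + 1))"

text \<open>The resolvent kernel at \<open>\<zeta> + 1/\<zeta>\<close> of the discrete Laplacian on the half line \<open>{1,2,\<dots>}\<close>
  with Dirichlet condition at \<open>0\<close>. It is a polynomial in \<open>\<zeta>\<close>; in particular it has no
  singularity at \<open>\<zeta> = \<plusminus>1\<close>, in contrast to the kernel on the whole line.\<close>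

definition half_green :: "nat \<Rightarrow> nat \<Rightarrow> complex \<Rightarrow> complex" where
  "half_green m n \<zeta> = - (\<zeta> ^ (max m n - min m n) * half_sum \<zeta> (min m n))"

lemma half_sum_Suc: "half_sum \<zeta> (Suc n) = half_sum \<zeta> n + \<zeta> ^ (2 * n + 1)"
  by (simp add: half_sum_def)

text \<open>A geometric sum without its denominator: \<open>half_sum\<close> is \<zeta>^n times the
  solution (\<zeta>^(-n) - \<zeta>^n) / (\<zeta>^(-1) - \<zeta>) of the free recurrence that
  vanishes at n = 0.\<close>

lemma half_sum_mult: "(1 - \<zeta>\<^sup>2) * half_sum \<zeta> n = \<zeta> * (1 - \<zeta> ^ (2 * n))"
proof (induction n)
  case (Suc n)
  have "(1 - \<zeta>\<^sup>2) * half_sum \<zeta> (Suc n) = (1 - \<zeta>\<^sup>2) * half_sum \<zeta> n + (1 - \<zeta>\<^sup>2) * \<zeta> ^ (2 * n + 1)"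
    by (simp only: half_sum_Suc distrib_left)
  also have "\<dots> = \<zeta> * (1 - \<zeta> ^ (2 * Suc n))"
    unfolding Suc by (simp add: algebra_simps power2_eq_square)
  finally show ?case .
qed (simp add: half_sum_def)

text \<open>On either side of the diagonal the kernel is a multiple of a solution of the free
  recurrence, decaying for n \<ge> m and vanishing at 0 for n \<le> m. The jump at n + 1 = m equals
  1 by \<open>half_sum_mult\<close>.\<close>

lemma half_green_recurrence:
  assumes "\<zeta> \<noteq> 0"
  shows "half_green m (n + 2) \<zeta> + half_green m n \<zeta> - (\<zeta> + 1 / \<zeta>) * half_green m (n + 1) \<zeta> = of_bool (m = n + 1)"
proof -
  consider "m \<le> n" | "m = n + 1" | k where "m = n + 2 + k"
    by (metis add.commute add_2_eq_Suc' le_add_diff_inverse not_less_eq_eq Suc_eq_plus1 le_antisym)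
  then show ?thesis
  proof cases
    case 1
    then obtain k where "n = m + k" using le_Suc_ex by blast
    then show ?thesis using assms by (simp add: half_green_def max_def min_def field_simps)
  next
    case 2
    have a: "half_sum \<zeta> n = half_sum \<zeta> (Suc n) - \<zeta> ^ (2 * n + 1)" by (simp add: half_sum_Suc)
    have b: "half_sum \<zeta> (Suc n) - \<zeta>\<^sup>2 * half_sum \<zeta> (Suc n) = \<zeta> - \<zeta> * \<zeta> ^ (2 * Suc n)"
      using half_sum_mult[of \<zeta> "Suc n"] by (simp add: algebra_simps)
    have "half_green m (n + 2) \<zeta> + half_green m n \<zeta> - (\<zeta> + 1 / \<zeta>) * half_green m (n + 1) \<zeta> =
      - (\<zeta> * half_sum \<zeta> (Suc n)) - \<zeta> * (half_sum \<zeta> (Suc n) - \<zeta> ^ (2 * n + 1)) + (\<zeta> + 1 / \<zeta>) * half_sum \<zeta> (Suc n)"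
      using 2 a by (simp add: half_green_def max_def min_def)
    also have "\<dots> = (half_sum \<zeta> (Suc n) - \<zeta>\<^sup>2 * half_sum \<zeta> (Suc n) + \<zeta> * \<zeta> ^ (2 * Suc n)) / \<zeta>"
      using assms by (simp add: field_simps power2_eq_square)
    also have "\<dots> = 1" unfolding b using assms by simp
    finally show ?thesis using 2 by simp
  next
    case 3
    have a: "half_sum \<zeta> (Suc n) = half_sum \<zeta> n + \<zeta> ^ (2 * n + 1)"
      "half_sum \<zeta> (Suc (Suc n)) = half_sum \<zeta> n + \<zeta> ^ (2 * n + 1) + \<zeta> ^ (2 * n + 3)"
      by (simp_all add: half_sum_Suc numeral_3_eq_3)
    have e: "half_green m (n + 2) \<zeta> = - (\<zeta> ^ k * half_sum \<zeta> (Suc (Suc n)))"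
      "half_green m n \<zeta> = - (\<zeta> ^ (k + 2) * half_sum \<zeta> n)"
      "half_green m (n + 1) \<zeta> = - (\<zeta> ^ (k + 1) * half_sum \<zeta> (Suc n))"
      using 3 by (simp_all add: half_green_def max_def min_def)
    show ?thesis unfolding e a using assms 3
      by (simp add: field_simps power_add power2_eq_square power3_eq_cube)
  qed
qed

text \<open>Linear growth, uniform up to the unit circle, takes the place of the singularity at
  \<zeta> = 1 and \<zeta> = -1.\<close>

lemma norm_half_green:
  assumes "cmod \<zeta> \<le> 1"
  shows "cmod (half_green m n \<zeta>) \<le> real m"
proof -
  have "cmod (half_sum \<zeta> k) \<le> real k" for k
  proof -
    have "cmod (half_sum \<zeta> k) \<le> (\<Sum>l<k. 1)"
      unfolding half_sum_def using assms by (intro sum_norm_le) (auto simp: norm_power power_le_one simp del: power_Suc)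
    then show ?thesis by simp
  qed
  from this[of "min m n"] have "cmod (half_sum \<zeta> (min m n)) \<le> real m" by linarith
  moreover have "cmod \<zeta> ^ (max m n - min m n) \<le> 1" using assms by (simp add: power_le_one)
  ultimately have "cmod \<zeta> ^ (max m n - min m n) * cmod (half_sum \<zeta> (min m n)) \<le> 1 * real m"
    by (intro mult_mono) auto
  then show ?thesis by (simp add: half_green_def norm_mult norm_power)
qed

text \<open>Discrete Green formula. The boundary terms at the origin vanish because
  \<open>x 0 = 0\<close> and the kernel is 0 there; those at N remain.\<close>

lemma half_green_summation:
  assumes "\<zeta> \<noteq> 0" "x 0 = 0" "1 \<le> m"
  shows "(\<Sum>n<N. half_green m (n + 1) \<zeta> * (x (n + 2) + x n - (\<zeta> + 1 / \<zeta>) * x (n + 1))) =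
     (if m \<le> N then x m else 0) + half_green m N \<zeta> * x (N + 1) - half_green m (N + 1) \<zeta> * x N"
proof (induction N)
  case 0
  then show ?case using assms by (simp add: half_green_def half_sum_def)
next
  case (Suc N)
  have r: "half_green m (N + 2) \<zeta> = of_bool (m = N + 1) - half_green m N \<zeta> + (\<zeta> + 1 / \<zeta>) * half_green m (N + 1) \<zeta>"
    using half_green_recurrence[OF assms(1), of m N] by (simp add: algebra_simps)
  have i: "(if m \<le> N + 1 then x m else 0) = (if m \<le> N then x m else 0) + of_bool (m = N + 1) * x (N + 1)"
    by (cases "m = N + 1") (auto simp: le_Suc_eq)
  have "(\<Sum>n<Suc N. half_green m (n + 1) \<zeta> * (x (n + 2) + x n - (\<zeta> + 1 / \<zeta>) * x (n + 1))) =
      (if m \<le> N then x m else 0) + half_green m N \<zeta> * x (N + 1) - half_green m (N + 1) \<zeta> * x N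
      + half_green m (N + 1) \<zeta> * (x (N + 2) + x N - (\<zeta> + 1 / \<zeta>) * x (N + 1))"
    unfolding sum.lessThan_Suc Suc.IH ..
  also have "\<dots> = (if m \<le> N + 1 then x m else 0) + half_green m (N + 1) \<zeta> * x (N + 2) - half_green m (N + 2) \<zeta> * x (N + 1)"
    unfolding i r by (simp only: algebra_simps)
  finally show ?case by simp
qed

lemma half_green_has_sum:
  assumes \<zeta>: "\<zeta> \<noteq> 0" "cmod \<zeta> < 1" and x0: "x 0 = 0" and m: "1 \<le> m"
    and bd: "\<And>n. cmod (x n) \<le> U"
    and ys: "(\<lambda>n. cmod (x (n + 2) + x n - (\<zeta> + 1 / \<zeta>) * x (n + 1))) summable_on UNIV"
  shows "((\<lambda>n. half_green m (n + 1) \<zeta> * (x (n + 2) + x n - (\<zeta> + 1 / \<zeta>) * x (n + 1))) has_sum x m) UNIV"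
proof -
  let ?f = "\<lambda>n. half_green m (n + 1) \<zeta> * (x (n + 2) + x n - (\<zeta> + 1 / \<zeta>) * x (n + 1))"
  have "?f summable_on UNIV"
  proof (rule abs_summable_summable, rule Infinite_Sum.abs_summable_on_comparison_test')
    show "(\<lambda>n. real m * cmod (x (n + 2) + x n - (\<zeta> + 1 / \<zeta>) * x (n + 1))) summable_on UNIV"
      by (intro summable_on_cmult_right ys)
    show "cmod (?f n) \<le> real m * cmod (x (n + 2) + x n - (\<zeta> + 1 / \<zeta>) * x (n + 1))" for n
      unfolding norm_mult using \<zeta> by (intro mult_right_mono norm_half_green) auto
  qed
  then have h: "(?f has_sum infsum ?f UNIV) UNIV" by (rule has_sum_infsum)
  then have l1: "(\<lambda>N. \<Sum>n<N. ?f n) \<longlonglongrightarrow> infsum ?f UNIV"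
    using has_sum_imp_sums sums_def by blast
  \<comment> \<open>Beyond the diagonal the kernel decays like a power of \<zeta>, which kills the
    boundary terms of a bounded sequence.\<close>
  have g0: "(\<lambda>N. half_green m (N + a) \<zeta> * x (N + b)) \<longlonglongrightarrow> 0" for a b
  proof (rule Lim_null_comparison)
    show "\<forall>\<^sub>F N in sequentially. cmod (half_green m (N + a) \<zeta> * x (N + b)) \<le> cmod \<zeta> ^ (N + a - m) * (cmod (half_sum \<zeta> m) * U)"
    proof (rule eventually_sequentiallyI[of m])
      fix N assume "m \<le> N"
      then have "half_green m (N + a) \<zeta> = - (\<zeta> ^ (N + a - m) * half_sum \<zeta> m)"
        by (simp add: half_green_def max_def min_def)
      then have "cmod (half_green m (N + a) \<zeta> * x (N + b)) = cmod \<zeta> ^ (N + a - m) * (cmod (half_sum \<zeta> m) * cmod (x (N + b)))"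
        by (simp add: norm_mult norm_power)
      also have "\<dots> \<le> cmod \<zeta> ^ (N + a - m) * (cmod (half_sum \<zeta> m) * U)"
        by (intro mult_left_mono bd) auto
      finally show "cmod (half_green m (N + a) \<zeta> * x (N + b)) \<le> cmod \<zeta> ^ (N + a - m) * (cmod (half_sum \<zeta> m) * U)" .
    qed
    have "(\<lambda>N. cmod \<zeta> ^ (N + m + a - m)) \<longlonglongrightarrow> 0"
      using LIMSEQ_ignore_initial_segment[OF LIMSEQ_realpow_zero[of "cmod \<zeta>"], of a] \<zeta> by simp
    then have "(\<lambda>N. cmod \<zeta> ^ (N + a - m)) \<longlonglongrightarrow> 0"
      by (rule LIMSEQ_offset[where k = m])
    then show "(\<lambda>N. cmod \<zeta> ^ (N + a - m) * (cmod (half_sum \<zeta> m) * U)) \<longlonglongrightarrow> 0"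
      by (rule tendsto_mult_left_zero)
  qed
  have "(\<lambda>N. x m + half_green m (N + 0) \<zeta> * x (N + 1) - half_green m (N + 1) \<zeta> * x (N + 0)) \<longlonglongrightarrow> x m + 0 - 0"
    by (intro tendsto_intros g0)
  moreover have "\<forall>\<^sub>F N in sequentially. x m + half_green m (N + 0) \<zeta> * x (N + 1) - half_green m (N + 1) \<zeta> * x (N + 0) = (\<Sum>n<N. ?f n)"
    by (rule eventually_sequentiallyI[of m]) (subst half_green_summation[of _ x, OF \<zeta>(1) x0 m], simp)
  ultimately have "(\<lambda>N. \<Sum>n<N. ?f n) \<longlonglongrightarrow> x m" using tendsto_cong by force
  then have "infsum ?f UNIV = x m" using l1 LIMSEQ_unique by blast
  then show ?thesis using h by simp
qed

context weight
begin

text \<open>The kernel consists of min m n monomials, all with exponents below m + n.\<close>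

lemma wnorm_le_half_green:
  assumes mono: "\<And>m n. m \<le> n \<Longrightarrow> w m \<le> w n"
  shows "wnorm_le w (half_green m n) (real m * w (m + n))"
proof -
  have "wnorm_le w (\<lambda>z. \<Sum>l<min m n. (-1) * z ^ (max m n - min m n + (2 * l + 1))) (\<Sum>l<min m n. cmod (-1) * w (max m n - min m n + (2 * l + 1)))"
    by (intro wnorm_le_sum wnorm_le_monom) auto
  moreover have "(\<Sum>l<min m n. cmod (-1) * w (max m n - min m n + (2 * l + 1))) \<le> real m * w (m + n)"
  proof -
    have "(\<Sum>l<min m n. cmod (-1) * w (max m n - min m n + (2 * l + 1))) \<le> (\<Sum>l<min m n. w (m + n))"
      by (intro sum_mono) (auto intro!: mono)
    also have "\<dots> \<le> real m * w (m + n)" using w_pos[of "m + n"] by simp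
    finally show ?thesis .
  qed
  moreover have "(\<Sum>l<min m n. (-1) * z ^ (max m n - min m n + (2 * l + 1))) = half_green m n z" for z
    unfolding half_green_def half_sum_def power_add[of z "max m n - min m n"]
    by (simp add: sum_distrib_left sum_negf)
  ultimately show ?thesis using wnorm_le_mono by auto
qed

end

section \<open>The perturbation determinant\<close>

text \<open>The integers split into \<open>2p\<close> half-infinite chains \<open>r, r + p, r + 2p, \<dots>\<close> and their reflections under
  \<open>i \<mapsto> -1 - i\<close>. Cutting the free operator between the negative and the nonnegative integers makes it
  a direct sum of half-line Laplacians along these chains.\<close>

definition depth :: "int \<Rightarrow> int" where
  "depth i = (if 0 \<le> i then i else - 1 - i)"

definition chain_pos :: "nat \<Rightarrow> int \<Rightarrow> nat" where
  "chain_pos p i = nat (depth i div int p)"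

definition same_chain :: "nat \<Rightarrow> int \<Rightarrow> int \<Rightarrow> bool" where
  "same_chain p i j \<longleftrightarrow> (0 \<le> i \<longleftrightarrow> 0 \<le> j) \<and> depth i mod int p = depth j mod int p"

definition chain :: "nat \<Rightarrow> int \<Rightarrow> nat \<Rightarrow> int" where
  "chain p i n = (let m = depth i mod int p + int p * int n in if 0 \<le> i then m else - 1 - m)"

definition green :: "nat \<Rightarrow> int \<Rightarrow> int \<Rightarrow> complex \<Rightarrow> complex" where
  "green p i j \<zeta> = (if same_chain p i j then half_green (chain_pos p i + 1) (chain_pos p j + 1) \<zeta> else 0)"

text \<open>Besides the deviation of D from the free operator this contains the free entries that
  cross the cut between -1 and 0, a block of finite rank.\<close>

definition perturbation :: "nat \<Rightarrow> (int \<Rightarrow> int \<Rightarrow> complex) \<Rightarrow> int \<Rightarrow> int \<Rightarrow> complex" where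
  "perturbation p D i j = D i j - of_bool (\<bar>i - j\<bar> = int p \<and> (0 \<le> i \<longleftrightarrow> 0 \<le> j))"

lemma depth_nonneg: "0 \<le> depth i" by (simp add: depth_def)

lemma chain_pos_chain:
  assumes "1 \<le> p"
  shows "chain_pos p (chain p i n) = n" "0 \<le> chain p i n \<longleftrightarrow> 0 \<le> i" "depth (chain p i n) = depth i mod int p + int p * int n"
proof -
  have m: "0 \<le> depth i mod int p" "depth i mod int p < int p" using assms by simp_all
  then have m': "0 \<le> depth i mod int p + int p * int n" by simp
  show s: "0 \<le> chain p i n \<longleftrightarrow> 0 \<le> i" using m' by (simp add: chain_def Let_def)
  show d: "depth (chain p i n) = depth i mod int p + int p * int n"
    using m' by (simp add: chain_def Let_def depth_def[of "chain p i n"] depth_def[of "- 1 - x" for x] depth_def[of "depth i mod x + y" for x y])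
  show "chain_pos p (chain p i n) = n" unfolding chain_pos_def d using m by simp
qed

lemma chain_chain_pos:
  assumes "1 \<le> p" "same_chain p i j"
  shows "chain p i (chain_pos p j) = j"
proof -
  have "0 \<le> depth j div int p" using depth_nonneg[of j] assms(1) by (simp add: pos_imp_zdiv_nonneg_iff)
  then have "depth i mod int p + int p * int (chain_pos p j) = depth j"
    using assms(2) by (simp add: same_chain_def chain_pos_def)
  then show ?thesis using assms(2) by (auto simp: chain_def same_chain_def depth_def)
qed

lemma same_chain_chain: "1 \<le> p \<Longrightarrow> same_chain p i (chain p i n)"
  by (simp add: same_chain_def chain_pos_chain)

text \<open>Here w = (z - J) u for the cut free operator J, while \<open>green\<close> is the kernel
  of the inverse of J - z; hence the minus sign. Along a chain the claim is that for the half-line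
  Laplacian.\<close>

lemma has_sum_green:
  assumes p: "1 \<le> p" and \<zeta>: "\<zeta> \<noteq> 0" "cmod \<zeta> < 1" and bd: "\<And>n. cmod (u n) \<le> U"
    and ws: "(\<lambda>i. cmod (w i)) summable_on UNIV"
    and w: "\<And>i. w i = (\<zeta> + 1 / \<zeta>) * u i - (\<Sum>k | \<bar>i - k\<bar> = int p \<and> (0 \<le> i \<longleftrightarrow> 0 \<le> k). u k)"
  shows "((\<lambda>j. green p i j \<zeta> * w j) has_sum (- u i)) UNIV"
proof -
  \<comment> \<open>Chain positions count from 0, half-line sites from 1; site 0 carries the
    Dirichlet value.\<close>
  define x where "x n = (case n of 0 \<Rightarrow> 0 | Suc n \<Rightarrow> u (chain p i n))" for n
  have y: "x (n + 2) + x n - (\<zeta> + 1 / \<zeta>) * x (n + 1) = - w (chain p i n)" for n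
  proof -
    define k where "k = chain p i n"
    have up: "chain p i (Suc n) = (if 0 \<le> i then k + int p else k - int p)"
      by (simp add: chain_def k_def Let_def algebra_simps)
    have dn: "chain p i m = (if 0 \<le> i then k - int p else k + int p)" if "n = Suc m" for m
      using that by (simp add: chain_def k_def Let_def algebra_simps)
    have sg: "0 \<le> chain p i m \<longleftrightarrow> 0 \<le> i" for m by (rule chain_pos_chain(2)[OF p])
    \<comment> \<open>On the same side of the cut the neighbours of k are its successor and
      predecessor in the chain. The first element has no predecessor, and \<open>x 0 = 0\<close>
      stands in for it.\<close>
    have nb: "{j. \<bar>k - j\<bar> = int p \<and> (0 \<le> k \<longleftrightarrow> 0 \<le> j)} = insert (chain p i (Suc n)) (if n = 0 then {} else {chain p i (n - 1)})"
    proof (cases n)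
      case 0
      have "0 \<le> depth i mod int p" "depth i mod int p < int p" using p by simp_all
      then have "if 0 \<le> i then 0 \<le> k \<and> k < int p else k < 0 \<and> k \<ge> - int p"
        using 0 by (auto simp: k_def chain_def)
      then show ?thesis using 0 sg[of n] unfolding up k_def[symmetric] by (auto split: if_splits)
    next
      case (Suc m)
      show ?thesis using Suc sg[of n] sg[of "Suc n"] sg[of m] unfolding up dn[OF Suc] k_def[symmetric]
        by (auto simp: up dn[OF Suc] split: if_splits)
    qed
    have "(\<Sum>j | \<bar>k - j\<bar> = int p \<and> (0 \<le> k \<longleftrightarrow> 0 \<le> j). u j) = x (n + 2) + x n"
    proof (cases n)
      case 0 then show ?thesis unfolding nb by (simp add: x_def)
    next
      case (Suc m)
      have "chain p i (Suc n) \<noteq> chain p i m" unfolding up dn[OF Suc] using p by auto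
      then show ?thesis unfolding nb using Suc by (simp add: x_def)
    qed
    then show ?thesis unfolding k_def[symmetric] w[of k] by (simp add: x_def k_def)
  qed
  have "0 \<le> U" using order_trans[OF norm_ge_zero bd] by blast
  then have xb: "cmod (x n) \<le> U" for n using bd by (auto simp: x_def split: nat.splits)
  have bij: "bij_betw (chain p i) UNIV {j. same_chain p i j}"
    by (rule bij_betw_byWitness[where f' = "chain_pos p"])
      (auto simp: chain_pos_chain(1)[OF p] chain_chain_pos[OF p] same_chain_chain[OF p])
  have "(\<lambda>i. cmod (w i)) summable_on {j. same_chain p i j}"
    using ws by (rule summable_on_subset_banach) simp
  then have ys: "(\<lambda>n. cmod (x (n + 2) + x n - (\<zeta> + 1 / \<zeta>) * x (n + 1))) summable_on UNIV"
    unfolding y norm_minus_cancel by (subst summable_on_reindex_bij_betw[OF bij])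
  have m: "same_chain p i i" by (simp add: same_chain_def)
  have "((\<lambda>n. half_green (chain_pos p i + 1) (n + 1) \<zeta> * - w (chain p i n)) has_sum x (chain_pos p i + 1)) UNIV"
    using half_green_has_sum[of \<zeta> x, OF \<zeta> _ _ xb ys, of "chain_pos p i + 1"] unfolding y by (simp add: x_def)
  also have "x (chain_pos p i + 1) = u i"
    using chain_chain_pos[OF p m] by (simp add: x_def)
  finally have "((\<lambda>n. half_green (chain_pos p i + 1) (n + 1) \<zeta> * - w (chain p i n)) has_sum u i) UNIV" .
  from has_sum_uminusI[OF this]
  have "((\<lambda>n. half_green (chain_pos p i + 1) (n + 1) \<zeta> * w (chain p i n)) has_sum - u i) UNIV" by simp
  then have "((\<lambda>n. green p i (chain p i n) \<zeta> * w (chain p i n)) has_sum - u i) UNIV"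
    by (simp add: green_def same_chain_chain[OF p] chain_pos_chain(1)[OF p])
  then have "((\<lambda>j. green p i j \<zeta> * w j) has_sum - u i) {j. same_chain p i j}"
    by (subst (asm) has_sum_reindex_bij_betw[OF bij, where f = "\<lambda>j. green p i j \<zeta> * w j"])
  then show ?thesis
    by (rule has_sum_cong_neutral[THEN iffD1, rotated -1]) (auto simp: green_def)
qed

text \<open>Chain positions are at most the absolute values of the indices, so submultiplicativity
  splits the bound into a factor in i and a factor in j, the product form that the reduction to
  finite dimension asks for.\<close>

lemma (in weight) wnorm_le_green:
  assumes mono: "\<And>m n. m \<le> n \<Longrightarrow> w m \<le> w n" and p: "1 \<le> p"
  shows "wnorm_le w (green p i j) ((\<bar>real_of_int i\<bar> + 1) * (w (nat \<bar>i\<bar> + 1) * w (nat \<bar>j\<bar> + 1)))"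
proof (cases "same_chain p i j")
  case True
  have d: "chain_pos p k \<le> nat \<bar>k\<bar>" for k
  proof -
    have "depth k div int p \<le> depth k div 1"
      using p depth_nonneg[of k] by (intro zdiv_mono2) auto
    then show ?thesis by (auto simp: chain_pos_def depth_def split: if_splits)
  qed
  have "real (chain_pos p i + 1) * w ((chain_pos p i + 1) + (chain_pos p j + 1))
      \<le> (\<bar>real_of_int i\<bar> + 1) * (w (nat \<bar>i\<bar> + 1) * w (nat \<bar>j\<bar> + 1))"
  proof (intro mult_mono)
    have "real (chain_pos p i) \<le> real (nat \<bar>i\<bar>)" unfolding of_nat_le_iff by (rule d)
    then show "real (chain_pos p i + 1) \<le> \<bar>real_of_int i\<bar> + 1" by simp
    have "w ((chain_pos p i + 1) + (chain_pos p j + 1)) \<le> w ((nat \<bar>i\<bar> + 1) + (nat \<bar>j\<bar> + 1))"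
      using d[of i] d[of j] by (intro mono) simp
    also have "\<dots> \<le> w (nat \<bar>i\<bar> + 1) * w (nat \<bar>j\<bar> + 1)" by (rule w_submult)
    finally show "w ((chain_pos p i + 1) + (chain_pos p j + 1)) \<le> w (nat \<bar>i\<bar> + 1) * w (nat \<bar>j\<bar> + 1)" .
  qed (use w_pos less_imp_le in auto)
  then show ?thesis using wnorm_le_mono[OF wnorm_le_half_green[OF mono]] True
    by (simp add: green_def[abs_def])
next
  case False
  have "wnorm_le w (\<lambda>z. 0) ((\<bar>real_of_int i\<bar> + 1) * (w (nat \<bar>i\<bar> + 1) * w (nat \<bar>j\<bar> + 1)))"
    by (rule wnorm_le_mono[OF wnorm_le_const]) (use w_pos less_imp_le in \<open>auto intro!: mult_nonneg_nonneg\<close>)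
  then show ?thesis using False by (simp add: green_def[abs_def])
qed

section \<open>Decay of the perturbation and its determinant\<close>

lemma mat_op_banded:
  assumes "banded p D"
  shows "mat_op D u i = (\<Sum>k\<in>{i - int p..i + int p}. D i k * u k)"
proof -
  have "mat_op D u i = (\<Sum>\<^sub>\<infinity>k\<in>{i - int p..i + int p}. D i k * u k)"
    unfolding mat_op_def using assms by (intro infsum_cong_neutral) (auto simp: banded_def)
  then show ?thesis by simp
qed

text \<open>The extra 2 pays for free entries removed by the cut, which occur only in rows within
  distance p of it.\<close>

lemma perturbation_row_sum:
  assumes p: "1 \<le> p"
  shows "(\<Sum>k\<in>{i - int p..i + int p}. cmod (perturbation p D i k)) \<le> q_dev p D i + (if \<bar>i\<bar> \<le> int p then 2 else 0)"
proof -
  have s: "{i - int p..i + int p} = insert (i - int p) (insert (i + int p) ((\<lambda>j. i + j) ` {- int p + 1..int p - 1}))"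
    using p by (auto simp: image_iff)
  have "(\<Sum>k\<in>{i - int p..i + int p}. cmod (perturbation p D i k)) = cmod (perturbation p D i (i - int p))
      + (cmod (perturbation p D i (i + int p)) + (\<Sum>j = - int p + 1..int p - 1. cmod (perturbation p D i (i + j))))"
    unfolding s using p by (subst sum.insert, simp, force)+ (subst sum.reindex, simp, simp only: o_def)
  also have "(\<Sum>j = - int p + 1..int p - 1. cmod (perturbation p D i (i + j))) = (\<Sum>j = - int p + 1..int p - 1. cmod (D i (i + j)))"
    by (intro sum.cong) (auto simp: perturbation_def)
  also have "cmod (perturbation p D i (i - int p)) \<le> cmod (D i (i - int p) - 1) + (if \<bar>i\<bar> \<le> int p then 1 else 0)"
    using norm_triangle_sub[of "D i (i - int p)" 1] by (auto simp: perturbation_def)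
  also have "cmod (perturbation p D i (i + int p)) \<le> cmod (D i (i + int p) - 1) + (if \<bar>i\<bar> \<le> int p then 1 else 0)"
    using norm_triangle_sub[of "D i (i + int p)" 1] by (auto simp: perturbation_def)
  finally show ?thesis by (simp add: q_dev_def split: if_splits)
qed

text \<open>Let J be the cut free operator and v = V u = (z - J) u. The free resolvent R sends v to
  - u, and applying V gives v + V R v = 0, where M is the kernel of V R(\<zeta>). Each entry of
  \<open>green\<close> is a polynomial divisible by \<zeta>, so M vanishes at 0 and F 0 = 1.\<close>

theorem perturbation_determinant:
  assumes p: "1 \<le> p" and \<beta>: "0 < \<beta>" "\<beta> \<le> 1" and D: "D \<in> P_class p \<beta>"
  shows "\<exists>c F K. 0 < c \<and> wnorm_le (\<lambda>n. exp (c * real n powr \<beta>)) F K \<and> F 0 = 1 \<and>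
    (\<forall>\<zeta>. \<zeta> \<noteq> 0 \<longrightarrow> cmod \<zeta> < 1 \<longrightarrow> eigenvalue D (\<zeta> + 1 / \<zeta>) \<longrightarrow> F \<zeta> = 0)"
proof -
  obtain C1 C2 where C: "0 < C1" "0 < C2" "\<And>n. q_dev p D n \<le> C1 * exp (- C2 * \<bar>real_of_int n\<bar> powr \<beta>)"
    and ban: "banded p D"
    using D unfolding P_class_def by blast
  \<comment> \<open>The product \<rho> i * \<sigma> i contains two weights, which use up half of the
    decay rate C2; the other half makes it summable.\<close>
  define c where "c = C2 / 4"
  have c: "0 < c" using C by (simp add: c_def)
  define w where "w n = exp (c * real n powr \<beta>)" for n
  interpret weight w unfolding w_def using c \<beta> by (intro weight_exp_powr) auto
  have mono: "w m \<le> w n" if "m \<le> n" for m n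
    using that c \<beta> by (simp add: w_def powr_mono2)
  define V where "V = perturbation p D"
  \<comment> \<open>The second summand absorbs the finitely many rows disturbed by the cut.\<close>
  define Q where "Q = C1 + 2 * exp (C2 * real p powr \<beta>)"
  have Q: "0 < Q" unfolding Q_def using C by (intro add_pos_nonneg) auto
  have rowV: "(\<Sum>k\<in>{i - int p..i + int p}. cmod (V i k)) \<le> Q * exp (- C2 * \<bar>real_of_int i\<bar> powr \<beta>)" for i
  proof -
    have "(if \<bar>i\<bar> \<le> int p then 2 else 0) \<le> 2 * exp (C2 * real p powr \<beta>) * exp (- C2 * \<bar>real_of_int i\<bar> powr \<beta>)"
    proof (cases "\<bar>i\<bar> \<le> int p")
      case True
      then have "\<bar>real_of_int i\<bar> \<le> real p" by linarith
      then have "C2 * \<bar>real_of_int i\<bar> powr \<beta> \<le> C2 * real p powr \<beta>"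
        using C \<beta> by (intro mult_left_mono powr_mono2) auto
      then have "1 \<le> exp (C2 * real p powr \<beta> + - C2 * \<bar>real_of_int i\<bar> powr \<beta>)" by simp
      then show ?thesis using True unfolding exp_add by simp
    qed simp
    then show ?thesis using perturbation_row_sum[OF p, of D i] C(3)[of i]
      by (simp add: V_def Q_def distrib_right)
  qed
  \<comment> \<open>Row i of V only reaches indices k with |k| \<le> |i| + p, so the growth of the
    kernel at k is bounded by its value at |i| + p.\<close>
  define \<rho> where "\<rho> i = Q * exp (- C2 * \<bar>real_of_int i\<bar> powr \<beta>) * ((\<bar>real_of_int i\<bar> + real p + 1) * w (nat \<bar>i\<bar> + p + 1))" for i
  define \<sigma> where "\<sigma> j = w (nat \<bar>j\<bar> + 1)" for j :: int
  define M where "M i j \<zeta> = (\<Sum>k\<in>{i - int p..i + int p}. V i k * green p k j \<zeta>)" for i j \<zeta>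
  have w1: "1 \<le> w n" for n by (rule w_ge1)
  have w0: "0 \<le> w n" for n using w_pos[of n] by simp
  have WM: "wnorm_le w (M i j) (\<rho> i * \<sigma> j)" for i j
  proof -
    let ?B = "(\<bar>real_of_int i\<bar> + real p + 1) * w (nat \<bar>i\<bar> + p + 1) * \<sigma> j"
    have "wnorm_le w (M i j) (\<Sum>k\<in>{i - int p..i + int p}. cmod (V i k) * ((\<bar>real_of_int k\<bar> + 1) * (w (nat \<bar>k\<bar> + 1) * w (nat \<bar>j\<bar> + 1))))"
      unfolding M_def by (intro wnorm_le_sum wnorm_le_cmult wnorm_le_green mono p) auto
    then show ?thesis
    proof (rule wnorm_le_mono)
      have "(\<Sum>k\<in>{i - int p..i + int p}. cmod (V i k) * ((\<bar>real_of_int k\<bar> + 1) * (w (nat \<bar>k\<bar> + 1) * w (nat \<bar>j\<bar> + 1))))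
        \<le> (\<Sum>k\<in>{i - int p..i + int p}. cmod (V i k) * ?B)"
    proof (intro sum_mono mult_left_mono norm_ge_zero)
      fix k assume k: "k \<in> {i - int p..i + int p}"
      have "\<bar>real_of_int k\<bar> + 1 \<le> \<bar>real_of_int i\<bar> + real p + 1" using k by auto
      moreover have "w (nat \<bar>k\<bar> + 1) \<le> w (nat \<bar>i\<bar> + p + 1)" using k by (intro mono) auto
      ultimately show "(\<bar>real_of_int k\<bar> + 1) * (w (nat \<bar>k\<bar> + 1) * w (nat \<bar>j\<bar> + 1)) \<le> ?B"
        unfolding \<sigma>_def mult.assoc by (intro mult_mono mult_nonneg_nonneg w0) auto
    qed
    also have "\<dots> = (\<Sum>k\<in>{i - int p..i + int p}. cmod (V i k)) * ?B" by (simp only: sum_distrib_right)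
    also have "\<dots> \<le> Q * exp (- C2 * \<bar>real_of_int i\<bar> powr \<beta>) * ?B"
      using w0 by (intro mult_right_mono rowV mult_nonneg_nonneg) (auto simp: \<sigma>_def)
    also have "\<dots> = \<rho> i * \<sigma> j" by (simp only: \<rho>_def mult.assoc)
    finally show "(\<Sum>k\<in>{i - int p..i + int p}. cmod (V i k) * ((\<bar>real_of_int k\<bar> + 1) * (w (nat \<bar>k\<bar> + 1) * w (nat \<bar>j\<bar> + 1)))) \<le> \<rho> i * \<sigma> j" .
    qed
  qed
  have \<rho>0: "0 \<le> \<rho> i" for i unfolding \<rho>_def using Q w0 by (intro mult_nonneg_nonneg) auto
  have \<sigma>0: "0 \<le> \<sigma> i" for i unfolding \<sigma>_def by (rule w0)
  have \<rho>\<sigma>: "(\<lambda>i. \<rho> i * \<sigma> i) summable_on UNIV"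
  proof -
    define f where "f n = (real n + (real p + 1)) * exp (- (C2 / 2) * real n powr \<beta>)" for n
    have sf: "summable f" unfolding f_def using C \<beta> by (intro summable_linear_exp_powr) auto
    then have s: "(\<lambda>i::int. (Q * (w (p + 1) * w 1)) * f (nat \<bar>i\<bar>)) summable_on UNIV"
      by (intro summable_on_cmult_right summable_on_int_abs sf) (simp add: f_def)
    show ?thesis
    proof (rule summable_on_comparison_test[OF s])
      fix i :: int
      let ?n = "nat \<bar>i\<bar>"
      have a: "w (?n + p + 1) * w (?n + 1) \<le> (w ?n * w (p + 1)) * (w ?n * w 1)"
        using w_submult[of ?n "p + 1"] w_submult[of ?n 1] w0 by (intro mult_mono mult_nonneg_nonneg) (auto simp: add.assoc)
      have e: "exp (- C2 * real ?n powr \<beta>) * (w ?n * w ?n) = exp (- (C2 / 2) * real ?n powr \<beta>)"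
        by (simp add: w_def c_def exp_add[symmetric] field_simps)
      have r: "real_of_int \<bar>i\<bar> = real ?n" by simp
      have "\<rho> i * \<sigma> i = (Q * exp (- C2 * real ?n powr \<beta>) * (real ?n + (real p + 1))) * (w (?n + p + 1) * w (?n + 1))"
        by (simp add: \<rho>_def \<sigma>_def mult_ac add_ac)
      also have "\<dots> \<le> (Q * exp (- C2 * real ?n powr \<beta>) * (real ?n + (real p + 1))) * ((w ?n * w (p + 1)) * (w ?n * w 1))"
        using Q by (intro mult_left_mono a mult_nonneg_nonneg) auto
      also have "\<dots> = (Q * (w (p + 1) * w 1)) * ((real ?n + (real p + 1)) * (exp (- C2 * real ?n powr \<beta>) * (w ?n * w ?n)))"
        by (simp only: mult_ac)
      also have "\<dots> = (Q * (w (p + 1) * w 1)) * f ?n" unfolding e f_def ..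
      finally show "\<rho> i * \<sigma> i \<le> (Q * (w (p + 1) * w 1)) * f ?n" .
    qed (use \<rho>0 \<sigma>0 in auto)
  qed
  have M0: "M i j 0 = 0" for i j
    unfolding M_def by (intro sum.neutral) (auto simp: green_def half_green_def half_sum_def)
  obtain F K where F: "wnorm_le w F K" "F 0 = 1" "\<And>z v C. cmod z \<le> 1 \<Longrightarrow> v \<noteq> (\<lambda>_. 0) \<Longrightarrow>
    (\<forall>i. cmod (v i) \<le> C * \<rho> i) \<Longrightarrow> (\<forall>i. v i + (\<Sum>\<^sub>\<infinity>j. M i j z * v j) = 0) \<Longrightarrow> F z = 0"
    using fredholm_reduction[of M \<rho> \<sigma>, OF WM \<rho>0 \<sigma>0 \<rho>\<sigma> M0] by blast
  have "F \<zeta> = 0" if \<zeta>: "\<zeta> \<noteq> 0" "cmod \<zeta> < 1" and ev: "eigenvalue D (\<zeta> + 1 / \<zeta>)" for \<zeta>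
  proof -
    obtain u where u: "u \<in> ell2" "u \<noteq> (\<lambda>_. 0)" "mat_op D u = (\<lambda>n. (\<zeta> + 1 / \<zeta>) * u n)"
      using ev unfolding eigenvalue_def by blast
    define U where "U = sqrt (\<Sum>\<^sub>\<infinity>n. (cmod (u n))\<^sup>2)"
    have uU: "cmod (u n) \<le> U" for n
      using finite_sum_le_infsum[of "\<lambda>n. (cmod (u n))\<^sup>2" UNIV "{n}"] u(1)
      by (auto simp: U_def ell2_def intro: real_le_rsqrt)
    have U0: "0 \<le> U" using uU[of 0] norm_ge_zero order_trans by blast
    define v where "v i = (\<Sum>k\<in>{i - int p..i + int p}. V i k * u k)" for i
    have vfree: "v i = (\<zeta> + 1 / \<zeta>) * u i - (\<Sum>k | \<bar>i - k\<bar> = int p \<and> (0 \<le> i \<longleftrightarrow> 0 \<le> k). u k)" for i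
    proof -
      have "v i = (\<Sum>k\<in>{i - int p..i + int p}. D i k * u k)
          - (\<Sum>k\<in>{i - int p..i + int p}. of_bool (\<bar>i - k\<bar> = int p \<and> (0 \<le> i \<longleftrightarrow> 0 \<le> k)) * u k)"
        by (simp add: v_def V_def perturbation_def left_diff_distrib sum_subtractf)
      also have "(\<Sum>k\<in>{i - int p..i + int p}. D i k * u k) = (\<zeta> + 1 / \<zeta>) * u i"
        using fun_cong[OF u(3), of i] unfolding mat_op_banded[OF ban] .
      also have "(\<Sum>k\<in>{i - int p..i + int p}. of_bool (\<bar>i - k\<bar> = int p \<and> (0 \<le> i \<longleftrightarrow> 0 \<le> k)) * u k)
          = (\<Sum>k | \<bar>i - k\<bar> = int p \<and> (0 \<le> i \<longleftrightarrow> 0 \<le> k). u k)"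
        by (rule sum.mono_neutral_cong_right) auto
      finally show ?thesis .
    qed
    have v\<rho>: "cmod (v i) \<le> U * \<rho> i" for i
    proof -
      have "cmod (v i) \<le> (\<Sum>k\<in>{i - int p..i + int p}. cmod (V i k) * U)"
        unfolding v_def by (intro sum_norm_le) (auto simp: norm_mult intro!: mult_left_mono uU)
      also have "\<dots> = (\<Sum>k\<in>{i - int p..i + int p}. cmod (V i k)) * U" by (simp add: sum_distrib_right)
      also have "\<dots> \<le> Q * exp (- C2 * \<bar>real_of_int i\<bar> powr \<beta>) * U" by (intro mult_right_mono rowV U0)
      also have "\<dots> \<le> \<rho> i * U"
      proof (rule mult_right_mono[OF _ U0])
        have "1 * 1 \<le> (\<bar>real_of_int i\<bar> + real p + 1) * w (nat \<bar>i\<bar> + p + 1)"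
          by (rule mult_mono) (use w1 in auto)
        then show "Q * exp (- C2 * \<bar>real_of_int i\<bar> powr \<beta>) \<le> \<rho> i"
          unfolding \<rho>_def using Q mult_left_mono[of 1 "(\<bar>real_of_int i\<bar> + real p + 1) * w (nat \<bar>i\<bar> + p + 1)" "Q * exp (- C2 * \<bar>real_of_int i\<bar> powr \<beta>)"]
          by simp
      qed
      finally show ?thesis by (simp add: mult.commute)
    qed
    from \<rho>\<sigma> have "(\<lambda>i. U * (\<rho> i * \<sigma> i)) summable_on UNIV" by (rule summable_on_cmult_right)
    then have vs: "(\<lambda>i. cmod (v i)) summable_on UNIV"
    proof (rule summable_on_comparison_test)
      fix i
      have "\<rho> i * 1 \<le> \<rho> i * \<sigma> i" by (intro mult_left_mono \<rho>0) (simp add: \<sigma>_def w1)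
      then have "U * \<rho> i \<le> U * (\<rho> i * \<sigma> i)" using U0 by (intro mult_left_mono) auto
      then show "cmod (v i) \<le> U * (\<rho> i * \<sigma> i)" using v\<rho>[of i] by linarith
    qed simp
    have g: "((\<lambda>j. green p k j \<zeta> * v j) has_sum (- u k)) UNIV" for k
      by (rule has_sum_green[OF p \<zeta>]) (rule uU vs vfree)+
    have "v i + (\<Sum>\<^sub>\<infinity>j. M i j \<zeta> * v j) = 0" for i
    proof -
      have "((\<lambda>j. \<Sum>k\<in>{i - int p..i + int p}. V i k * (green p k j \<zeta> * v j)) has_sum (\<Sum>k\<in>{i - int p..i + int p}. V i k * (- u k))) UNIV"
        by (intro has_sum_sum has_sum_cmult_right g)
      moreover have "(\<Sum>k\<in>{i - int p..i + int p}. V i k * (- u k)) = - v i" by (simp add: v_def sum_negf)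
      moreover have "(\<lambda>j. \<Sum>k\<in>{i - int p..i + int p}. V i k * (green p k j \<zeta> * v j)) = (\<lambda>j. M i j \<zeta> * v j)"
        by (simp add: M_def sum_distrib_right mult.assoc)
      ultimately have "((\<lambda>j. M i j \<zeta> * v j) has_sum - v i) UNIV" by simp
      then show ?thesis using infsumI by fastforce
    qed
    \<comment> \<open>Otherwise u would be minus the image of 0 under the free resolvent.\<close>
    moreover have "v \<noteq> (\<lambda>_. 0)"
    proof
      assume "v = (\<lambda>_. 0)"
      then have "((\<lambda>_. 0) has_sum (- u k)) (UNIV :: int set)" for k using g[of k] by simp
      then have "- u k = 0" for k using has_sum_0_simp has_sum_unique by blast
      then show False using u(2) by auto
    qed
    ultimately show "F \<zeta> = 0" using F(3)[of \<zeta> v U] \<zeta>(2) v\<rho> by auto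
  qed
  then show ?thesis using c F(1,2) unfolding w_def by blast
qed

section \<open>Flatness at limits of zeros\<close>

text \<open>Coefficient decay beyond every power, that is, smoothness of the series up to and
  including the unit circle.\<close>

definition rapid :: "(nat \<Rightarrow> complex) \<Rightarrow> bool" where
  "rapid a \<longleftrightarrow> (\<forall>k. summable (\<lambda>n. cmod (a n) * real n ^ k))"

text \<open>A bound for the k-th derivative of the series on the whole closed disc.\<close>

definition moment :: "(nat \<Rightarrow> complex) \<Rightarrow> nat \<Rightarrow> real" where
  "moment a k = (\<Sum>n. cmod (a n) * real n ^ k)"

definition pser :: "(nat \<Rightarrow> complex) \<Rightarrow> complex \<Rightarrow> complex" where
  "pser a z = (\<Sum>n. a n * z ^ n)"

lemma norm_diffs: "cmod (diffs a n) * real n ^ k \<le> cmod (a (Suc n)) * real (Suc n) ^ Suc k"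
proof -
  have "cmod (diffs a n) * real n ^ k = (cmod (a (Suc n)) * real (Suc n)) * real n ^ k"
    by (simp add: diffs_def norm_mult mult_ac del: of_nat_Suc)
  also have "\<dots> \<le> (cmod (a (Suc n)) * real (Suc n)) * real (Suc n) ^ k"
    by (intro mult_left_mono power_mono) auto
  finally show ?thesis by (simp add: mult_ac)
qed

lemma rapid_diffs:
  assumes "rapid a"
  shows "rapid (diffs a)"
  unfolding rapid_def
proof
  fix k
  have "summable (\<lambda>n. cmod (a (Suc n)) * real (Suc n) ^ Suc k)"
    using assms summable_Suc_iff[of "\<lambda>n. cmod (a n) * real n ^ Suc k"] unfolding rapid_def by blast
  then show "summable (\<lambda>n. cmod (diffs a n) * real n ^ k)"
    by (rule summable_comparison_test'[where N = 0]) (use norm_diffs in simp)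
qed

lemma moment_diffs:
  assumes "rapid a"
  shows "moment (diffs a) k \<le> moment a (Suc k)"
proof -
  have s: "summable (\<lambda>n. cmod (a n) * real n ^ Suc k)" using assms unfolding rapid_def by blast
  have "moment (diffs a) k \<le> (\<Sum>n. cmod (a (Suc n)) * real (Suc n) ^ Suc k)"
    unfolding moment_def using rapid_diffs[OF assms] s summable_Suc_iff[of "\<lambda>n. cmod (a n) * real n ^ Suc k"]
    by (intro suminf_le norm_diffs) (auto simp: rapid_def)
  also have "\<dots> = moment a (Suc k)"
    unfolding moment_def using suminf_split_head[OF s] by simp
  finally show ?thesis .
qed

lemma rapid_funpow_diffs: "rapid a \<Longrightarrow> rapid ((diffs ^^ k) a)"
  by (induction k) (auto intro: rapid_diffs)

lemma moment_funpow_diffs: "rapid a \<Longrightarrow> moment ((diffs ^^ k) a) 0 \<le> moment a k"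
proof (induction k arbitrary: a)
  case (Suc k)
  have "moment ((diffs ^^ Suc k) a) 0 \<le> moment (diffs a) k"
    using Suc.IH[OF rapid_diffs[OF Suc.prems]] by (simp add: funpow_swap1)
  also have "\<dots> \<le> moment a (Suc k)" by (rule moment_diffs[OF Suc.prems])
  finally show ?case .
qed simp

lemma pser_term_le: "cmod z \<le> 1 \<Longrightarrow> cmod (a n * z ^ n) \<le> cmod (a n) * real n ^ 0"
  using mult_left_mono[OF power_le_one[of "cmod z" n], of "cmod (a n)"] by (simp add: norm_mult norm_power)

lemma summable_pser:
  assumes "rapid a" "cmod z \<le> 1"
  shows "summable (\<lambda>n. a n * z ^ n)"
  by (rule summable_comparison_test'[where N = 0 and g = "\<lambda>n. cmod (a n) * real n ^ 0"])
    (use assms pser_term_le in \<open>auto simp: rapid_def dest: spec[of _ 0]\<close>)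

lemma norm_pser_le:
  assumes "rapid a" "cmod z \<le> 1"
  shows "cmod (pser a z) \<le> moment a 0"
proof -
  have s: "summable (\<lambda>n. cmod (a n) * real n ^ 0)" using assms(1) unfolding rapid_def by blast
  have s': "summable (\<lambda>n. cmod (a n * z ^ n))"
    by (rule summable_comparison_test'[OF s, where N = 0]) (use pser_term_le[OF assms(2)] in simp)
  have "cmod (pser a z) \<le> (\<Sum>n. cmod (a n * z ^ n))" unfolding pser_def by (rule summable_norm[OF s'])
  also have "\<dots> \<le> moment a 0" unfolding moment_def by (rule suminf_le[OF _ s' s]) (rule pser_term_le[OF assms(2)])
  finally show ?thesis .
qed

lemma pser_has_field_derivative:
  assumes a: "rapid a" and x: "x \<in> cball 0 1"
  shows "(pser a has_field_derivative pser (diffs a) x) (at x within cball 0 1)"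
proof -
  let ?f' = "\<lambda>n z. of_nat n * a n * z ^ (n - Suc 0)"
  have m: "cmod (?f' n z) \<le> cmod (a n) * real n ^ 1" if "z \<in> cball 0 1" for n z
    using mult_left_mono[OF power_le_one[of "cmod z" "n - Suc 0"], of "real n * cmod (a n)"] that
    by (simp add: norm_mult norm_power mult_ac)
  have sm: "summable (\<lambda>n. cmod (a n) * real n ^ 1)" using a unfolding rapid_def by blast
  have ul: "uniform_limit (cball 0 1) (\<lambda>n x. \<Sum>i<n. ?f' i x) (\<lambda>x. suminf (\<lambda>i. ?f' i x)) sequentially"
    by (rule Weierstrass_m_test[OF m sm])
  have "summable (\<lambda>n. a n * 0 ^ n)" by (rule summable_pser[OF a]) simp
  have "\<exists>g. \<forall>x\<in>cball 0 1. (\<lambda>n. a n * x ^ n) sums g x \<and> (g has_field_derivative suminf (\<lambda>i. ?f' i x)) (at x within cball 0 1)"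
  proof (rule has_field_derivative_series[OF convex_cball _ ul])
    show "((\<lambda>z. a n * z ^ n) has_field_derivative ?f' n x) (at x within cball 0 1)" for n x
      by (auto intro!: derivative_eq_intros)
    show "0 \<in> cball (0 :: complex) 1" by simp
  qed fact
  then obtain g where g: "\<And>x. x \<in> cball 0 1 \<Longrightarrow> (\<lambda>n. a n * x ^ n) sums g x"
    "\<And>x. x \<in> cball 0 1 \<Longrightarrow> (g has_field_derivative suminf (\<lambda>i. ?f' i x)) (at x within cball 0 1)"
    by blast
  have gp: "g y = pser a y" if "y \<in> cball 0 1" for y using g(1)[OF that] by (simp add: pser_def sums_iff)
  have "suminf (\<lambda>i. ?f' i x) = pser (diffs a) x"
    using diffs_equiv[OF summable_pser[OF rapid_diffs[OF a]], of x] x by (simp add: sums_iff pser_def)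
  then show ?thesis
    using has_field_derivative_transform_within[OF g(2)[OF x] zero_less_one x] gp by simp
qed

lemma pser_Taylor:
  assumes a: "rapid a" and e: "cmod e \<le> 1" and z: "cmod z \<le> 1"
  shows "cmod (pser a z - (\<Sum>i\<le>n. pser ((diffs ^^ i) a) e * (z - e) ^ i / fact i)) \<le> moment a (Suc n) * cmod (z - e) ^ Suc n / fact n"
proof -
  have "cmod (pser ((diffs ^^ 0) a) z - (\<Sum>i\<le>n. pser ((diffs ^^ i) a) e * (z - e) ^ i / fact i)) \<le> moment a (Suc n) * cmod (z - e) ^ Suc n / fact n"
  proof (rule complex_Taylor[where S = "cball 0 1" and f = "\<lambda>i. pser ((diffs ^^ i) a)"])
    show "(pser ((diffs ^^ i) a) has_field_derivative pser ((diffs ^^ Suc i) a) x) (at x within cball 0 1)" if "x \<in> cball 0 1" for i x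
      using pser_has_field_derivative[OF rapid_funpow_diffs[OF a] that] by simp
    show "cmod (pser ((diffs ^^ Suc n) a) x) \<le> moment a (Suc n)" if "x \<in> cball 0 1" for x
      using norm_pser_le[OF rapid_funpow_diffs[OF a], of x "Suc n"] moment_funpow_diffs[OF a, of "Suc n"] that by (simp del: funpow.simps)
  qed (use e z in auto)
  then show ?thesis by simp
qed

text \<open>If k is the first order with a nonzero derivative c at e, Taylor's formula at a zero z
  gives |c| \<le> B |z - e|, which fails for zeros within |c| / (B + 1) of e.\<close>

lemma pser_derivs_eq_0:
  assumes a: "rapid a" and e: "cmod e \<le> 1"
    and zeros: "\<And>\<epsilon>. 0 < \<epsilon> \<Longrightarrow> \<exists>z. z \<noteq> e \<and> cmod z \<le> 1 \<and> cmod (z - e) < \<epsilon> \<and> pser a z = 0"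
  shows "pser ((diffs ^^ k) a) e = 0"
proof (induction k rule: less_induct)
  case (less k)
  define B where "B = moment a (Suc k)"
  have "summable (\<lambda>n. cmod (a n) * real n ^ Suc k)" using a unfolding rapid_def by blast
  then have B: "0 \<le> B" unfolding B_def moment_def by (rule suminf_nonneg) simp
  show ?case
  proof (rule ccontr)
    assume ne: "pser ((diffs ^^ k) a) e \<noteq> 0" (is "?c \<noteq> 0")
    then have "0 < cmod ?c / (B + 1)" using B by simp
    then obtain z where z: "z \<noteq> e" "cmod z \<le> 1" "cmod (z - e) < cmod ?c / (B + 1)" "pser a z = 0"
      using zeros by blast
    have "(\<Sum>i\<le>k. pser ((diffs ^^ i) a) e * (z - e) ^ i / fact i) = ?c * (z - e) ^ k / fact k"
      using less by (simp add: lessThan_Suc_atMost[symmetric])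
    then have "cmod ?c * cmod (z - e) ^ k / fact k \<le> B * cmod (z - e) ^ Suc k / fact k"
      using pser_Taylor[OF a e z(2), of k] z(4) by (simp add: B_def norm_mult norm_divide norm_power)
    then have "cmod ?c * cmod (z - e) ^ k \<le> (B * cmod (z - e)) * cmod (z - e) ^ k"
      by (simp add: divide_le_cancel mult_ac)
    then have "cmod ?c \<le> B * cmod (z - e)" using z(1) by simp
    also have "\<dots> \<le> (B + 1) * cmod (z - e)" by (intro mult_right_mono) auto
    also have "\<dots> < cmod ?c" using z(3) B by (simp add: less_divide_eq mult.commute)
    finally show False by simp
  qed
qed

lemma pser_flat:
  assumes a: "rapid a" and e: "cmod e \<le> 1"
    and zeros: "\<And>\<epsilon>. 0 < \<epsilon> \<Longrightarrow> \<exists>z. z \<noteq> e \<and> cmod z \<le> 1 \<and> cmod (z - e) < \<epsilon> \<and> pser a z = 0"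
    and z: "cmod z \<le> 1"
  shows "cmod (pser a z) \<le> moment a (Suc n) * cmod (z - e) ^ Suc n / fact n"
  using pser_Taylor[OF a e z, of n] pser_derivs_eq_0[OF a e zeros] by simp

text \<open>The number n^n / n! is one term of the series of exp n.\<close>

lemma ln_fact_ge: "real n * ln (real n) - real n \<le> ln (fact n)"
proof (cases "n = 0")
  case False
  have "real n ^ n / fact n \<le> exp (real n)"
  proof -
    have "(\<Sum>k\<in>{n}. real n ^ k / fact k) \<le> (\<Sum>k. real n ^ k / fact k)"
      using summable_exp[of "real n"] by (intro sum_le_suminf) (auto simp: divide_inverse mult.commute)
    then show ?thesis by (simp add: exp_def divide_inverse mult.commute scaleR_conv_of_real)
  qed
  then have "ln (real n ^ n / fact n) \<le> real n"
    using False by (subst ln_exp[symmetric], intro ln_mono) auto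
  then show ?thesis using False by (simp add: ln_div ln_realpow)
qed simp

text \<open>With y = c n^\<beta> and s = K / \<beta> this is ln (y / s) \<le> y / s, up to a factor
  exp (- s) that is given away.\<close>

lemma power_le_exp_powr:
  fixes c \<beta> :: real
  assumes "0 < c" "0 < \<beta>" "1 \<le> K"
  shows "real n ^ K \<le> exp (real K / \<beta> * ln (real K / (\<beta> * c))) * exp (c * real n powr \<beta>)"
proof (cases "n = 0")
  case False
  define y where "y = c * real n powr \<beta>"
  have y: "0 < y" using False assms by (simp add: y_def)
  define s where "s = real K / \<beta>"
  have s: "0 < s" using assms by (simp add: s_def)
  have "ln (y / s) \<le> y / s - 1" using y s by (intro ln_le_minus_one) auto
  also have "\<dots> \<le> y / s" by simp
  finally have 1: "s * ln (y / s) \<le> y" using s by (simp add: field_simps)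
  have 2: "ln (y / s) = ln c + \<beta> * ln (real n) - ln s"
    using y s False assms by (simp add: y_def ln_div ln_mult ln_powr)
  have 3: "ln (real K / (\<beta> * c)) = ln s - ln c"
  proof -
    have "real K / (\<beta> * c) = s / c" by (simp add: s_def)
    then show ?thesis using s assms by (simp add: ln_div)
  qed
  have 4: "real K * ln (real n) = s * (\<beta> * ln (real n))" using assms by (simp add: s_def)
  have "real K * ln (real n) \<le> s * ln (real K / (\<beta> * c)) + y"
    using 1 unfolding 2 3 4 by (simp add: algebra_simps)
  then have "exp (real K * ln (real n)) \<le> exp (s * ln (real K / (\<beta> * c)) + y)" by simp
  moreover have "exp (real K * ln (real n)) = real n ^ K"
    using False by (simp add: exp_of_nat_mult)
  ultimately show ?thesis by (simp add: exp_add s_def y_def)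
qed (use assms in \<open>simp add: zero_power\<close>)

text \<open>The weight forces the moments to grow at most like (K / (\<beta> c))^(K / \<beta>),
  which is Gevrey regularity of order 1 / \<beta> on the closed disc.\<close>

lemma wnorm_le_coeffs:
  assumes f: "wnorm_le (\<lambda>n. exp (c * real n powr \<beta>)) f A" and c: "0 < c" "0 < \<beta>"
  shows "\<exists>a. rapid a \<and> (\<forall>z. cmod z \<le> 1 \<longrightarrow> f z = pser a z) \<and>
    (\<forall>K\<ge>1. moment a K \<le> exp (real K / \<beta> * ln (real K / (\<beta> * c))) * A)"
proof -
  obtain a where a: "\<And>F. finite F \<Longrightarrow> (\<Sum>n\<in>F. cmod (a n) * exp (c * real n powr \<beta>)) \<le> A"
    "\<And>z. cmod z \<le> 1 \<Longrightarrow> ((\<lambda>n. a n * z ^ n) has_sum f z) UNIV"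
    using f unfolding wnorm_le_def by blast
  let ?w = "\<lambda>n. cmod (a n) * exp (c * real n powr \<beta>)"
  have sw: "summable ?w"
    by (rule summable_on_imp_summable, rule nonneg_bdd_above_summable_on, simp, rule bdd_aboveI2[where M = A]) (auto intro: a)
  have swA: "suminf ?w \<le> A" by (rule suminf_le_const[OF sw]) (auto intro: a)
  have le: "cmod (a n) * real n ^ K \<le> exp (real K / \<beta> * ln (real K / (\<beta> * c))) * ?w n" if "1 \<le> K" for n K
    using mult_left_mono[OF power_le_exp_powr[OF c that, of n], of "cmod (a n)"] by (simp add: mult_ac)
  have sK: "summable (\<lambda>n. cmod (a n) * real n ^ K)" if "1 \<le> K" for K
    by (rule summable_comparison_test'[OF summable_mult[OF sw], where N = 0]) (use le[OF that] in simp)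
  have s0: "summable (\<lambda>n. cmod (a n) * real n ^ 0)"
    by (rule summable_comparison_test'[OF sw, where N = 0]) (use c in \<open>auto intro!: mult_left_mono simp: mult_le_cancel_left1\<close>)
  have "rapid a" unfolding rapid_def
  proof
    show "summable (\<lambda>n. cmod (a n) * real n ^ k)" for k by (cases "k = 0") (use s0 sK[of k] in auto)
  qed
  moreover have "f z = pser a z" if "cmod z \<le> 1" for z
    using has_sum_imp_sums[OF a(2)[OF that]] by (simp add: pser_def sums_iff)
  moreover have "moment a K \<le> exp (real K / \<beta> * ln (real K / (\<beta> * c))) * A" if "1 \<le> K" for K
  proof -
    have "moment a K \<le> (\<Sum>n. exp (real K / \<beta> * ln (real K / (\<beta> * c))) * ?w n)"
      unfolding moment_def by (rule suminf_le[OF le[OF that] sK[OF that] summable_mult[OF sw]])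
    also have "\<dots> = exp (real K / \<beta> * ln (real K / (\<beta> * c))) * suminf ?w" by (rule suminf_mult[OF sw])
    also have "\<dots> \<le> exp (real K / \<beta> * ln (real K / (\<beta> * c))) * A" using swA by simp
    finally show ?thesis .
  qed
  ultimately show ?thesis by blast
qed

text \<open>Optimizing the order \<open>K\<close> of the Taylor expansion at a point where \<open>f\<close> vanishes to infinite order.\<close>

theorem flat_at_zero_limit:
  assumes f: "wnorm_le (\<lambda>n. exp (c * real n powr \<beta>)) f A" and c: "0 < c" "0 < \<beta>" "\<beta> < 1"
  shows "\<exists>B L. 0 < B \<and> 0 < L \<and> (\<forall>e z. cmod e \<le> 1 \<longrightarrow> cmod z \<le> 1 \<longrightarrow>
    (\<forall>\<epsilon>>0. \<exists>x. x \<noteq> e \<and> cmod x \<le> 1 \<and> cmod (x - e) < \<epsilon> \<and> f x = 0) \<longrightarrow>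
    cmod (f z) \<le> B * exp (- ((L * cmod (z - e)) powr (- (\<beta> / (1 - \<beta>))))))"
proof -
  obtain a where a: "rapid a" "\<And>z. cmod z \<le> 1 \<Longrightarrow> f z = pser a z"
    "\<And>K. 1 \<le> K \<Longrightarrow> moment a K \<le> exp (real K / \<beta> * ln (real K / (\<beta> * c))) * A"
    using wnorm_le_coeffs[OF f c(1,2)] by blast
  interpret weight "\<lambda>n. exp (c * real n powr \<beta>)" using c by (intro weight_exp_powr) auto
  have A: "0 \<le> A" by (rule wnorm_le_nonneg[OF f])
  define g where "g = \<beta> / (1 - \<beta>)"
  have g: "0 < g" using c by (simp add: g_def)
  \<comment> \<open>The quotient cancels the constant in the moment bound. Of the 3, two units pay
    for the factorial and one yields the final factor exp (- K).\<close>
  define L where "L = exp (3 - ln (\<beta> * c) / \<beta>)"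
  define B where "B = (A + 1) * exp 1"
  have B: "0 < B" using A by (simp add: B_def)
  have "cmod (f z) \<le> B * exp (- ((L * cmod (z - e)) powr (- g)))"
    if e: "cmod e \<le> 1" and z: "cmod z \<le> 1"
      and zeros: "\<And>\<epsilon>. 0 < \<epsilon> \<Longrightarrow> \<exists>x. x \<noteq> e \<and> cmod x \<le> 1 \<and> cmod (x - e) < \<epsilon> \<and> f x = 0" for e z
  proof -
    define d where "d = cmod (z - e)"
    \<comment> \<open>For z = e the convention \<open>0 powr a = 0\<close> gives X = 0, and the
      claim is just a uniform bound.\<close>
    define X where "X = (L * d) powr (- g)"
    have zeros': "\<exists>x. x \<noteq> e \<and> cmod x \<le> 1 \<and> cmod (x - e) < \<epsilon> \<and> pser a x = 0" if "0 < \<epsilon>" for \<epsilon>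
      using zeros[OF that] a(2) by force
    \<comment> \<open>Rounding down costs the factor \<open>exp 1\<close> in B.\<close>
    define K where "K = nat \<lfloor>X\<rfloor>"
    have X0: "0 \<le> X" by (simp add: X_def)
    then have KX: "real K \<le> X" "X < real K + 1" unfolding K_def by linarith+
    have "cmod (f z) \<le> A * exp (- real K)"
    proof (cases "K = 0")
      case True
      then show ?thesis using wnorm_le_norm[OF f z] by simp
    next
      case False
      then have K1: "1 \<le> K" by simp
      then have "X \<noteq> 0" using KX by linarith
      then have d: "0 < d" by (auto simp: X_def d_def)
      obtain n where n: "K = Suc n" using False not0_implies_Suc by blast
      have lnL: "ln L = 3 - ln (\<beta> * c) / \<beta>" by (simp add: L_def)
      have L: "0 < L" by (simp add: L_def)
      have "ln (real K) \<le> ln X" using K1 KX by simp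
      also have "ln X = - g * (ln L + ln d)" using d L by (simp add: X_def ln_powr ln_mult)
      finally have "ln (real K) / g \<le> - (ln L + ln d)" using g by (simp add: field_simps)
      \<comment> \<open>Logarithmic form of K^(1/\<beta> - 1) * L * d \<le> 1, since 1 / g = 1 /
        \<beta> - 1.\<close>
      then have lk: "ln (real K) / \<beta> - ln (real K) + (3 - ln (\<beta> * c) / \<beta>) + ln d \<le> 0"
        using c unfolding lnL by (simp add: g_def diff_divide_distrib right_diff_distrib)
      \<comment> \<open>The remainder carries the factorial of n = K - 1; passing to that of K costs
        ln K \<le> K.\<close>
      have lnf: "- ln (fact n) \<le> 2 * real K - real K * ln (real K)"
      proof -
        have "ln (fact K :: real) = ln (real K) + ln (fact n)" unfolding n by (simp add: ln_mult)
        moreover have "ln (real K) \<le> real K" using ln_le_minus_one[of "real K"] K1 by simp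
        ultimately show ?thesis using ln_fact_ge[of K] by linarith
      qed
      have "cmod (f z) \<le> moment a K * d ^ K / fact n"
        unfolding n d_def using pser_flat[OF a(1) e zeros' z, of n] a(2)[OF z] by simp
      also have "\<dots> \<le> exp (real K / \<beta> * ln (real K / (\<beta> * c))) * A * d ^ K / fact n"
        by (intro divide_right_mono mult_right_mono a(3) K1) (simp_all add: d_def)
      also have "\<dots> = A * exp (real K / \<beta> * ln (real K / (\<beta> * c)) + real K * ln d - ln (fact n))"
        using d by (simp add: exp_add exp_diff exp_of_nat_mult mult_ac)
      also have "\<dots> \<le> A * exp (- real K)"
      proof (intro mult_left_mono A, subst exp_le_cancel_iff)
        have "ln (real K / (\<beta> * c)) = ln (real K) - ln (\<beta> * c)" using K1 c by (simp add: ln_div)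
        then have e: "real K / \<beta> * ln (real K / (\<beta> * c)) = real K * (ln (real K) / \<beta> - ln (\<beta> * c) / \<beta>)"
          by (simp add: diff_divide_distrib right_diff_distrib)
        have "real K / \<beta> * ln (real K / (\<beta> * c)) + real K * ln d - ln (fact n)
            \<le> real K * (ln (real K) / \<beta> - ln (\<beta> * c) / \<beta> + ln d) + (2 * real K - real K * ln (real K))"
          unfolding e using lnf by (simp add: algebra_simps)
        also have "\<dots> = real K * (ln (real K) / \<beta> - ln (real K) + (3 - ln (\<beta> * c) / \<beta>) + ln d) - real K"
          by (simp add: algebra_simps)
        also have "\<dots> \<le> - real K" using mult_left_mono[OF lk, of "real K"] by simp
        finally show "real K / \<beta> * ln (real K / (\<beta> * c)) + real K * ln d - ln (fact n) \<le> - real K" .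
      qed
      finally show ?thesis .
    qed
    also have "\<dots> \<le> A * exp (1 - X)" using KX A by (intro mult_left_mono) auto
    also have "\<dots> = A * exp 1 * exp (- X)" by (simp add: exp_diff exp_minus field_simps)
    also have "\<dots> \<le> B * exp (- X)" unfolding B_def by (intro mult_right_mono) auto
    finally show ?thesis by (simp add: X_def d_def)
  qed
  moreover have "0 < L" by (simp add: L_def)
  ultimately show ?thesis using B unfolding g_def by blast
qed

section \<open>Jensen's inequality\<close>

text \<open>One step moves the first factor to the end, where periodicity identifies it.\<close>

lemma prod_cyclic_shift:
  fixes g :: "real \<Rightarrow> 'a::comm_monoid_mult"
  assumes "\<And>x. g (x + h * real N) = g x" "0 < N"
  shows "(\<Prod>k<N. g (x + h * real m + h * real k)) = (\<Prod>k<N. g (x + h * real k))"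
proof (induction m)
  case (Suc m)
  obtain N' where N': "N = Suc N'" using assms(2) gr0_implies_Suc by blast
  define y where "y = x + h * real m"
  have e: "x + h * real (Suc m) + h * real k = y + h * real (Suc k)" for k
    by (simp add: y_def algebra_simps)
  have "(\<Prod>k<N. g (x + h * real (Suc m) + h * real k)) = (\<Prod>k<N'. g (y + h * real (Suc k))) * g (y + h * real N)"
    unfolding e by (simp add: N')
  also have "\<dots> = g (y + h * real 0) * (\<Prod>k<N'. g (y + h * real (Suc k)))"
    using assms(1) by (simp add: mult.commute)
  also have "\<dots> = (\<Prod>k<N. g (y + h * real k))"
    unfolding N' prod.lessThan_Suc_shift ..
  finally show ?case using Suc by (simp add: y_def)
qed simp

text \<open>Jensen's inequality for the integral mean of \<open>ln \<bar>f\<bar>\<close>, in the form of an upper bound for minorants of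
  \<open>- ln \<bar>f\<bar>\<close>: the product of the \<open>N\<close> rotations of \<open>f\<close> has value \<open>1\<close> at \<open>0\<close>, so by the maximum principle it has
  modulus at least \<open>1\<close> somewhere on the circle, which bounds a Riemann sum of the minorant.\<close>

theorem jensen_mean:
  fixes f :: "complex \<Rightarrow> complex" and H :: "real \<Rightarrow> real"
  assumes cf: "continuous_on (cball 0 1) f" and hf: "f holomorphic_on ball 0 1" and f0: "f 0 = 1"
    and H: "continuous_on {0..2 * pi} H"
    and le: "\<And>t. t \<in> {0..2 * pi} \<Longrightarrow> cmod (f (cis t)) \<le> exp (l - H t)"
  shows "integral {0..2 * pi} H \<le> 2 * pi * l"
proof (rule field_le_epsilon)
  fix \<epsilon>' :: real assume "0 < \<epsilon>'"
  define \<epsilon> where "\<epsilon> = \<epsilon>' / (2 * pi)"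
  have \<epsilon>: "0 < \<epsilon>" "2 * pi * \<epsilon> = \<epsilon>'" using \<open>0 < \<epsilon>'\<close> by (simp_all add: \<epsilon>_def)
  have "uniformly_continuous_on {0..2 * pi} H" using compact_uniformly_continuous[OF H] by simp
  then obtain \<delta> where \<delta>: "0 < \<delta>" "\<And>s t. s \<in> {0..2 * pi} \<Longrightarrow> t \<in> {0..2 * pi} \<Longrightarrow> \<bar>s - t\<bar> < \<delta> \<Longrightarrow> \<bar>H s - H t\<bar> < \<epsilon>"
    unfolding uniformly_continuous_on_def dist_real_def using \<epsilon>(1) by metis
  obtain N :: nat where N: "2 * pi / \<delta> < real N" using reals_Archimedean2 by blast
  then have N0: "0 < real N" using \<delta>(1) pi_gt_zero by (smt (verit) divide_pos_pos)
  define h where "h = 2 * pi / real N"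
  have h: "0 < h" "h < \<delta>" "h * real N = 2 * pi" using N N0 \<delta>(1) by (simp_all add: h_def field_simps)
  define P where "P z = (\<Prod>k<N. f (z * cis (h * real k)))" for z
  have cP: "continuous_on (cball 0 1) P"
    unfolding P_def by (intro continuous_intros continuous_on_compose2[OF cf]) (auto simp: norm_mult)
  have hP: "P holomorphic_on ball 0 1"
    unfolding P_def
    by (intro holomorphic_intros holomorphic_on_compose_gen[OF _ hf, unfolded o_def]) (auto simp: norm_mult)
  have P0: "P 0 = 1" by (simp add: P_def f0)
  obtain z0 where z0: "z0 \<in> sphere 0 1" "\<And>z. z \<in> sphere 0 1 \<Longrightarrow> cmod (P z) \<le> cmod (P z0)"
  proof -
    have "continuous_on (sphere 0 1) (\<lambda>z. cmod (P z))"
      using continuous_on_subset[OF cP] by (intro continuous_on_norm) auto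
    then have "\<exists>x\<in>sphere 0 1. \<forall>y\<in>sphere 0 1. cmod (P y) \<le> cmod (P x)"
      by (intro continuous_attains_sup) auto
    then show ?thesis using that by blast
  qed
  have "cmod (P 0) \<le> cmod (P z0)"
    by (rule maximum_modulus_frontier[of P "cball 0 1"]) (use hP cP z0 in auto)
  then have Pz0: "1 \<le> cmod (P z0)" by (simp add: P0)
  define \<phi> where "\<phi> = Arg2pi z0"
  have \<phi>: "0 \<le> \<phi>" "z0 = cis \<phi>"
    using z0(1) Arg2pi_eq[of z0] Arg2pi_ge_0[of z0] by (auto simp: \<phi>_def cis_conv_exp mult.commute)
  define m where "m = nat \<lfloor>\<phi> / h\<rfloor>"
  have "real m \<le> \<phi> / h" "\<phi> / h < real m + 1"
    using \<phi>(1) h(1) unfolding m_def by (simp_all add: floor_divide_lower)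
  then have m: "h * real m \<le> \<phi>" "\<phi> < h * real m + h" using h(1) by (simp_all add: field_simps)
  \<comment> \<open>The angle of the maximum point modulo the mesh h. By cyclic invariance the
    product may be started there, and each cell of the partition then contains a node.\<close>
  define \<theta> where "\<theta> = \<phi> - h * real m"
  have \<theta>: "0 \<le> \<theta>" "\<theta> < h" using m by (simp_all add: \<theta>_def)
  have node: "\<theta> + h * real k \<in> {h * real k..h * real (Suc k)}" for k using \<theta> by (simp add: algebra_simps)
  have sub: "{h * real k..h * real (Suc k)} \<subseteq> {0..2 * pi}" if "k < N" for k
  proof -
    have "h * real (Suc k) \<le> h * real N" using that h(1) by (intro mult_left_mono) auto
    then show ?thesis using h by auto
  qed
  have "cmod (P z0) = (\<Prod>k<N. cmod (f (cis (\<theta> + h * real m + h * real k))))"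
    by (simp add: P_def \<phi>(2) cis_mult \<theta>_def prod_norm)
  also have "\<dots> = (\<Prod>k<N. cmod (f (cis (\<theta> + h * real k))))"
  proof (rule prod_cyclic_shift)
    show "cmod (f (cis (x + h * real N))) = cmod (f (cis x))" for x
      unfolding h(3) by (simp add: cis_mult[symmetric])
  qed (use N0 in simp)
  also have "\<dots> \<le> (\<Prod>k<N. exp (l - H (\<theta> + h * real k)))"
    using node sub by (intro prod_mono conjI le norm_ge_zero) blast
  also have "\<dots> = exp (\<Sum>k<N. l - H (\<theta> + h * real k))" by (simp add: exp_sum)
  finally have "1 \<le> exp (\<Sum>k<N. l - H (\<theta> + h * real k))" using Pz0 by linarith
  then have "0 \<le> (\<Sum>k<N. l - H (\<theta> + h * real k))" by simp
  \<comment> \<open>A Riemann sum of H with one node per cell.\<close>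
  then have S: "(\<Sum>k<N. H (\<theta> + h * real k)) \<le> real N * l" by (simp add: sum_subtractf)
  have int: "H integrable_on {a..b}" if "{a..b} \<subseteq> {0..2 * pi}" for a b
    using continuous_on_subset[OF H that] by (rule integrable_continuous_real)
  have "integral {0..h * real n} H = (\<Sum>k<n. integral {h * real k..h * real (Suc k)} H)" if "n \<le> N" for n
    using that
  proof (induction n)
    case (Suc n)
    have "integral {0..h * real n} H + integral {h * real n..h * real (Suc n)} H = integral {0..h * real (Suc n)} H"
    proof (rule Henstock_Kurzweil_Integration.integral_combine)
      have "h * real (Suc n) \<le> 2 * pi" using sub[of n] Suc.prems h(1) by auto
      then show "H integrable_on {0..h * real (Suc n)}" by (intro int) auto
    qed (use h(1) in \<open>auto intro!: mult_left_mono\<close>)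
    then show ?case using Suc by simp
  qed simp
  from this[of N] have "integral {0..2 * pi} H = (\<Sum>k<N. integral {h * real k..h * real (Suc k)} H)"
    by (simp add: h(3))
  also have "\<dots> \<le> (\<Sum>k<N. h * (H (\<theta> + h * real k) + \<epsilon>))"
  proof (rule sum_mono)
    fix k assume "k \<in> {..<N}"
    then have k: "{h * real k..h * real (Suc k)} \<subseteq> {0..2 * pi}" using sub by blast
    have "integral {h * real k..h * real (Suc k)} H \<le> integral {h * real k..h * real (Suc k)} (\<lambda>_. H (\<theta> + h * real k) + \<epsilon>)"
    proof (rule integral_le[OF int[OF k]])
      fix t assume t: "t \<in> {h * real k..h * real (Suc k)}"
      have "\<bar>t - (\<theta> + h * real k)\<bar> \<le> h" using t node[of k] by (auto simp: algebra_simps)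
      then have "\<bar>H t - H (\<theta> + h * real k)\<bar> < \<epsilon>"
        using h(2) by (intro \<delta>(2) subsetD[OF k t] subsetD[OF k node]) auto
      then show "H t \<le> H (\<theta> + h * real k) + \<epsilon>" by linarith
    qed (rule integrable_const_ivl)
    also have "\<dots> = h * (H (\<theta> + h * real k) + \<epsilon>)" using h(1) by (simp add: algebra_simps)
    finally show "integral {h * real k..h * real (Suc k)} H \<le> h * (H (\<theta> + h * real k) + \<epsilon>)" .
  qed
  also have "\<dots> = h * (\<Sum>k<N. H (\<theta> + h * real k)) + (h * real N) * \<epsilon>"
    by (simp add: sum_distrib_left distrib_left sum.distrib)
  also have "\<dots> \<le> h * (real N * l) + (h * real N) * \<epsilon>"
    using h(1) S by (intro add_right_mono mult_left_mono) auto
  also have "\<dots> = 2 * pi * l + \<epsilon>'" using h(3) \<epsilon>(2) by (simp add: mult.assoc[symmetric])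
  finally show "integral {0..2 * pi} H \<le> 2 * pi * l + \<epsilon>'" .
qed

text \<open>A lower bound for the integral of dist^(-g) in terms of a finite step function. Jensen's
  inequality is applied to H, the power of the distance truncated at height \<eta>^(-g), which is
  continuous and lies above the step function.\<close>

theorem flat_cover_bound:
  fixes f :: "complex \<Rightarrow> complex" and E :: "complex set"
  assumes cf: "continuous_on (cball 0 1) f" and hf: "f holomorphic_on ball 0 1" and f0: "f 0 = 1"
    and E: "closed E" "E \<noteq> {}" and BL: "0 < B" "0 < L" "0 < g"
    and fE: "\<And>z. z \<in> E \<Longrightarrow> f z = 0"
    and flat: "\<And>e z. e \<in> E \<Longrightarrow> cmod z \<le> 1 \<Longrightarrow> cmod (f z) \<le> B * exp (- ((L * cmod (z - e)) powr (- g)))"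
    and K: "finite K" and disj: "disjoint_family_on S K"
    and S: "\<And>k. k \<in> K \<Longrightarrow> S k \<in> sets borel \<and> S k \<subseteq> {0..2 * pi}"
    and \<delta>: "\<And>k. k \<in> K \<Longrightarrow> 0 < \<delta> k"
    and near: "\<And>k t. k \<in> K \<Longrightarrow> t \<in> S k \<Longrightarrow> \<exists>e\<in>E. cmod (cis t - e) \<le> \<delta> k"
  shows "(\<Sum>k\<in>K. \<delta> k powr (- g) * measure lborel (S k)) \<le> L powr g * (2 * pi * ln B)"
proof (cases "K = {}")
  case True
  obtain e where "e \<in> E" using E by blast
  \<comment> \<open>The empty sum is 0, so ln B has to be nonnegative: the flatness bound is read
    off at 0, where f is 1.\<close>
  then have "cmod (f 0) \<le> B * exp (- ((L * cmod (0 - e)) powr (- g)))" by (rule flat) simp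
  also have "\<dots> \<le> B * 1" using BL by (intro mult_left_mono) auto
  finally have "0 \<le> ln B" using f0 by simp
  then show ?thesis using True by simp
next
  case False
  \<comment> \<open>The truncation lies below every scale L * \<delta> k, hence does not affect the
    comparison on the sets S k.\<close>
  define \<eta> where "\<eta> = Min ((\<lambda>k. L * \<delta> k) ` K)"
  have \<eta>: "0 < \<eta>" "\<And>k. k \<in> K \<Longrightarrow> \<eta> \<le> L * \<delta> k"
    using False K \<delta> BL unfolding \<eta>_def by auto
  define d where "d t = infdist (cis t) E" for t
  define H where "H t = max (L * d t) \<eta> powr (- g)" for t
  have cH: "continuous_on {0..2 * pi} H"
    unfolding H_def d_def using \<eta>(1) by (intro continuous_intros) (auto simp: max_def)
  have "cmod (f (cis t)) \<le> exp (ln B - H t)" for t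
  proof -
    obtain e where e: "e \<in> E" "d t = cmod (cis t - e)"
      using infdist_attains_inf[OF E, of "cis t"] by (auto simp: d_def dist_norm)
    show ?thesis
    proof (cases "d t = 0")
      case True
      \<comment> \<open>On E itself the flatness bound degenerates to B, since
        \<open>0 powr (- g) = 0\<close>; the zero of f replaces it.\<close>
      then have "f (cis t) = 0" using e fE[OF e(1)] by simp
      then show ?thesis by simp
    next
      case False
      then have d: "0 < d t" using infdist_nonneg[of "cis t" E] by (simp add: d_def)
      have "H t \<le> (L * d t) powr (- g)"
        unfolding H_def using d BL by (intro powr_mono2') auto
      then have "B * exp (- ((L * cmod (cis t - e)) powr (- g))) \<le> B * exp (- H t)"
        unfolding e(2)[symmetric] using BL by (intro mult_left_mono) auto
      also have "\<dots> = exp (ln B - H t)" using BL by (simp add: exp_diff exp_minus field_simps)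
      finally show ?thesis using flat[OF e(1), of "cis t"] by simp
    qed
  qed
  then have int: "integral {0..2 * pi} H \<le> 2 * pi * ln B"
    by (intro jensen_mean[OF cf hf f0 cH])
  have m: "S k \<in> sets lborel" if "k \<in> K" for k using S[OF that] by simp
  have fin: "emeasure lborel (S k) < \<infinity>" if "k \<in> K" for k
  proof -
    have "emeasure lborel (S k) \<le> emeasure lborel {0..2 * pi}" using S[OF that] by (intro emeasure_mono) auto
    also have "\<dots> < \<infinity>" by simp
    finally show ?thesis .
  qed
  have intH: "set_integrable lborel {0..2 * pi} H"
    by (rule borel_integrable_atLeastAtMost'[OF cH])
  have "(\<Sum>k\<in>K. (L * \<delta> k) powr (- g) * measure lborel (S k)) =
      (\<integral>t. (\<Sum>k\<in>K. (L * \<delta> k) powr (- g) * indicator (S k) t) \<partial>lborel)"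
    using m fin by (subst Bochner_Integration.integral_sum) auto
  also have "\<dots> \<le> (\<integral>t. indicator {0..2 * pi} t *\<^sub>R H t \<partial>lborel)"
  proof (rule integral_mono)
    show "integrable lborel (\<lambda>t. \<Sum>k\<in>K. (L * \<delta> k) powr (- g) * indicator (S k) t)"
      using m fin by (intro Bochner_Integration.integrable_sum) auto
    show "integrable lborel (\<lambda>t. indicator {0..2 * pi} t *\<^sub>R H t)"
      using intH by (simp add: set_integrable_def)
    show "(\<Sum>k\<in>K. (L * \<delta> k) powr (- g) * indicator (S k) t) \<le> indicator {0..2 * pi} t *\<^sub>R H t" for t
    proof (cases "\<exists>k\<in>K. t \<in> S k")
      case True
      then obtain k where k: "k \<in> K" "t \<in> S k" by blast
      have "(\<Sum>j\<in>K. (L * \<delta> j) powr (- g) * indicator (S j) t) = (\<Sum>j\<in>{k}. (L * \<delta> j) powr (- g) * indicator (S j) t)"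
        using K k disj by (intro sum.mono_neutral_right) (auto simp: disjoint_family_on_def indicator_def)
      also have "\<dots> = (L * \<delta> k) powr (- g)" using k by simp
      also have "\<dots> \<le> H t"
      proof -
        obtain e where e: "e \<in> E" "cmod (cis t - e) \<le> \<delta> k" using near[OF k] by blast
        have "d t \<le> \<delta> k" using infdist_le2[OF e(1)] e(2) by (simp add: d_def dist_norm)
        then have "L * d t \<le> L * \<delta> k" using BL by simp
        then show ?thesis
          unfolding H_def using \<eta> k BL by (intro powr_mono2') auto
      qed
      finally have "(\<Sum>j\<in>K. (L * \<delta> j) powr (- g) * indicator (S j) t) \<le> H t" .
      moreover have "t \<in> {0..2 * pi}" using S[OF k(1)] k(2) by blast
      ultimately show ?thesis by simp
    next
      case False
      then have "(\<Sum>j\<in>K. (L * \<delta> j) powr (- g) * indicator (S j) t) = 0"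
        by (intro sum.neutral) auto
      then show ?thesis by (simp add: H_def)
    qed
  qed
  also have "\<dots> = integral {0..2 * pi} H"
    using set_borel_integral_eq_integral(2)[OF intH] by (simp add: set_lebesgue_integral_def)
  finally have fin': "(\<Sum>k\<in>K. (L * \<delta> k) powr (- g) * measure lborel (S k)) \<le> 2 * pi * ln B" using int by linarith
  have "(\<Sum>k\<in>K. \<delta> k powr (- g) * measure lborel (S k)) = L powr g * (\<Sum>k\<in>K. (L * \<delta> k) powr (- g) * measure lborel (S k))"
    unfolding sum_distrib_left
  proof (rule sum.cong)
    fix k assume "k \<in> K"
    then have "(L * \<delta> k) powr (- g) = L powr (- g) * \<delta> k powr (- g)"
      using \<delta>[of k] BL by (simp add: powr_mult)
    moreover have "L powr g * L powr (- g) = 1" using BL by (simp add: powr_add[symmetric])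
    ultimately show "\<delta> k powr (- g) * measure lborel (S k) = L powr g * ((L * \<delta> k) powr (- g) * measure lborel (S k))"
      by (simp add: mult.assoc[symmetric])
  qed simp
  also have "\<dots> \<le> L powr g * (2 * pi * ln B)" using fin' by (intro mult_left_mono) auto
  finally show ?thesis .
qed

section \<open>Gaps of the limit set\<close>

text \<open>The preimage of F under \<zeta> + 1/\<zeta> on the unit circle, where this map equals
  twice the real part. It is symmetric under conjugation.\<close>

definition circle_lift :: "real set \<Rightarrow> complex set" where
  "circle_lift F = {z. cmod z = 1 \<and> 2 * Re z \<in> F}"

text \<open>Encodes that the integral of dist (cis t, E)^(-g) is at most C, through step functions:
  on A the distance is at most \<delta> A. Each application picks its own sets and scales.\<close>

definition cover_bound :: "complex set \<Rightarrow> real \<Rightarrow> real \<Rightarrow> bool" where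
  "cover_bound E g C \<longleftrightarrow> (\<forall>\<S> \<delta>. finite \<S> \<longrightarrow> disjoint \<S> \<longrightarrow>
     (\<forall>A\<in>\<S>. A \<in> sets borel \<and> A \<subseteq> {0..2 * pi} \<and> 0 < \<delta> A \<and> (\<forall>t\<in>A. \<exists>e\<in>E. cmod (cis t - e) \<le> \<delta> A)) \<longrightarrow>
     (\<Sum>A\<in>\<S>. \<delta> A powr (- g) * measure lborel A) \<le> C)"

lemma cis_circle_lift: "cis t \<in> circle_lift F \<longleftrightarrow> 2 * cos t \<in> F"
  by (simp add: circle_lift_def)

lemma closed_circle_lift:
  assumes "closed F"
  shows "closed (circle_lift F)"
proof -
  have "circle_lift F = sphere 0 1 \<inter> (\<lambda>z. 2 * Re z) -` F" by (auto simp: circle_lift_def)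
  moreover have "closed ((\<lambda>z. 2 * Re z) -` F)" by (intro closed_vimage assms continuous_intros)
  ultimately show ?thesis by (simp add: closed_Int)
qed

lemma norm_cis_diff_le: "cmod (cis t - cis s) \<le> \<bar>t - s\<bar>"
proof -
  have "(cmod (cis t - cis s))\<^sup>2 = (cos t - cos s)\<^sup>2 + (sin t - sin s)\<^sup>2"
    by (simp add: cmod_power2)
  also have "\<dots> = 2 - 2 * cos (t - s)"
    using sin_cos_squared_add[of t] sin_cos_squared_add[of s] by (simp add: power2_diff cos_diff algebra_simps)
  also have "\<dots> = 4 * (sin ((t - s) / 2))\<^sup>2"
  proof -
    have e: "2 * ((t - s) / 2) = t - s" by simp
    show ?thesis using cos_double_sin[of "(t - s) / 2"] unfolding e by simp
  qed
  also have "\<dots> \<le> 4 * ((t - s) / 2)\<^sup>2"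
    using abs_sin_x_le_abs_x[of "(t - s) / 2"] by (simp only: abs_le_square_iff)
  also have "\<dots> = \<bar>t - s\<bar>\<^sup>2" by (simp add: power2_eq_square)
  finally show ?thesis by (rule power2_le_imp_le[OF _ abs_ge_zero])
qed

lemma cos_diff_le: "\<bar>cos t - cos s\<bar> \<le> \<bar>t - s\<bar>" for t s :: real
  using order_trans[OF abs_Re_le_cmod norm_cis_diff_le[of t s]] by simp

text \<open>The set of angles lying over F is at distance 0, so any \<delta> is admissible; the one
  chosen makes the weighted measure equal to |C| + 1. Then F is the image of a null set under a
  smooth map.\<close>

lemma cover_bound_null:
  assumes cb: "cover_bound (circle_lift F) g C" and g: "0 < g" and F: "closed F" "F \<subseteq> {-2..2}"
  shows "F \<in> null_sets lborel"
proof -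
  define T where "T = {t \<in> {0..2 * pi}. 2 * cos t \<in> F}"
  have "T = {0..2 * pi} \<inter> (\<lambda>t. 2 * cos t) -` F" by (auto simp: T_def)
  moreover have "closed ((\<lambda>t. 2 * cos t) -` F)" by (intro closed_vimage F continuous_intros)
  ultimately have T: "closed T" by (simp add: closed_Int)
  then have Tb: "T \<in> sets borel" by (rule borel_closed)
  have "emeasure lborel T \<le> emeasure lborel {0..2 * pi}" by (intro emeasure_mono) (auto simp: T_def)
  then have fin: "emeasure lborel T \<noteq> \<infinity>" by (auto simp: top_unique)
  have "measure lborel T = 0"
  proof (rule ccontr)
    assume "measure lborel T \<noteq> 0"
    then have m: "0 < measure lborel T" using measure_nonneg[of lborel T] by linarith
    define \<delta> where "\<delta> = ((\<bar>C\<bar> + 1) / measure lborel T) powr (- 1 / g)"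
    have "(\<Sum>A\<in>{T}. \<delta> powr (- g) * measure lborel A) \<le> C"
    proof (rule cb[unfolded cover_bound_def, rule_format, of "{T}" "\<lambda>_. \<delta>"])
      show "A \<in> sets borel \<and> A \<subseteq> {0..2 * pi} \<and> 0 < \<delta> \<and> (\<forall>t\<in>A. \<exists>e\<in>circle_lift F. cmod (cis t - e) \<le> \<delta>)" if "A \<in> {T}" for A
      proof (intro conjI ballI)
        show d: "0 < \<delta>" using m by (auto simp: \<delta>_def)
        show "\<exists>e\<in>circle_lift F. cmod (cis t - e) \<le> \<delta>" if "t \<in> A" for t
          using that \<open>A \<in> {T}\<close> d by (intro bexI[of _ "cis t"]) (auto simp: T_def cis_circle_lift)
      qed (use that Tb in \<open>auto simp: T_def\<close>)
    qed auto
    moreover have "\<delta> powr (- g) = (\<bar>C\<bar> + 1) / measure lborel T"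
      using m g by (simp add: \<delta>_def powr_powr)
    ultimately show False using m by simp
  qed
  then have "T \<in> null_sets lborel" using Tb fin by (simp add: null_sets_def emeasure_eq_ennreal_measure)
  then have "negligible T" by (simp add: negligible_iff_null_sets null_sets_completionI)
  then have "negligible ((\<lambda>t. 2 * cos t) ` T)"
  proof (intro negligible_differentiable_image_negligible)
    have "((\<lambda>t. 2 * cos t) has_real_derivative - 2 * sin x) (at x within T)" for x
      by (auto intro!: derivative_eq_intros)
    then show "(\<lambda>t. 2 * cos t) differentiable_on T"
      unfolding differentiable_on_def has_field_derivative_def using differentiableI by blast
  qed auto
  moreover have "F \<subseteq> (\<lambda>t. 2 * cos t) ` T"
  proof
    fix x assume x: "x \<in> F"
    then have "-1 \<le> x / 2" "x / 2 \<le> 1" using F by auto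
    then have "2 * cos (arccos (x / 2)) = x" "0 \<le> arccos (x / 2)" "arccos (x / 2) \<le> pi"
      by (auto simp: arccos_lbound arccos_ubound)
    then show "x \<in> (\<lambda>t. 2 * cos t) ` T"
      using x by (intro image_eqI[of _ _ "arccos (x / 2)"]) (auto simp: T_def)
  qed
  ultimately have "negligible F" using negligible_subset by blast
  then show ?thesis
    using F(1) by (auto simp: negligible_iff_null_sets null_sets_def borel_closed)
qed

text \<open>The end points are the nearest points of F on either side of a point of the gap. A gap
  that reaches -2 or 2 may have no such point on that side, hence the exclusion.\<close>

lemma gap_interval:
  assumes F: "closed F" "F \<subseteq> {-2..2}" and l: "l \<in> adjacent_intervals F" "-2 \<notin> l" "2 \<notin> l"
  obtains a b where "a \<in> F" "b \<in> F" "a < b" "l = {a<..<b}"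
proof -
  have lc: "l \<in> components ({-2..2} - F)" using l(1) by (simp add: adjacent_intervals_def)
  then have conn: "connected l" and sub: "l \<subseteq> {-2..2} - F" and "l \<noteq> {}"
    using in_components_connected[OF lc] in_components_subset[OF lc] in_components_nonempty[OF lc] by simp_all
  then obtain x where x: "x \<in> l" by blast
  have max: "S \<subseteq> l" if "connected S" "S \<subseteq> {-2..2} - F" "x \<in> S" for S
    using components_maximal[OF lc that(1,2)] x that(3) by blast
  have icc: "{u..v} \<subseteq> l" if "u \<in> l" "v \<in> l" for u v
    using connected_contains_Icc[OF conn that] .
  have xs: "-2 \<le> x" "x \<le> 2" "x \<notin> F" using sub x by auto
  have nea: "F \<inter> {..x} \<noteq> {}"
  proof
    assume "F \<inter> {..x} = {}"
    then have "{-2..x} \<subseteq> l" using xs by (intro max) auto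
    then show False using l(2) xs by auto
  qed
  have neb: "F \<inter> {x..} \<noteq> {}"
  proof
    assume "F \<inter> {x..} = {}"
    then have "{x..2} \<subseteq> l" using xs by (intro max) auto
    then show False using l(3) xs by auto
  qed
  define a where "a = Sup (F \<inter> {..x})"
  define b where "b = Inf (F \<inter> {x..})"
  have a: "a \<in> F \<inter> {..x}" unfolding a_def
    by (rule closed_contains_Sup) (use nea F(1) in \<open>auto intro!: closed_Int bdd_aboveI[of _ x]\<close>)
  have b: "b \<in> F \<inter> {x..}" unfolding b_def
    by (rule closed_contains_Inf) (use neb F(1) in \<open>auto intro!: closed_Int bdd_belowI[of _ x]\<close>)
  have aU: "y \<le> a" if "y \<in> F" "y \<le> x" for y
    unfolding a_def using that by (intro cSup_upper) (auto intro!: bdd_aboveI[of _ x])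
  have bL: "b \<le> y" if "y \<in> F" "x \<le> y" for y
    unfolding b_def using that by (intro cInf_lower) (auto intro!: bdd_belowI[of _ x])
  have ax: "a < x" "x < b" using a b xs by (auto simp: less_le)
  have "{a<..<b} \<subseteq> l"
  proof (rule max)
    show "{a<..<b} \<subseteq> {-2..2} - F"
    proof
      fix y assume y: "y \<in> {a<..<b}"
      have "y \<notin> F" using aU[of y] bL[of y] y by (cases "y \<le> x") auto
      moreover have "-2 \<le> a" "b \<le> 2" using a b F(2) by auto
      ultimately show "y \<in> {-2..2} - F" using y by auto
    qed
  qed (use ax in auto)
  moreover have "l \<subseteq> {a<..<b}"
  proof
    fix y assume y: "y \<in> l"
    have "a < y"
    proof (rule ccontr)
      assume "\<not> a < y"
      then have "a \<in> l" using icc[OF y x] ax by auto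
      then show False using a sub by auto
    qed
    moreover have "y < b"
    proof (rule ccontr)
      assume "\<not> y < b"
      then have "b \<in> l" using icc[OF x y] ax by auto
      then show False using b sub by auto
    qed
    ultimately show "y \<in> {a<..<b}" by simp
  qed
  ultimately have "l = {a<..<b}" by blast
  then show ?thesis using that a b ax by auto
qed

lemma disjoint_adjacent: "l \<in> adjacent_intervals F \<Longrightarrow> m \<in> adjacent_intervals F \<Longrightarrow> l \<noteq> m \<Longrightarrow> l \<inter> m = {}"
  unfolding adjacent_intervals_def by (simp add: components_nonoverlap)

lemma finite_gaps_at:
  "finite {l \<in> adjacent_intervals F. x \<in> l}"
proof (cases "\<exists>l\<in>adjacent_intervals F. x \<in> l")
  case True
  then obtain m where m: "m \<in> adjacent_intervals F" "x \<in> m" by blast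
  then have "{l \<in> adjacent_intervals F. x \<in> l} \<subseteq> {m}" using disjoint_adjacent by blast
  then show ?thesis using finite_subset by blast
next
  case False
  then have "{l \<in> adjacent_intervals F. x \<in> l} = {}" by blast
  then show ?thesis by (simp only: finite.emptyI)
qed

text \<open>The cosine decreases on [0, \<pi>], so the right end b corresponds to the left angle
  \<alpha>; it is 1-Lipschitz, so the arc is at least half as long as the gap.\<close>

lemma gap_angles:
  assumes F: "F \<subseteq> {-2..2}" and ab: "a \<in> F" "b \<in> F" "a < b"
  shows "\<exists>\<alpha> \<alpha>'. 0 \<le> \<alpha> \<and> \<alpha> < \<alpha>' \<and> \<alpha>' \<le> pi \<and> {t \<in> {0<..<pi}. 2 * cos t \<in> {a<..<b}} = {\<alpha><..<\<alpha>'} \<and>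
    2 * cos \<alpha> = b \<and> b - a \<le> 2 * (\<alpha>' - \<alpha>)"
proof -
  have r: "-2 \<le> a" "b \<le> 2" using F ab by auto
  define \<alpha> where "\<alpha> = arccos (b / 2)"
  define \<alpha>' where "\<alpha>' = arccos (a / 2)"
  have \<alpha>: "0 \<le> \<alpha>" "\<alpha> \<le> pi" "cos \<alpha> = b / 2" using r ab(3) by (auto simp: \<alpha>_def arccos_lbound arccos_ubound)
  have \<alpha>': "0 \<le> \<alpha>'" "\<alpha>' \<le> pi" "cos \<alpha>' = a / 2" using r ab(3) by (auto simp: \<alpha>'_def arccos_lbound arccos_ubound)
  have lt: "\<alpha> < \<alpha>'" using cos_mono_less_eq[OF \<alpha>'(1,2) \<alpha>(1,2)] \<alpha>(3) \<alpha>'(3) ab(3) by simp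
  have "2 * cos t \<in> {a<..<b} \<longleftrightarrow> t \<in> {\<alpha><..<\<alpha>'}" if t: "0 < t" "t < pi" for t
  proof -
    have "\<alpha> < t \<longleftrightarrow> cos t < b / 2" using cos_mono_less_eq[of t \<alpha>] \<alpha> t by simp
    moreover have "t < \<alpha>' \<longleftrightarrow> a / 2 < cos t" using cos_mono_less_eq[of \<alpha>' t] \<alpha>' t by simp
    ultimately show ?thesis by auto
  qed
  then have "{t \<in> {0<..<pi}. 2 * cos t \<in> {a<..<b}} = {\<alpha><..<\<alpha>'}"
    unfolding set_eq_iff mem_Collect_eq greaterThanLessThan_iff[of _ 0 pi]
    using \<alpha>(1) \<alpha>'(2) by (meson greaterThanLessThan_iff le_less_trans less_le_trans)
  moreover have "b - a \<le> 2 * (\<alpha>' - \<alpha>)" using abs_le_D1[OF cos_diff_le[of \<alpha> \<alpha>']] lt unfolding \<alpha>(3) \<alpha>'(3) by simp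
  ultimately show ?thesis using \<alpha> \<alpha>' lt by (intro exI[of _ \<alpha>] exI[of _ \<alpha>']) simp
qed

text \<open>Each arc over a gap is taken with its own length as scale: all its points are that close
  to its end point \<alpha>, which lies over F. Its contribution is length^(-g) * length.\<close>

lemma cover_bound_gap_sum:
  assumes cb: "cover_bound (circle_lift F) g C" and g: "0 < g" "g < 1" and F: "closed F" "F \<subseteq> {-2..2}"
  shows "(\<lambda>l. measure lborel l powr (1 - g)) summable_on adjacent_intervals F"
proof -
  \<comment> \<open>Gaps containing an end of the segment; there are at most two, and they are added
    at the end.\<close>
  define I where "I = {l \<in> adjacent_intervals F. -2 \<in> l} \<union> {l \<in> adjacent_intervals F. 2 \<in> l}"
  define A where "A l = {t \<in> {0<..<pi}. 2 * cos t \<in> l}" for l :: "real set"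
  have gap: "\<exists>\<alpha> \<alpha>'. 0 \<le> \<alpha> \<and> \<alpha> < \<alpha>' \<and> \<alpha>' \<le> pi \<and> A l = {\<alpha><..<\<alpha>'} \<and> 2 * cos \<alpha> \<in> F \<and> measure lborel l \<le> 2 * (\<alpha>' - \<alpha>)"
    if l: "l \<in> adjacent_intervals F - I" for l
  proof -
    have "l \<in> adjacent_intervals F" "-2 \<notin> l" "2 \<notin> l" using l by (auto simp: I_def)
    then obtain a b where ab: "a \<in> F" "b \<in> F" "a < b" "l = {a<..<b}" by (rule gap_interval[OF F])
    have m: "measure lborel l = b - a" using ab by simp
    obtain \<alpha> \<alpha>' where \<alpha>: "0 \<le> \<alpha>" "\<alpha> < \<alpha>'" "\<alpha>' \<le> pi" "A l = {\<alpha><..<\<alpha>'}" "2 * cos \<alpha> = b" "b - a \<le> 2 * (\<alpha>' - \<alpha>)"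
      using gap_angles[OF F(2) ab(1-3)] unfolding A_def ab(4) by blast
    show ?thesis using \<alpha> ab(2) m by (intro exI[of _ \<alpha>] exI[of _ \<alpha>']) simp
  qed
  have "(\<lambda>l. measure lborel l powr (1 - g)) summable_on (adjacent_intervals F - I)"
  proof (rule nonneg_bdd_above_summable_on)
    show "bdd_above (sum (\<lambda>l. measure lborel l powr (1 - g)) ` {G. G \<subseteq> adjacent_intervals F - I \<and> finite G})"
    proof (rule bdd_aboveI2)
      fix G assume G': "G \<in> {G. G \<subseteq> adjacent_intervals F - I \<and> finite G}"
      then have G: "finite G" "\<And>l. l \<in> G \<Longrightarrow> l \<in> adjacent_intervals F - I" by auto
      have ne: "A l \<noteq> {}" if "l \<in> G" for l using gap[OF G(2)[OF that]] by (auto simp: greaterThanLessThan_empty_iff)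
      have Ad: "A l \<inter> A m = {}" if "l \<in> G" "m \<in> G" "l \<noteq> m" for l m
        using disjoint_adjacent[of l F m] G(2) that by (auto simp: A_def)
      have inj: "inj_on A G" using ne Ad by (intro inj_onI) blast
      have "(\<Sum>l\<in>G. measure lborel l powr (1 - g)) \<le> (\<Sum>l\<in>G. 2 powr (1 - g) * (measure lborel (A l) powr (- g) * measure lborel (A l)))"
      proof (rule sum_mono)
        fix l assume "l \<in> G"
        then obtain \<alpha> \<alpha>' where \<alpha>: "\<alpha> < \<alpha>'" "A l = {\<alpha><..<\<alpha>'}" "measure lborel l \<le> 2 * (\<alpha>' - \<alpha>)" using gap[OF G(2)] by blast
        have m: "measure lborel (A l) = \<alpha>' - \<alpha>" using \<alpha> by simp
        have "measure lborel l powr (1 - g) \<le> (2 * (\<alpha>' - \<alpha>)) powr (1 - g)" using \<alpha> g by (intro powr_mono2) auto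
        also have "\<dots> = 2 powr (1 - g) * ((\<alpha>' - \<alpha>) powr (- g) * (\<alpha>' - \<alpha>) powr 1)"
          using \<alpha>(1) by (simp only: powr_mult powr_add[symmetric]) simp
        also have "\<dots> = 2 powr (1 - g) * (measure lborel (A l) powr (- g) * measure lborel (A l))"
          using \<alpha>(1) m by simp
        finally show "measure lborel l powr (1 - g) \<le> 2 powr (1 - g) * (measure lborel (A l) powr (- g) * measure lborel (A l))" .
      qed
      also have "\<dots> = 2 powr (1 - g) * (\<Sum>X\<in>A ` G. measure lborel X powr (- g) * measure lborel X)"
        by (simp add: sum.reindex[OF inj] sum_distrib_left)
      also have "\<dots> \<le> 2 powr (1 - g) * C"
      proof (intro mult_left_mono cb[unfolded cover_bound_def, rule_format])
        show "disjoint (A ` G)"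
        proof (rule pairwiseI)
          fix X Y assume "X \<in> A ` G" "Y \<in> A ` G" "X \<noteq> Y"
          then obtain l m where "X = A l" "Y = A m" "l \<noteq> m" "l \<in> G" "m \<in> G" by blast
          then show "disjnt X Y" using Ad by (simp add: disjnt_def)
        qed
        fix X assume "X \<in> A ` G"
        then obtain l where l: "l \<in> G" "X = A l" by blast
        then obtain \<alpha> \<alpha>' where \<alpha>: "0 \<le> \<alpha>" "\<alpha> < \<alpha>'" "\<alpha>' \<le> pi" "A l = {\<alpha><..<\<alpha>'}" "2 * cos \<alpha> \<in> F" using gap[OF G(2)] by blast
        have m: "measure lborel X = \<alpha>' - \<alpha>" using \<alpha> l by simp
        show "X \<in> sets borel \<and> X \<subseteq> {0..2 * pi} \<and> 0 < measure lborel X \<and> (\<forall>t\<in>X. \<exists>e\<in>circle_lift F. cmod (cis t - e) \<le> measure lborel X)"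
        proof (intro conjI ballI)
          show "X \<subseteq> {0..2 * pi}" using \<alpha> l by auto
          fix t assume t: "t \<in> X"
          have "cmod (cis t - cis \<alpha>) \<le> \<bar>t - \<alpha>\<bar>" by (rule norm_cis_diff_le)
          also have "\<dots> \<le> measure lborel X" using t \<alpha>(4) l(2) unfolding m by auto
          finally show "\<exists>e\<in>circle_lift F. cmod (cis t - e) \<le> measure lborel X"
            using \<alpha>(5) by (auto simp: cis_circle_lift)
        qed (use \<alpha> l m in auto)
      qed (use G in auto)
      finally show "(\<Sum>l\<in>G. measure lborel l powr (1 - g)) \<le> 2 powr (1 - g) * C" .
    qed
  qed simp
  moreover have "(\<lambda>l. measure lborel l powr (1 - g)) summable_on I"
    unfolding I_def by (intro summable_on_finite finite_UnI finite_gaps_at)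
  ultimately have "(\<lambda>l. measure lborel l powr (1 - g)) summable_on ((adjacent_intervals F - I) \<union> I)"
    by (rule summable_on_union)
  moreover have "(adjacent_intervals F - I) \<union> I = adjacent_intervals F" by (auto simp: I_def)
  ultimately show ?thesis by simp
qed

text \<open>One point already makes the integral of 1 / dist diverge: the dyadic arc between the
  distances 2^(-j-1) and 2^(-j) contributes 1/2 for every j. The arcs stay within [0, 2\<pi>]
  because s \<le> \<pi>.\<close>

lemma cover_bound_1_empty:
  assumes cb: "cover_bound (circle_lift F) 1 C" and F: "F \<subseteq> {-2..2}"
  shows "F = {}"
proof (rule ccontr)
  assume "F \<noteq> {}"
  then obtain x where x: "x \<in> F" by blast
  define s where "s = arccos (x / 2)"
  have s: "0 \<le> s" "s \<le> pi" "2 * cos s = x"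
    using F x by (auto simp: s_def arccos_lbound arccos_ubound subset_iff)
  define I where "I j = {s + 1 / 2 ^ Suc j<..<s + 1 / 2 ^ j}" for j :: nat
  have lt: "1 / 2 ^ Suc j < (1 :: real) / 2 ^ j" for j by (simp add: field_simps)
  have m: "measure lborel (I j) = 1 / 2 ^ Suc j" for j
    using lt[of j] by (simp add: I_def field_simps)
  have disj': "I i \<inter> I j = {}" if "i < j" for i j
  proof -
    have "(2::real) ^ Suc i \<le> 2 ^ j" using that by (intro power_increasing) auto
    then have "1 / 2 ^ j \<le> 1 / (2::real) ^ Suc i" by (intro divide_left_mono) auto
    then show ?thesis by (auto simp: I_def)
  qed
  have disj: "I i \<inter> I j = {}" if "i \<noteq> j" for i j
    using disj'[of i j] disj'[of j i] that by (cases "i < j") auto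
  have ne: "I j \<noteq> {}" for j using lt[of j] by (auto simp: I_def greaterThanLessThan_empty_iff)
  have inj: "inj I" using disj ne by (intro injI) blast
  obtain n :: nat where n: "2 * C < real n" using reals_Archimedean2 by blast
  have "(\<Sum>A\<in>I ` {..<n}. (2 * measure lborel A) powr (- 1) * measure lborel A) \<le> C"
  proof (rule cb[unfolded cover_bound_def, rule_format])
    show "disjoint (I ` {..<n})"
    proof (rule pairwiseI)
      fix X Y assume "X \<in> I ` {..<n}" "Y \<in> I ` {..<n}" "X \<noteq> Y"
      then obtain i j where "X = I i" "Y = I j" "i \<noteq> j" by blast
      then show "disjnt X Y" using disj by (simp add: disjnt_def)
    qed
    fix A assume "A \<in> I ` {..<n}"
    then obtain j where j: "A = I j" by blast
    have one: "1 / 2 ^ j \<le> (1 :: real)" by simp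
    show "A \<in> sets borel \<and> A \<subseteq> {0..2 * pi} \<and> 0 < 2 * measure lborel A \<and> (\<forall>t\<in>A. \<exists>e\<in>circle_lift F. cmod (cis t - e) \<le> 2 * measure lborel A)"
    proof (intro conjI ballI)
      show "A \<subseteq> {0..2 * pi}"
      proof
        fix t assume "t \<in> A"
        then have "s + 1 / 2 ^ Suc j < t" "t < s + 1 / 2 ^ j" by (simp_all add: j I_def)
        moreover have "0 < 1 / (2::real) ^ Suc j" by simp
        ultimately show "t \<in> {0..2 * pi}" using s one pi_ge_two unfolding atLeastAtMost_iff by linarith
      qed
      fix t assume "t \<in> A"
      then have t: "s + 1 / 2 ^ Suc j < t" "t < s + 1 / 2 ^ j" by (simp_all add: j I_def)
      have "0 < 1 / (2::real) ^ Suc j" by simp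
      then have "\<bar>t - s\<bar> \<le> 1 / 2 ^ j" using t by linarith
      also have "1 / 2 ^ j = 2 * measure lborel A" unfolding j m by simp
      finally have "cmod (cis t - cis s) \<le> 2 * measure lborel A" using norm_cis_diff_le[of t s] by linarith
      then show "\<exists>e\<in>circle_lift F. cmod (cis t - e) \<le> 2 * measure lborel A"
        using s(3) x by (intro bexI[of _ "cis s"]) (auto simp: cis_circle_lift)
    qed (auto simp: j m I_def[of j, symmetric], simp add: I_def)
  qed auto
  also have "(\<Sum>A\<in>I ` {..<n}. (2 * measure lborel A) powr (- 1) * measure lborel A) = (\<Sum>j<n. (2 * (1 / 2 ^ Suc j)) powr (- 1) * (1 / 2 ^ Suc j))"
    using inj by (subst sum.reindex) (auto simp: m intro: inj_on_subset)
  also have "\<dots> = (\<Sum>j<n. 1 / 2)"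
    by (intro sum.cong) (auto simp: powr_minus field_simps)
  finally show False using n by simp
qed

section \<open>Hausdorff dimension and gap lengths\<close>

lemma emeasure_Union_le_finite_sums:
  assumes "countable \<L>" "\<L> \<subseteq> sets M"
    and le: "\<And>\<G>. finite \<G> \<Longrightarrow> \<G> \<subseteq> \<L> \<Longrightarrow> (\<Sum>l\<in>\<G>. emeasure M l) \<le> B"
  shows "emeasure M (\<Union>\<L>) \<le> B"
proof (cases "\<L> = {}")
  case False
  define X where "X n = \<Union>(from_nat_into \<L> ` {..n})" for n :: nat
  have sub: "from_nat_into \<L> ` {..n} \<subseteq> \<L>" for n using from_nat_into[OF False] by blast
  have Xs: "X n \<in> sets M" for n
    unfolding X_def using subset_trans[OF sub assms(2)] by (intro sets.finite_Union) auto
  have "(\<Union>n. X n) = \<Union>\<L>"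
  proof -
    have "(\<Union>n. X n) = \<Union>(range (from_nat_into \<L>))" unfolding X_def by auto
    then show ?thesis by (simp only: range_from_nat_into[OF False assms(1)])
  qed
  then have "emeasure M (\<Union>\<L>) = (SUP n. emeasure M (X n))"
    using Xs by (subst SUP_emeasure_incseq) (auto simp: incseq_def X_def intro: order_trans)
  also have "\<dots> \<le> B"
  proof (rule SUP_least)
    fix n
    have "emeasure M (\<Union>l\<in>from_nat_into \<L> ` {..n}. l) \<le> (\<Sum>l\<in>from_nat_into \<L> ` {..n}. emeasure M l)"
      using subset_trans[OF sub assms(2)] by (intro emeasure_subadditive_finite) auto
    also have "\<dots> \<le> B" using sub by (intro le) auto
    finally show "emeasure M (X n) \<le> B" by (simp add: X_def)
  qed
  finally show ?thesis .
qed simp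

text \<open>Both end points of the interval belong to \<open>F\<close>, so it is filled, up to a null set, by gaps that are no longer
  than the interval itself.\<close>

lemma interval_powr_le_gap_sum:
  assumes F: "closed F" "F \<subseteq> {-2..2}" "F \<in> null_sets lborel" and ab: "a \<in> F" "b \<in> F" "a < b"
    and s: "0 < s" "s \<le> 1" and summ: "(\<lambda>l. measure lborel l powr s) summable_on adjacent_intervals F"
  shows "(b - a) powr s \<le> (\<Sum>\<^sub>\<infinity>l | l \<in> adjacent_intervals F \<and> l \<subseteq> {a<..<b}. measure lborel l powr s)"
proof -
  define \<L> where "\<L> = {l. l \<in> adjacent_intervals F \<and> l \<subseteq> {a<..<b}}"
  define \<Sigma> where "\<Sigma> = (\<Sum>\<^sub>\<infinity>l\<in>\<L>. measure lborel l powr s)"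
  have r: "-2 \<le> a" "b \<le> 2" using F ab by auto
  have op: "open l" "l \<in> sets borel" "emeasure lborel l = ennreal (measure lborel l)" "measure lborel l \<le> b - a" if "l \<in> \<L>" for l
  proof -
    have "l \<in> adjacent_intervals F" "-2 \<notin> l" "2 \<notin> l" using that r by (auto simp: \<L>_def)
    then obtain c d where cd: "c < d" "l = {c<..<d}" by (rule gap_interval[OF F(1,2)])
    moreover have "a \<le> c" "d \<le> b" using that cd by (auto simp: \<L>_def greaterThanLessThan_subseteq_greaterThanLessThan)
    ultimately show "open l" "l \<in> sets borel" "emeasure lborel l = ennreal (measure lborel l)" "measure lborel l \<le> b - a"
      by auto
  qed
  have "disjoint \<L>"
  proof (rule pairwiseI)
    fix l m assume "l \<in> \<L>" "m \<in> \<L>" "l \<noteq> m"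
    then show "disjnt l m" using disjoint_adjacent[of l F m] by (simp add: \<L>_def disjnt_def)
  qed
  then have cnt: "countable \<L>" using countable_disjoint_open_subsets[of \<L>] op(1) by blast
  have cov: "{a<..<b} - F \<subseteq> \<Union>\<L>"
  proof
    fix x assume x: "x \<in> {a<..<b} - F"
    then have "x \<in> {-2..2} - F" using r by auto
    then have "x \<in> \<Union>(components ({-2..2} - F))" by (simp only: Union_components)
    then obtain l where l: "l \<in> components ({-2..2} - F)" "x \<in> l" by blast
    have conn: "connected l" using in_components_connected[OF l(1)] .
    have sub: "l \<subseteq> {-2..2} - F" using in_components_subset[OF l(1)] .
    have "l \<subseteq> {a<..<b}"
    proof
      fix y assume y: "y \<in> l"
      have "a < y"
      proof (rule ccontr)
        assume "\<not> a < y"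
        then have "a \<in> {y..x}" using x by auto
        then have "a \<in> l" using connected_contains_Icc[OF conn y l(2)] by blast
        then show False using ab(1) sub by blast
      qed
      moreover have "y < b"
      proof (rule ccontr)
        assume "\<not> y < b"
        then have "b \<in> {x..y}" using x by auto
        then have "b \<in> l" using connected_contains_Icc[OF conn l(2) y] by blast
        then show False using ab(2) sub by blast
      qed
      ultimately show "y \<in> {a<..<b}" by simp
    qed
    then show "x \<in> \<Union>\<L>" using l by (auto simp: \<L>_def adjacent_intervals_def)
  qed
  have summL: "(\<lambda>l. measure lborel l powr s) summable_on \<L>"
    by (rule summable_on_subset_banach[OF summ]) (auto simp: \<L>_def)
  have "ennreal (b - a) = emeasure lborel {a<..<b}" using ab by simp
  also have "\<dots> = emeasure lborel ({a<..<b} - F)"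
    using emeasure_Diff_null_set[OF F(3), of "{a<..<b}"] by simp
  also have "\<dots> \<le> emeasure lborel (\<Union>\<L>)"
    using cov cnt op(2) by (intro emeasure_mono) (auto intro!: sets.countable_Union)
  also have "\<dots> \<le> ennreal ((b - a) powr (1 - s) * \<Sigma>)"
  proof (rule emeasure_Union_le_finite_sums[OF cnt])
    fix \<G> assume G: "finite \<G>" "\<G> \<subseteq> \<L>"
    \<comment> \<open>A gap inside the interval is not longer than it, so all but the power s of its
      length is bounded by the corresponding power of b - a, which is divided out at the
      end.\<close>
    have "(\<Sum>l\<in>\<G>. measure lborel l) \<le> (\<Sum>l\<in>\<G>. (b - a) powr (1 - s) * measure lborel l powr s)"
    proof (rule sum_mono)
      fix l assume "l \<in> \<G>"
      then have l: "measure lborel l \<le> b - a" using op(4) G by blast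
      have "measure lborel l = measure lborel l powr (1 - s) * measure lborel l powr s"
        by (simp add: powr_add[symmetric])
      also have "\<dots> \<le> (b - a) powr (1 - s) * measure lborel l powr s"
        using l s by (intro mult_right_mono powr_mono2) auto
      finally show "measure lborel l \<le> (b - a) powr (1 - s) * measure lborel l powr s" .
    qed
    also have "\<dots> = (b - a) powr (1 - s) * (\<Sum>l\<in>\<G>. measure lborel l powr s)" by (simp add: sum_distrib_left)
    also have "\<dots> \<le> (b - a) powr (1 - s) * \<Sigma>"
      unfolding \<Sigma>_def using G summL by (intro mult_left_mono finite_sum_le_infsum) auto
    finally have tot: "(\<Sum>l\<in>\<G>. measure lborel l) \<le> (b - a) powr (1 - s) * \<Sigma>" .
    have "(\<Sum>l\<in>\<G>. emeasure lborel l) = (\<Sum>l\<in>\<G>. ennreal (measure lborel l))"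
      using G op(3) by (intro sum.cong) auto
    also have "\<dots> = ennreal (\<Sum>l\<in>\<G>. measure lborel l)" by (intro sum_ennreal) simp
    also have "\<dots> \<le> ennreal ((b - a) powr (1 - s) * \<Sigma>)" using tot by (rule ennreal_leI)
    finally show "(\<Sum>l\<in>\<G>. emeasure lborel l) \<le> ennreal ((b - a) powr (1 - s) * \<Sigma>)" .
  qed (use op(2) in auto)
  finally have "b - a \<le> (b - a) powr (1 - s) * \<Sigma>"
    by (subst (asm) ennreal_le_iff) (auto simp: \<Sigma>_def intro!: mult_nonneg_nonneg infsum_nonneg)
  moreover have "b - a = (b - a) powr (1 - s) * (b - a) powr s" using ab by (simp add: powr_add[symmetric])
  ultimately have "(b - a) powr (1 - s) * (b - a) powr s \<le> (b - a) powr (1 - s) * \<Sigma>" by linarith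
  then show ?thesis using ab by (simp add: \<Sigma>_def \<L>_def)
qed

text \<open>F is cut into its pieces in short cells. The hull of a piece has its end points in F, so
  the power s of its length is at most the gap sum inside the hull. Gaps of positive length in the
  finite set G are longer than a cell, so only the tail outside G contributes, and it is at most
  \<eta>.\<close>

theorem hausdorff_dim_le_gap_exponent:
  assumes F: "closed F" "F \<subseteq> {-2..2}" "F \<in> null_sets lborel"
    and s: "0 < s" "s \<le> 1" and summ: "(\<lambda>l. measure lborel l powr s) summable_on adjacent_intervals F"
  shows "hausdorff_dim (complex_of_real ` F) \<le> ereal s"
proof -
  let ?A = "adjacent_intervals F"
  let ?m = "\<lambda>l :: real set. measure lborel l powr s"
  have content: "hausdorff_content s \<delta> (complex_of_real ` F) \<le> ennreal \<eta>" if \<delta>: "0 < \<delta>" and \<eta>: "0 < \<eta>" for \<delta> \<eta>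
  proof -
    obtain G where G: "finite G" "G \<subseteq> ?A" "dist (sum ?m G) (infsum ?m ?A) \<le> \<eta>"
      using infsum_finite_approximation[OF summ \<eta>] by blast
    have "infsum ?m ?A = sum ?m G + infsum ?m (?A - G)"
    proof -
      have "infsum ?m (G \<union> (?A - G)) = infsum ?m G + infsum ?m (?A - G)"
        using G(1) summable_on_subset_banach[OF summ, of "?A - G"] by (intro infsum_Un_disjoint) auto
      moreover have "G \<union> (?A - G) = ?A" using G(2) by blast
      ultimately show ?thesis using G(1) by simp
    qed
    then have tail: "infsum ?m (?A - G) \<le> \<eta>" using G(3) by (simp add: dist_real_def)
    \<comment> \<open>Cells shorter than \<mu> contain no gap of G of positive length, and their
      diameter is below \<delta>. Gaps of measure 0 contribute \<open>0 powr s = 0\<close>.\<close>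
    define \<mu> where "\<mu> = Min (insert \<delta> (measure lborel ` {l \<in> G. 0 < measure lborel l}))"
    have \<mu>: "0 < \<mu>" "\<mu> \<le> \<delta>" "\<And>l. l \<in> G \<Longrightarrow> 0 < measure lborel l \<Longrightarrow> \<mu> \<le> measure lborel l"
      using G(1) \<delta> by (auto simp: \<mu>_def)
    obtain n :: nat where n: "4 / \<mu> < real n" using reals_Archimedean2 by blast
    then have n0: "0 < real n" using \<mu>(1) by (smt (verit) divide_pos_pos)
    define h where "h = 4 / real n"
    have h: "0 < h" "h < \<mu>" using n n0 \<mu>(1) by (simp_all add: h_def field_simps)
    define I where "I k = {-2 + h * real k..-2 + h * real (Suc k)}" for k
    define a where "a k = Inf (F \<inter> I k)" for k
    define b where "b k = Sup (F \<inter> I k)" for k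
    have ab: "a k \<in> F \<inter> I k" "b k \<in> F \<inter> I k" "F \<inter> I k \<subseteq> {a k..b k}" if "F \<inter> I k \<noteq> {}" for k
    proof -
      have cl: "closed (F \<inter> I k)" using F(1) by (auto simp: I_def)
      have bd: "bdd_below (F \<inter> I k)" "bdd_above (F \<inter> I k)"
        by (auto simp: I_def intro!: bdd_below_Int2 bdd_above_Int2)
      show "a k \<in> F \<inter> I k" unfolding a_def by (rule closed_contains_Inf[OF that bd(1) cl])
      show "b k \<in> F \<inter> I k" unfolding b_def by (rule closed_contains_Sup[OF that bd(2) cl])
      show "F \<inter> I k \<subseteq> {a k..b k}"
        unfolding a_def b_def using cInf_lower[OF _ bd(1)] cSup_upper[OF _ bd(2)] by auto
    qed
    define U where "U k = (if k < n then complex_of_real ` (F \<inter> I k) else {})" for k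
    define \<L> where "\<L> k = {l. l \<in> ?A \<and> l \<subseteq> {a k<..<b k}}" for k
    have diam: "bounded (U k) \<and> diameter (U k) \<le> \<delta> \<and> diameter (U k) powr s \<le> infsum ?m (\<L> k - G)" for k
    proof (cases "k < n \<and> F \<inter> I k \<noteq> {}")
      case True
      then have k: "F \<inter> I k \<noteq> {}" by blast
      have le: "a k \<le> b k" "b k - a k \<le> h" using ab[OF k] by (auto simp: I_def algebra_simps)
      have bU: "bounded (U k)"
      proof -
        have "bounded (F \<inter> I k)" by (rule bounded_subset[of "I k"]) (auto simp: I_def)
        then show ?thesis unfolding U_def by (auto intro!: bounded_linear_image bounded_linear_of_real)
      qed
      have dU: "diameter (U k) \<le> b k - a k"
      proof (rule diameter_le)
        fix x y assume "x \<in> U k" "y \<in> U k"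
        then obtain x' y' where "x = of_real x'" "y = of_real y'" "x' \<in> F \<inter> I k" "y' \<in> F \<inter> I k"
          using True by (auto simp: U_def)
        moreover have "\<bar>x' - y'\<bar> \<le> b k - a k"
          using ab(3)[OF k] \<open>x' \<in> F \<inter> I k\<close> \<open>y' \<in> F \<inter> I k\<close> by (auto simp: subset_iff abs_le_iff) (smt (verit))+
        ultimately show "norm (x - y) \<le> b k - a k" by (simp add: of_real_diff[symmetric] del: of_real_diff)
      qed (use le in auto)
      have "diameter (U k) powr s \<le> infsum ?m (\<L> k - G)"
      proof (cases "a k < b k")
        case False
        \<comment> \<open>A piece that is a single point contributes
          \<open>0 powr s = 0\<close>.\<close>
        then have "diameter (U k) = 0" using dU diameter_ge_0[OF bU] by linarith
        then show ?thesis by (simp add: infsum_nonneg)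
      next
        case True
        have "diameter (U k) powr s \<le> (b k - a k) powr s"
          using dU s diameter_ge_0[OF bU] by (intro powr_mono2) auto
        also have "\<dots> \<le> infsum ?m (\<L> k)"
          unfolding \<L>_def using ab[OF k] by (intro interval_powr_le_gap_sum F True s summ) auto
        also have "\<dots> = infsum ?m (\<L> k - G)"
        proof (rule infsum_cong_neutral)
          fix l assume "l \<in> \<L> k - (\<L> k - G)"
          then have l: "l \<in> \<L> k" "l \<in> G" by auto
          have "emeasure lborel l \<le> emeasure lborel {a k<..<b k}" using l(1) by (intro emeasure_mono) (auto simp: \<L>_def)
          then have "measure lborel l \<le> measure lborel {a k<..<b k}"
            unfolding measure_def by (intro enn2real_mono) (auto simp: True less_imp_le)
          then have "measure lborel l < \<mu>" using le h(2) True by simp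
          then have "measure lborel l = 0" using \<mu>(3)[OF l(2)] measure_nonneg[of lborel l] by linarith
          then show "?m l = 0" by simp
        qed auto
        finally show ?thesis .
      qed
      moreover have "diameter (U k) \<le> \<delta>" using dU le h \<mu> by linarith
      ultimately show ?thesis using bU by blast
    next
      case False
      then have "U k = {}" by (auto simp: U_def)
      then show ?thesis using \<delta> by (simp add: infsum_nonneg)
    qed
    have cover: "complex_of_real ` F \<subseteq> (\<Union>i. U i)"
    proof
      fix z assume "z \<in> complex_of_real ` F"
      then obtain x where x: "x \<in> F" "z = of_real x" by blast
      define k0 where "k0 = nat \<lfloor>(x + 2) / h\<rfloor>"
      have x2: "0 \<le> x + 2" "x + 2 \<le> 4" using x F(2) by auto
      have k0: "real k0 \<le> (x + 2) / h" "(x + 2) / h < real k0 + 1"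
        using x2(1) h(1) unfolding k0_def by (simp_all add: floor_divide_lower)
      \<comment> \<open>The minimum matters only for x = 2, which is put into the last cell.\<close>
      define k where "k = min k0 (n - 1)"
      have kn: "k < n" using n0 by (auto simp: k_def)
      have "x \<in> I k"
      proof (cases "k0 < n")
        case True
        then have "k = k0" by (simp add: k_def)
        then show ?thesis using k0 h(1) by (simp add: I_def field_simps)
      next
        case False
        then have k: "k = n - 1" "real (Suc k) = real n" using n0 by (auto simp: k_def of_nat_diff)
        have "real n \<le> (x + 2) / h" using k0(1) False by linarith
        then have "h * real n \<le> x + 2" using h(1) by (simp add: field_simps)
        moreover have hn: "h * real n = 4" using n0 by (simp add: h_def)
        moreover have "h * real k \<le> h * real n" using k(1) h(1) by (intro mult_left_mono) auto
        ultimately show ?thesis using x2 unfolding I_def k(2) hn by auto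
      qed
      then show "z \<in> (\<Union>i. U i)" using x kn by (auto simp: U_def)
    qed
    \<comment> \<open>Neighbouring cells share an end point, but gaps lie inside the open hulls,
      which do not meet; hence no gap is counted twice.\<close>
    have disj: "(\<L> i - G) \<inter> (\<L> j - G) = {}" if "i < j" "F \<inter> I i \<noteq> {}" "F \<inter> I j \<noteq> {}" for i j
    proof -
      have "h * real (Suc i) \<le> h * real j" using that(1) h(1) by (intro mult_left_mono) auto
      then have "b i \<le> a j" using ab(2)[OF that(2)] ab(1)[OF that(3)] unfolding I_def by auto
      then have "l = {}" if "l \<in> \<L> i" "l \<in> \<L> j" for l using that by (fastforce simp: \<L>_def)
      moreover have "{} \<notin> ?A" using in_components_nonempty unfolding adjacent_intervals_def by blast
      ultimately show ?thesis by (auto simp: \<L>_def)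
    qed
    define N where "N = {k. k < n \<and> F \<inter> I k \<noteq> {}}"
    have finN: "finite N" by (simp add: N_def)
    have "(\<Sum>i\<in>N. infsum ?m (\<L> i - G)) = infsum ?m (\<Union>i\<in>N. \<L> i - G)"
    proof (rule sum_infsum[OF finN])
      show "?m summable_on \<L> i - G" for i by (rule summable_on_subset_banach[OF summ]) (auto simp: \<L>_def)
      show "(\<L> i - G) \<inter> (\<L> j - G) = {}" if "i \<in> N" "j \<in> N" "i \<noteq> j" for i j
        using disj[of i j] disj[of j i] that unfolding N_def by (cases "i < j") auto
    qed
    also have "\<dots> \<le> infsum ?m (?A - G)"
    proof (rule infsum_mono2)
      show "?m summable_on (\<Union>i\<in>N. \<L> i - G)" "?m summable_on (?A - G)"
        by (rule summable_on_subset_banach[OF summ]; auto simp: \<L>_def)+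
    qed (auto simp: \<L>_def)
    also have "\<dots> \<le> \<eta>" by (rule tail)
    finally have tot: "(\<Sum>i\<in>N. infsum ?m (\<L> i - G)) \<le> \<eta>" .
    have "(\<Sum>i. ennreal (diameter (U i) powr s)) = (\<Sum>i\<in>N. ennreal (diameter (U i) powr s))"
      by (rule suminf_finite[OF finN]) (auto simp: N_def U_def)
    also have "\<dots> \<le> (\<Sum>i\<in>N. ennreal (infsum ?m (\<L> i - G)))"
      using diam by (intro sum_mono ennreal_leI) blast
    also have "\<dots> = ennreal (\<Sum>i\<in>N. infsum ?m (\<L> i - G))"
      by (intro sum_ennreal infsum_nonneg) simp
    also have "\<dots> \<le> ennreal \<eta>" using tot by (rule ennreal_leI)
    finally have "(\<Sum>i. ennreal (diameter (U i) powr s)) \<le> ennreal \<eta>" .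
    moreover have "hausdorff_content s \<delta> (complex_of_real ` F) \<le> (\<Sum>i. ennreal (diameter (U i) powr s))"
      unfolding hausdorff_content_def using cover diam by (intro INF_lower) auto
    ultimately show ?thesis by (rule order_trans[rotated])
  qed
  have "hausdorff_content s \<delta> (complex_of_real ` F) \<le> 0" if "0 < \<delta>" for \<delta>
    by (rule ennreal_le_epsilon) (use content[OF that] in simp)
  then have "hausdorff_measure s (complex_of_real ` F) \<le> 0"
    unfolding hausdorff_measure_def by (intro SUP_least) auto
  then have "hausdorff_measure s (complex_of_real ` F) = 0" by simp
  then show ?thesis unfolding hausdorff_dim_def using s by (intro INF_lower) simp
qed

section \<open>Limit points of the discrete spectrum\<close>

text \<open>The two solutions are inverse to each other, so one lies in the open disc unless both
  are on the circle; in that case z is twice a real part and belongs to the segment.\<close>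

lemma joukowski_disk:
  assumes "z \<notin> complex_of_real ` {-2..2}"
  obtains \<zeta> where "\<zeta> \<noteq> 0" "cmod \<zeta> < 1" "z = \<zeta> + 1 / \<zeta>"
proof -
  define r where "r = csqrt (z\<^sup>2 - 4)"
  define x where "x = (z + r) / 2"
  have "r\<^sup>2 = z\<^sup>2 - 4" by (simp add: r_def)
  then have xy: "x * (z - x) = 1" by (simp add: x_def field_simps power2_eq_square)
  then have x0: "x \<noteq> 0" by auto
  then have z: "z = x + 1 / x" using xy by (simp add: field_simps)
  have "cmod x \<noteq> 1"
  proof
    assume n: "cmod x = 1"
    then have "1 / x = cnj x" using complex_norm_square[of x] x0 by (simp add: field_simps)
    then have "z = complex_of_real (2 * Re x)" using z by (simp add: complex_add_cnj)
    moreover have "2 * Re x \<in> {-2..2}" using abs_Re_le_cmod[of x] n by auto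
    ultimately show False using assms by blast
  qed
  then consider "cmod x < 1" | "1 < cmod x" by linarith
  then show ?thesis
  proof cases
    case 1
    then show ?thesis using that[of x] x0 z by blast
  next
    case 2
    then have "cmod (1 / x) < 1" by (simp add: norm_divide divide_less_eq)
    then show ?thesis using that[of "1 / x"] x0 z by (simp add: add.commute)
  qed
qed

text \<open>Closeness of spectral points makes the product of the distances to both preimages e and
  1/e small. For e inside the disc the second distance stays away from 0; for e on the circle either
  factor may be the small one.\<close>

lemma joukowski_factor:
  fixes \<zeta> e :: complex
  assumes "\<zeta> \<noteq> 0" "e \<noteq> 0"
  shows "(\<zeta> - e) * (\<zeta> - 1 / e) = \<zeta> * ((\<zeta> + 1 / \<zeta>) - (e + 1 / e))"
  using assms by (simp add: field_simps)

lemma (in weight) wnorm_le_cnj: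
  assumes "wnorm_le w f K"
  shows "wnorm_le w (\<lambda>z. cnj (f (cnj z))) K"
proof -
  obtain a where a: "\<And>F. finite F \<Longrightarrow> (\<Sum>n\<in>F. cmod (a n) * w n) \<le> K"
    "\<And>z. cmod z \<le> 1 \<Longrightarrow> ((\<lambda>n. a n * z ^ n) has_sum f z) UNIV"
    using assms unfolding wnorm_le_def by blast
  have "((\<lambda>n. cnj (a n) * z ^ n) has_sum cnj (f (cnj z))) UNIV" if "cmod z \<le> 1" for z
  proof -
    have "((\<lambda>n. cnj (a n * cnj z ^ n)) has_sum cnj (f (cnj z))) UNIV"
      using a(2)[of "cnj z"] that by (simp only: has_sum_cnj_iff complex_mod_cnj)
    then show ?thesis by simp
  qed
  then show ?thesis unfolding wnorm_le_def using a(1) by (intro exI[of _ "\<lambda>n. cnj (a n)"]) auto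
qed

lemma wnorm_le_regular:
  assumes f: "wnorm_le (\<lambda>n. exp (c * real n powr \<beta>)) f A" and c: "0 < c" "0 < \<beta>"
  shows "continuous_on (cball 0 1) f" "f holomorphic_on ball 0 1"
proof -
  obtain a where a: "rapid a" "\<And>z. cmod z \<le> 1 \<Longrightarrow> f z = pser a z"
    using wnorm_le_coeffs[OF f c] by blast
  have "continuous_on (cball 0 1) (pser a)"
    using pser_has_field_derivative[OF a(1)] by (rule DERIV_continuous_on)
  then show "continuous_on (cball 0 1) f"
    by (rule continuous_on_eq) (use a(2) in auto)
  have "pser a holomorphic_on ball 0 1"
  proof (rule holomorphic_onI)
    fix x :: complex assume x: "x \<in> ball 0 1"
    then have "(pser a has_field_derivative pser (diffs a) x) (at x within cball 0 1)"
      by (intro pser_has_field_derivative[OF a(1)]) auto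
    then have "(pser a has_field_derivative pser (diffs a) x) (at x within ball 0 1)"
      by (rule DERIV_subset) auto
    then show "pser a field_differentiable at x within ball 0 1"
      unfolding field_differentiable_def by blast
  qed
  then show "f holomorphic_on ball 0 1"
    by (rule holomorphic_transform) (use a(2) in auto)
qed

lemma discrete_spectrum_facts:
  assumes p: "1 \<le> p" and \<beta>: "0 < \<beta>" "\<beta> < 1" and D: "D \<in> P_class p \<beta>"
  shows "E_set D \<subseteq> complex_of_real ` {-2..2}"
    and "\<exists>C. cover_bound (circle_lift (complex_of_real -` E_set D)) (\<beta> / (1 - \<beta>)) C"
    and "bounded (discrete_spectrum D)"
proof -
  obtain c F K where c: "0 < c" and F: "wnorm_le (\<lambda>n. exp (c * real n powr \<beta>)) F K" "F 0 = 1"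
    and zero: "\<And>\<zeta>. \<zeta> \<noteq> 0 \<Longrightarrow> cmod \<zeta> < 1 \<Longrightarrow> eigenvalue D (\<zeta> + 1 / \<zeta>) \<Longrightarrow> F \<zeta> = 0"
    using perturbation_determinant[OF p \<beta>(1) less_imp_le[OF \<beta>(2)] D] by blast
  interpret weight "\<lambda>n. exp (c * real n powr \<beta>)" using c \<beta> by (intro weight_exp_powr) auto
  note regF = wnorm_le_regular[OF F(1) c \<beta>(1)]
  have spec: "\<exists>\<zeta>. \<zeta> \<noteq> 0 \<and> cmod \<zeta> < 1 \<and> z = \<zeta> + 1 / \<zeta> \<and> F \<zeta> = 0" if "z \<in> discrete_spectrum D" for z
  proof -
    have z: "z \<notin> complex_of_real ` {-2..2}" "eigenvalue D z" using that by (simp_all add: discrete_spectrum_def)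
    obtain \<zeta> where \<zeta>: "\<zeta> \<noteq> 0" "cmod \<zeta> < 1" "z = \<zeta> + 1 / \<zeta>" by (rule joukowski_disk[OF z(1)])
    then show ?thesis using zero[of \<zeta>] z(2) by blast
  qed
  have lim: "\<exists>\<zeta>. \<zeta> \<noteq> 0 \<and> cmod \<zeta> < 1 \<and> \<zeta> \<noteq> e \<and> F \<zeta> = 0 \<and> cmod (\<zeta> - e) * cmod (\<zeta> - 1 / e) < \<epsilon>"
    if e: "e \<noteq> 0" "e + 1 / e \<in> E_set D" and \<epsilon>: "0 < \<epsilon>" for e \<epsilon>
  proof -
    have "e + 1 / e islimpt discrete_spectrum D" using e(2) by (simp add: E_set_def)
    then obtain z where z: "z \<in> discrete_spectrum D" "z \<noteq> e + 1 / e" "dist z (e + 1 / e) < \<epsilon>"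
      using \<epsilon> unfolding islimpt_approachable by blast
    obtain \<zeta> where \<zeta>: "\<zeta> \<noteq> 0" "cmod \<zeta> < 1" "z = \<zeta> + 1 / \<zeta>" "F \<zeta> = 0" using spec[OF z(1)] by blast
    have "cmod (\<zeta> - e) * cmod (\<zeta> - 1 / e) = cmod \<zeta> * cmod (z - (e + 1 / e))"
      using arg_cong[OF joukowski_factor[OF \<zeta>(1) e(1)], of cmod] unfolding \<zeta>(3) norm_mult .
    also have "\<dots> \<le> 1 * cmod (z - (e + 1 / e))" using \<zeta>(2) by (intro mult_right_mono) auto
    also have "\<dots> < \<epsilon>" using z(3) by (simp add: dist_norm)
    finally show ?thesis using \<zeta> z(2) by blast
  qed
  show seg: "E_set D \<subseteq> complex_of_real ` {-2..2}"
  proof (rule ccontr)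
    assume "\<not> E_set D \<subseteq> complex_of_real ` {-2..2}"
    then obtain z where z: "z \<in> E_set D" "z \<notin> complex_of_real ` {-2..2}" by blast
    obtain e where e: "e \<noteq> 0" "cmod e < 1" "z = e + 1 / e" by (rule joukowski_disk[OF z(2)])
    \<comment> \<open>The distance of 1/e from the unit disc. It bounds the second factor from
      below, so the zeros accumulate at e inside the disc, against the identity theorem and F 0 =
      1.\<close>
    define \<kappa> where "\<kappa> = 1 / cmod e - 1"
    have \<kappa>: "0 < \<kappa>" using e by (simp add: \<kappa>_def)
    have "e islimpt {\<zeta> \<in> ball 0 1. F \<zeta> = 0}"
      unfolding islimpt_approachable
    proof (intro allI impI)
      fix \<epsilon> :: real assume "0 < \<epsilon>"
      then obtain \<zeta> where \<zeta>: "cmod \<zeta> < 1" "\<zeta> \<noteq> e" "F \<zeta> = 0" "cmod (\<zeta> - e) * cmod (\<zeta> - 1 / e) < \<epsilon> * \<kappa>"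
        using lim[OF e(1), of "\<epsilon> * \<kappa>"] z(1) e(3) \<kappa> by auto
      have "\<kappa> \<le> cmod (\<zeta> - 1 / e)"
        using norm_triangle_ineq2[of "1 / e" \<zeta>] \<zeta>(1) by (simp add: \<kappa>_def norm_divide norm_minus_commute)
      then have "cmod (\<zeta> - e) * \<kappa> \<le> cmod (\<zeta> - e) * cmod (\<zeta> - 1 / e)" by (intro mult_left_mono) auto
      then have "cmod (\<zeta> - e) * \<kappa> < \<epsilon> * \<kappa>" using \<zeta>(4) by linarith
      then have "dist \<zeta> e < \<epsilon>" using \<kappa> by (simp add: dist_norm)
      then show "\<exists>x'\<in>{\<zeta> \<in> ball 0 1. F \<zeta> = 0}. x' \<noteq> e \<and> dist x' e < \<epsilon>" using \<zeta> by auto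
    qed
    then have "F 0 = 0"
    proof (rule analytic_continuation[OF regF(2) open_ball connected_ball, rotated 2])
      show "F z = 0" if "z \<in> {\<zeta> \<in> ball 0 1. F \<zeta> = 0}" for z using that by simp
    qed (use e(2) in auto)
    then show False using F(2) by simp
  qed
  show "bounded (discrete_spectrum D)"
  proof -
    \<comment> \<open>Large eigenvalues correspond to \<zeta> near 0, where F is close to 1 and has
      no zeros.\<close>
    have "isCont F 0"
      using continuous_on_interior[OF regF(1), of 0] by (simp add: interior_cball)
    then obtain r where r: "0 < r" "\<And>x. dist x 0 < r \<Longrightarrow> dist (F x) (F 0) < 1"
      using continuous_at_eps_delta[THEN iffD1, rule_format, of 0 F 1] by auto
    have "cmod z \<le> 1 + 1 / r" if "z \<in> discrete_spectrum D" for z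
    proof -
      obtain \<zeta> where \<zeta>: "\<zeta> \<noteq> 0" "cmod \<zeta> < 1" "z = \<zeta> + 1 / \<zeta>" "F \<zeta> = 0" using spec[OF \<open>z \<in> _\<close>] by blast
      have "r \<le> cmod \<zeta>" using r(2)[of \<zeta>] \<zeta>(4) F(2) by fastforce
      then have "1 / cmod \<zeta> \<le> 1 / r" using r(1) by (intro divide_left_mono mult_pos_pos) auto
      moreover have "cmod z \<le> cmod \<zeta> + 1 / cmod \<zeta>"
        unfolding \<zeta>(3) using norm_triangle_ineq[of \<zeta> "1 / \<zeta>"] by (simp add: norm_divide)
      ultimately show ?thesis using \<zeta>(2) by linarith
    qed
    then show ?thesis unfolding bounded_iff by blast
  qed
  \<comment> \<open>A spectral limit point \<open>e + 1/e\<close> determines \<open>e\<close> only up to conjugation, so the zeros are made symmetric.\<close>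
  define f where "f z = F z * cnj (F (cnj z))" for z
  have f: "wnorm_le (\<lambda>n. exp (c * real n powr \<beta>)) f (K * K)"
    unfolding f_def by (intro wnorm_le_mult wnorm_le_cnj F)
  note regf = wnorm_le_regular[OF f c \<beta>(1)]
  obtain B L where B: "0 < B" and L: "0 < L" and flat: "\<And>e z. cmod e \<le> 1 \<Longrightarrow> cmod z \<le> 1 \<Longrightarrow>
    (\<forall>\<epsilon>>0. \<exists>x. x \<noteq> e \<and> cmod x \<le> 1 \<and> cmod (x - e) < \<epsilon> \<and> f x = 0) \<Longrightarrow>
    cmod (f z) \<le> B * exp (- ((L * cmod (z - e)) powr (- (\<beta> / (1 - \<beta>)))))"
    using flat_at_zero_limit[OF f c \<beta>] by blast
  let ?F = "complex_of_real -` E_set D"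
  have zeros: "\<exists>x. x \<noteq> e \<and> cmod x \<le> 1 \<and> cmod (x - e) < \<epsilon> \<and> f x = 0"
    if e: "e \<in> circle_lift ?F" and \<epsilon>: "0 < \<epsilon>" for e \<epsilon>
  proof -
    have e1: "cmod e = 1" and e2: "complex_of_real (2 * Re e) \<in> E_set D" using e by (auto simp: circle_lift_def)
    have e0: "e \<noteq> 0" using e1 by auto
    have ce: "1 / e = cnj e" using complex_norm_square[of e] e1 e0 by (simp add: field_simps)
    have "e + 1 / e \<in> E_set D" using e2 unfolding ce by (simp add: complex_add_cnj)
    \<comment> \<open>If a product of two distances is below \<epsilon>^2, one of them is below
      \<epsilon>. As 1/e is the conjugate of e, either \<zeta> or its conjugate is then close to
      e.\<close>
    then obtain \<zeta> where \<zeta>: "cmod \<zeta> < 1" "F \<zeta> = 0" "cmod (\<zeta> - e) * cmod (\<zeta> - 1 / e) < \<epsilon> * \<epsilon>"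
      using lim[OF e0, of "\<epsilon> * \<epsilon>"] \<epsilon> by auto
    have "cmod (\<zeta> - cnj e) = cmod (cnj \<zeta> - e)"
      using complex_mod_cnj[of "\<zeta> - cnj e"] by simp
    then have "cmod (\<zeta> - e) < \<epsilon> \<or> cmod (cnj \<zeta> - e) < \<epsilon>"
      using \<zeta>(3) \<epsilon> mult_mono[of \<epsilon> "cmod (\<zeta> - e)" \<epsilon> "cmod (cnj \<zeta> - e)"] unfolding ce by fastforce
    then show ?thesis
    proof
      assume "cmod (\<zeta> - e) < \<epsilon>"
      then show ?thesis using \<zeta> e1 by (intro exI[of _ \<zeta>]) (auto simp: f_def)
    next
      assume "cmod (cnj \<zeta> - e) < \<epsilon>"
      then show ?thesis using \<zeta> e1 by (intro exI[of _ "cnj \<zeta>"]) (auto simp: f_def)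
    qed
  qed
  have fe: "f e = 0" if e: "e \<in> circle_lift ?F" for e
  proof (rule ccontr)
    assume ne: "f e \<noteq> 0"
    have "cmod e = 1" using e by (simp add: circle_lift_def)
    then have "e \<in> cball 0 1" by simp
    then obtain d where d: "0 < d" "\<And>x. x \<in> cball 0 1 \<Longrightarrow> dist x e < d \<Longrightarrow> dist (f x) (f e) < cmod (f e)"
      using regf(1)[unfolded continuous_on_iff, rule_format, of e "cmod (f e)"] ne by auto
    obtain x where "cmod x \<le> 1" "cmod (x - e) < d" "f x = 0" using zeros[OF e d(1)] by blast
    then show False using d(2)[of x] by (simp add: dist_norm)
  qed
  have cl: "closed (circle_lift ?F)"
    unfolding E_set_def by (intro closed_circle_lift closed_vimage closed_limpts continuous_intros)
  show "\<exists>C. cover_bound (circle_lift ?F) (\<beta> / (1 - \<beta>)) C"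
  \<comment> \<open>Over an empty set only empty pieces are admissible; the distance function is
    used in the other case.\<close>
  proof (cases "circle_lift ?F = {}")
    case True
    have "cover_bound {} (\<beta> / (1 - \<beta>)) 0"
      unfolding cover_bound_def
    proof (intro allI impI sum_nonpos)
      fix \<S> :: "real set set" and \<delta> A
      assume "\<forall>A\<in>\<S>. A \<in> sets borel \<and> A \<subseteq> {0..2 * pi} \<and> 0 < \<delta> A \<and> (\<forall>t\<in>A. \<exists>e\<in>{}. cmod (cis t - e) \<le> \<delta> A)" "A \<in> \<S>"
      then have "A = {}" by blast
      then show "\<delta> A powr - (\<beta> / (1 - \<beta>)) * measure lborel A \<le> 0" by simp
    qed
    then show ?thesis unfolding True by blast
  next
    case False
    have "cover_bound (circle_lift ?F) (\<beta> / (1 - \<beta>)) (L powr (\<beta> / (1 - \<beta>)) * (2 * pi * ln B))"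
      unfolding cover_bound_def
    proof (intro allI impI)
      fix \<S> :: "real set set" and \<delta>
      assume S: "finite \<S>" "disjoint \<S>" "\<forall>A\<in>\<S>. A \<in> sets borel \<and> A \<subseteq> {0..2 * pi} \<and> 0 < \<delta> A \<and> (\<forall>t\<in>A. \<exists>e\<in>circle_lift ?F. cmod (cis t - e) \<le> \<delta> A)"
      show "(\<Sum>A\<in>\<S>. \<delta> A powr - (\<beta> / (1 - \<beta>)) * measure lborel A) \<le> L powr (\<beta> / (1 - \<beta>)) * (2 * pi * ln B)"
      proof (rule flat_cover_bound[OF regf _ cl False B L, where S = "\<lambda>A. A"])
        show "f 0 = 1" by (simp add: f_def F(2))
        show "0 < \<beta> / (1 - \<beta>)" using \<beta> by simp
        show "f z = 0" if "z \<in> circle_lift ?F" for z using fe[OF that] .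
        show "cmod (f z) \<le> B * exp (- ((L * cmod (z - e)) powr - (\<beta> / (1 - \<beta>))))" if "e \<in> circle_lift ?F" "cmod z \<le> 1" for e z
          using that zeros[OF that(1)] by (intro flat) (auto simp: circle_lift_def)
        show "disjoint_family_on (\<lambda>A. A) \<S>"
          using S(2) by (auto simp: disjoint_family_on_def pairwise_def disjnt_def)
      qed (use S in blast)+
    qed
    then show ?thesis by blast
  qed
qed

theorem theorem5p1:
  fixes p :: nat and \<beta> :: real and D :: "int \<Rightarrow> int \<Rightarrow> complex"
  assumes "p \<ge> 1"
  shows "(0 < \<beta> \<and> \<beta> < 1/2 \<and> D \<in> P_class p \<beta> \<longrightarrow>
            E_set D \<subseteq> complex_of_real ` {-2..2} \<and>
            closed (E_set D) \<and>
            complex_of_real -` E_set D \<in> null_sets lborel \<and>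
            hausdorff_dim (E_set D) \<le> ereal (conv_exponent (complex_of_real -` E_set D)) \<and>
            conv_exponent (complex_of_real -` E_set D) \<le> (1 - 2 * \<beta>) / (1 - \<beta>))
       \<and> (D \<in> P_class p (1/2) \<longrightarrow>
            E_set D = {} \<and> finite (discrete_spectrum D))"
proof (intro conjI impI; (elim conjE)?)
  have closedE: "closed (E_set D)" unfolding E_set_def by (rule closed_limpts)
  define F where "F = complex_of_real -` E_set D"
  have closedF: "closed F" unfolding F_def by (intro closed_vimage closedE continuous_intros)
  {
    assume \<beta>: "0 < \<beta>" "\<beta> < 1/2" and D: "D \<in> P_class p \<beta>"
    define g where "g = \<beta> / (1 - \<beta>)"
    have g: "0 < g" "g < 1" "1 - g = (1 - 2 * \<beta>) / (1 - \<beta>)" using \<beta> by (simp_all add: g_def field_simps)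
    have \<beta>1: "\<beta> < 1" using \<beta> by simp
    note facts = discrete_spectrum_facts[OF assms \<beta>(1) \<beta>1 D]
    have F2: "F \<subseteq> {-2..2}" using facts(1) by (auto simp: F_def)
    have EF: "E_set D = complex_of_real ` F" using facts(1) by (auto simp: F_def)
    obtain C where C: "cover_bound (circle_lift F) g C" using facts(2) unfolding F_def g_def by blast
    have nullF: "F \<in> null_sets lborel" by (rule cover_bound_null[OF C g(1) closedF F2])
    define X where "X = {\<epsilon>. \<epsilon> > 0 \<and> (\<lambda>l. measure lborel l powr \<epsilon>) summable_on adjacent_intervals F}"
    have gX: "1 - g \<in> X" unfolding X_def using cover_bound_gap_sum[OF C g(1,2) closedF F2] g(2) by simp
    have dim1: "hausdorff_dim (E_set D) \<le> ereal x" if "x \<in> X" "x \<le> 1" for x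
      unfolding EF using that by (intro hausdorff_dim_le_gap_exponent closedF F2 nullF) (auto simp: X_def)
    \<comment> \<open>Exponents above 1 are compared with 1 - g, since the covering estimate
      concerns exponents up to 1.\<close>
    have dim: "hausdorff_dim (E_set D) \<le> ereal x" if "x \<in> X" for x
    proof (cases "x \<le> 1")
      case False
      have "hausdorff_dim (E_set D) \<le> ereal (1 - g)" using gX g by (intro dim1) auto
      also have "\<dots> \<le> ereal x" using False g by simp
      finally show ?thesis .
    qed (use dim1 that in blast)
    have conv: "conv_exponent F = Inf X" by (simp add: conv_exponent_def X_def)
    have "Inf X \<le> 1 - g" using gX by (intro cInf_lower) (auto simp: X_def intro!: bdd_belowI[of _ 0])
    then show "conv_exponent (complex_of_real -` E_set D) \<le> (1 - 2 * \<beta>) / (1 - \<beta>)"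
      using conv g(3) by (simp add: F_def)
    have "hausdorff_dim (E_set D) \<le> ereal (Inf X)"
    proof (rule ccontr)
      assume "\<not> hausdorff_dim (E_set D) \<le> ereal (Inf X)"
      then have "ereal (Inf X) < hausdorff_dim (E_set D)" by simp
      \<comment> \<open>The infimum need not be attained, so an exponent of X is chosen below a real
        number r that separates it from the dimension.\<close>
      then obtain r where r: "ereal (Inf X) < ereal r" "ereal r < hausdorff_dim (E_set D)"
        using ereal_dense2 by blast
      then obtain x where x: "x \<in> X" "x < r" using cInf_lessD[of X r] gX by auto
      have "hausdorff_dim (E_set D) \<le> ereal x" by (rule dim[OF x(1)])
      also have "\<dots> < ereal r" using x(2) by simp
      finally show False using r(2) by simp
    qed
    then show "hausdorff_dim (E_set D) \<le> ereal (conv_exponent (complex_of_real -` E_set D))"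
      using conv by (simp add: F_def)
    show "E_set D \<subseteq> complex_of_real ` {-2..2}" by (rule facts(1))
    show "closed (E_set D)" by (rule closedE)
    show "complex_of_real -` E_set D \<in> null_sets lborel" using nullF by (simp add: F_def)
  }
  assume D: "D \<in> P_class p (1/2)"
  have half: "0 < (1/2::real)" "1/2 < (1::real)" by simp_all
  note facts = discrete_spectrum_facts[OF assms half D]
  have F2: "F \<subseteq> {-2..2}" using facts(1) by (auto simp: F_def)
  \<comment> \<open>At \<beta> = 1/2 the exponent \<beta> / (1 - \<beta>) equals 1.\<close>
  obtain C where "cover_bound (circle_lift F) 1 C" using facts(2) by (auto simp: F_def)
  then have "F = {}" using F2 by (rule cover_bound_1_empty)
  moreover have "E_set D = complex_of_real ` F" using facts(1) by (auto simp: F_def)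
  ultimately show E: "E_set D = {}" by simp
  show "finite (discrete_spectrum D)"
  proof (rule ccontr)
    assume inf: "infinite (discrete_spectrum D)"
    \<comment> \<open>Boundedness excludes eigenvalues escaping to infinity, which the absence of
      limit points in the plane alone would allow.\<close>
    obtain R where "discrete_spectrum D \<subseteq> cball 0 R"
      using facts(3) by (auto simp: bounded_iff subset_iff)
    then obtain x where "x islimpt discrete_spectrum D"
      using inf compact_cball[of "0::complex" R] unfolding compact_eq_Bolzano_Weierstrass by blast
    then show False using E by (auto simp: E_set_def)
  qed
qed

end
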